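(* Let $\sigma,\rho\subseteq\mathbb{N}$ each be finite or cofinite, with associated label set $C$ and $s=|C|$, and let $n,k\ge 1$ be integers. Given tables $A_l,A_r:C^k\to\{0,1,\dots,n\}\cup\{\bot\}$, the join table $A_i:C^k\to\{0,1,\dots,n\}\cup\{\bot\}$ for the optimisation (minimisation, resp. maximisation) variant, defined by $$A_i(\vec c)=\operatorname{opt}\{A_l(\vec c_l)+A_r(\vec c_r)\;:\;\vec c_l,\vec c_r\in C^k,\ \vec c_l\oplus\vec c_r=\vec c,\ A_l(\vec c_l)\neq\bot,\ A_r(\vec c_r)\neq\bot\}$$ (with $\operatorname{opt}=\min$, resp. $\max$, and the optimum of the empty set equal to $\bot$), can be computed in $\mathcal{O}(s^{k+1}\,k\,n\,(k\log(s)+\log(n)))$ arithmetic operations.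
   Context: The label set is $C=C_\sigma\cup C_\rho$ (disjoint union), where for $\tau\in\{\sigma,\rho\}$: if $\tau$ is finite, $C_\tau=\{|0|_\tau,\dots,|\ell_\tau|_\tau\}$ with $\ell_\tau=\max\tau$; if $\tau=\mathbb{N}$, $C_\tau=\{|{\geq}0|_\tau\}$ (set $\ell_\tau=0$); if $\tau\neq\mathbb{N}$ is cofinite, $C_\tau=\{|0|_\tau,\dots,|\ell_\tau-1|_\tau,|{\geq}\ell_\tau|_\tau\}$ with $\ell_\tau=\max(\mathbb{N}\setminus\tau)+1$. The partial operation $\oplus$ on $C$: $a\oplus b$ is defined only if $a,b$ lie in the same $C_\tau$; then read $|j|_\tau$ as the number $j$ and $|{\geq}\ell_\tau|_\tau$ as $\ell_\tau$, let $m$ be the sum; if $C_\tau$ contains $|{\geq}\ell_\tau|_\tau$ and $m\ge\ell_\tau$ the result is $|{\geq}\ell_\tau|_\tau$, otherwise the result is $|m|_\tau$ if this label lies in $C_\tau$ and undefined otherwise. On $C^k$, $\vec c_l\oplus\vec c_r=\vec c$ means that $\oplus$ is defined in every coordinate and gives $\vec c$ coordinatewise. The symbol $\bot$ (written $\infty$ in the minimisation case) means that no partial solution exists. *)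

theory Defs
  imports Complex_Main
begin

section \<open>Labels and their partial addition\<close>

datatype side = Sigma_side | Rho_side

datatype label = Exact side nat | At_least side nat

definition fin_or_cofin :: "nat set \<Rightarrow> bool" where
  "fin_or_cofin \<tau> \<longleftrightarrow> finite \<tau> \<or> finite (UNIV - \<tau>)"

text \<open>For nonempty finite \<open>\<tau>\<close> the first branch is \<open>Max \<tau>\<close>; inserting \<open>0\<close> only fixes
  the value \<open>0\<close> for \<open>\<tau> = {}\<close>, where the maximum is undefined.\<close>

definition ell :: "nat set \<Rightarrow> nat" where
  "ell \<tau> = (if finite \<tau> then Max (insert 0 \<tau>)
            else if \<tau> = UNIV then 0
            else Max (UNIV - \<tau>) + 1)"

definition side_labels :: "side \<Rightarrow> nat set \<Rightarrow> label set" where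
  "side_labels t \<tau> =
     (if finite \<tau> then {Exact t j | j. j \<le> ell \<tau>}
      else if \<tau> = UNIV then {At_least t 0}
      else {Exact t j | j. j < ell \<tau>} \<union> {At_least t (ell \<tau>)})"

definition labels :: "nat set \<Rightarrow> nat set \<Rightarrow> label set" where
  "labels \<sigma> \<rho> = side_labels Sigma_side \<sigma> \<union> side_labels Rho_side \<rho>"

fun label_num :: "label \<Rightarrow> nat" where
  "label_num (Exact t j) = j"
| "label_num (At_least t j) = j"

definition side_oplus :: "side \<Rightarrow> nat set \<Rightarrow> label \<Rightarrow> label \<Rightarrow> label option" where
  "side_oplus t \<tau> a b =
     (let m = label_num a + label_num b in
      if At_least t (ell \<tau>) \<in> side_labels t \<tau> \<and> ell \<tau> \<le> m then Some (At_least t (ell \<tau>))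
      else if Exact t m \<in> side_labels t \<tau> then Some (Exact t m)
      else None)"

definition oplus :: "nat set \<Rightarrow> nat set \<Rightarrow> label \<Rightarrow> label \<Rightarrow> label option" where
  "oplus \<sigma> \<rho> a b =
     (if a \<in> side_labels Sigma_side \<sigma> \<and> b \<in> side_labels Sigma_side \<sigma>
        then side_oplus Sigma_side \<sigma> a b
      else if a \<in> side_labels Rho_side \<rho> \<and> b \<in> side_labels Rho_side \<rho>
        then side_oplus Rho_side \<rho> a b
      else None)"

definition label_vecs :: "nat set \<Rightarrow> nat set \<Rightarrow> nat \<Rightarrow> label list set" where
  "label_vecs \<sigma> \<rho> k = {c. length c = k \<and> set c \<subseteq> labels \<sigma> \<rho>}"

definition vec_oplus :: "nat set \<Rightarrow> nat set \<Rightarrow> label list \<Rightarrow> label list \<Rightarrow> label list \<Rightarrow> bool" where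
  "vec_oplus \<sigma> \<rho> cl cr c \<longleftrightarrow>
     length cl = length c \<and> length cr = length c \<and>
     (\<forall>i < length c. oplus \<sigma> \<rho> (cl ! i) (cr ! i) = Some (c ! i))"

section \<open>Tables and the join\<close>

text \<open>\<open>None\<close> is \<open>\<bottom>\<close> (\<open>\<infinity>\<close> for minimisation). The entries of a join of two tables with
  entries at most \<open>n\<close> may be as large as \<open>2 * n\<close>; they are not cut off.\<close>

type_synonym table = "label list \<Rightarrow> nat option"

definition tables :: "nat set \<Rightarrow> nat set \<Rightarrow> nat \<Rightarrow> nat \<Rightarrow> table set" where
  "tables \<sigma> \<rho> n k = {A. \<forall>c \<in> label_vecs \<sigma> \<rho> k. \<forall>a. A c = Some a \<longrightarrow> a \<le> n}"

datatype variant = Minimise | Maximise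

definition opt :: "variant \<Rightarrow> nat set \<Rightarrow> nat option" where
  "opt v S = (if S = {} then None
              else Some (case v of Minimise \<Rightarrow> Min S | Maximise \<Rightarrow> Max S))"

definition join :: "variant \<Rightarrow> nat set \<Rightarrow> nat set \<Rightarrow> nat \<Rightarrow> table \<Rightarrow> table \<Rightarrow> table" where
  "join v \<sigma> \<rho> k Al Ar c =
     opt v {a + b | a b cl cr. cl \<in> label_vecs \<sigma> \<rho> k \<and> cr \<in> label_vecs \<sigma> \<rho> k \<and>
                               vec_oplus \<sigma> \<rho> cl cr c \<and> Al cl = Some a \<and> Ar cr = Some b}"

section \<open>Programs and their operation counts\<close>

text \<open>Algorithms are programs of a loop language with two kinds of data: index variables
  holding natural numbers, and arrays of complex numbers with exact arithmetic. The table
  entries live in arrays. Array contents never influence index variables or control flow, so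
  table data can be processed only by the field operations and the test for zero; in
  particular it cannot be packed into long integers and unpacked by integer division.

  The counter \<open>ops\<close> charges one unit for every arithmetic operation on complex numbers, and
  also for every test for zero, every root of unity, every arithmetic operation on
  indices, every assignment, every comparison and every loop iteration.\<close>

type_synonym name = string

datatype iexp =
    IConst nat
  | IVar name
  | IAdd iexp iexp
  | ISub iexp iexp
  | IMul iexp iexp
  | IDiv iexp iexp
  | IMod iexp iexp

datatype dexp =
    Num iexp
  | Root iexp iexp
  | Get name iexp
  | Add dexp dexp
  | Sub dexp dexp
  | Mul dexp dexp
  | Div dexp dexp
  | Is_zero dexp

datatype com =
    Skip
  | Set_index name iexp
  | Set_array name iexp dexp
  | Seq com com
  | If_less iexp iexp com com
  | For name iexp com

record state =
  idx :: "name \<Rightarrow> nat"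
  arr :: "name \<Rightarrow> nat \<Rightarrow> complex"
  ops :: nat

primrec ival :: "iexp \<Rightarrow> state \<Rightarrow> nat" where
  "ival (IConst m) s = m"
| "ival (IVar x) s = idx s x"
| "ival (IAdd e f) s = ival e s + ival f s"
| "ival (ISub e f) s = ival e s - ival f s"
| "ival (IMul e f) s = ival e s * ival f s"
| "ival (IDiv e f) s = ival e s div ival f s"
| "ival (IMod e f) s = ival e s mod ival f s"

primrec iops :: "iexp \<Rightarrow> nat" where
  "iops (IConst m) = 0"
| "iops (IVar x) = 0"
| "iops (IAdd e f) = 1 + iops e + iops f"
| "iops (ISub e f) = 1 + iops e + iops f"
| "iops (IMul e f) = 1 + iops e + iops f"
| "iops (IDiv e f) = 1 + iops e + iops f"
| "iops (IMod e f) = 1 + iops e + iops f"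

primrec dval :: "dexp \<Rightarrow> state \<Rightarrow> complex" where
  "dval (Num e) s = of_nat (ival e s)"
| "dval (Root e f) s = cis (2 * pi * real (ival e s) / real (ival f s))"
| "dval (Get A e) s = arr s A (ival e s)"
| "dval (Add d e) s = dval d s + dval e s"
| "dval (Sub d e) s = dval d s - dval e s"
| "dval (Mul d e) s = dval d s * dval e s"
| "dval (Div d e) s = dval d s / dval e s"
| "dval (Is_zero d) s = (if dval d s = 0 then 1 else 0)"

primrec dops :: "dexp \<Rightarrow> nat" where
  "dops (Num e) = iops e"
| "dops (Root e f) = 1 + iops e + iops f"
| "dops (Get A e) = iops e"
| "dops (Add d e) = 1 + dops d + dops e"
| "dops (Sub d e) = 1 + dops d + dops e"
| "dops (Mul d e) = 1 + dops d + dops e"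
| "dops (Div d e) = 1 + dops d + dops e"
| "dops (Is_zero d) = 1 + dops d"

definition charge :: "nat \<Rightarrow> state \<Rightarrow> state" where
  "charge m s = s\<lparr>ops := ops s + m\<rparr>"

definition put_idx :: "name \<Rightarrow> nat \<Rightarrow> state \<Rightarrow> state" where
  "put_idx x m s = s\<lparr>idx := (idx s)(x := m)\<rparr>"

definition put_arr :: "name \<Rightarrow> nat \<Rightarrow> complex \<Rightarrow> state \<Rightarrow> state" where
  "put_arr A i z s = s\<lparr>arr := (arr s)(A := (arr s A)(i := z))\<rparr>"

primrec exec :: "com \<Rightarrow> state \<Rightarrow> state" where
  "exec Skip s = s"
| "exec (Set_index x e) s = charge (1 + iops e) (put_idx x (ival e s) s)"
| "exec (Set_array A e d) s = charge (1 + iops e + dops d) (put_arr A (ival e s) (dval d s) s)"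
| "exec (Seq c d) s = exec d (exec c s)"
| "exec (If_less e f c d) s =
     (if ival e s < ival f s then exec c else exec d) (charge (1 + iops e + iops f) s)"
| "exec (For x e c) s =
     fold (\<lambda>j r. exec c (charge 1 (put_idx x j r))) [0..<ival e s] (charge (1 + iops e) s)"

section \<open>Input and output format\<close>

text \<open>The labels are numbered \<open>0, \<dots>, s - 1\<close>, those of \<open>\<sigma>\<close> first, and a vector of labels
  is addressed by reading the numbers of its components as digits in base \<open>s\<close>.\<close>

fun label_index :: "nat set \<Rightarrow> label \<Rightarrow> nat" where
  "label_index \<sigma> (Exact Sigma_side j) = j"
| "label_index \<sigma> (At_least Sigma_side j) = j"
| "label_index \<sigma> (Exact Rho_side j) = card (side_labels Sigma_side \<sigma>) + j"
| "label_index \<sigma> (At_least Rho_side j) = card (side_labels Sigma_side \<sigma>) + j"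

definition vec_index :: "nat set \<Rightarrow> nat set \<Rightarrow> label list \<Rightarrow> nat" where
  "vec_index \<sigma> \<rho> c = (\<Sum>i<length c. label_index \<sigma> (c ! i) * card (labels \<sigma> \<rho>) ^ i)"

fun entry_code :: "nat option \<Rightarrow> complex" where
  "entry_code None = -1"
| "entry_code (Some a) = of_nat a"

definition holds_table :: "nat set \<Rightarrow> nat set \<Rightarrow> nat \<Rightarrow> state \<Rightarrow> name \<Rightarrow> table \<Rightarrow> bool" where
  "holds_table \<sigma> \<rho> k s X A \<longleftrightarrow>
     (\<forall>c \<in> label_vecs \<sigma> \<rho> k. arr s X (vec_index \<sigma> \<rho> c) = entry_code (A c))"

text \<open>The sets \<open>\<sigma>\<close> and \<open>\<rho>\<close> are passed as \<open>ell\<close> and a flag for finiteness, which determine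
  the labels and their addition. All memory not mentioned here has arbitrary contents.\<close>

definition initial_state ::
  "nat set \<Rightarrow> nat set \<Rightarrow> nat \<Rightarrow> nat \<Rightarrow> table \<Rightarrow> table \<Rightarrow> state \<Rightarrow> bool" where
  "initial_state \<sigma> \<rho> n k Al Ar s \<longleftrightarrow>
     idx s ''n'' = n \<and> idx s ''k'' = k \<and>
     idx s ''ell_sigma'' = ell \<sigma> \<and> idx s ''fin_sigma'' = of_bool (finite \<sigma>) \<and>
     idx s ''ell_rho'' = ell \<rho> \<and> idx s ''fin_rho'' = of_bool (finite \<rho>) \<and>
     holds_table \<sigma> \<rho> k s ''Al'' Al \<and> holds_table \<sigma> \<rho> k s ''Ar'' Ar \<and>
     ops s = 0"

end

theory Submission
  imports Defs
begin

text \<open>For every vector \<open>c\<close> and every \<open>v \<le> 2 n\<close> the program counts the pairs with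
  \<open>c\<^sub>l \<oplus> c\<^sub>r = c\<close> and \<open>A\<^sub>l(c\<^sub>l) + A\<^sub>r(c\<^sub>r) = v\<close>; the optimum is then the first or last \<open>v\<close> with a
  nonzero count. Values are convolved by a radix-2 Fourier transform of length \<open>N = 2 ^ m > 2 n\<close>.
  The algebra of a finite side is \<open>C[x]/(x ^ (l + 1))\<close>, that of a cofinite side is
  \<open>C[x]/(x ^ l) \<times> C\<close>. Both have nilpotents, and padding them to remove the truncation would
  cost a factor exponential in \<open>k\<close>. Instead the nilpotent part is deformed to \<open>x ^ q = \<epsilon>\<close>, which is
  diagonalised by a matrix of size \<open>s\<close>. The deformed product is affine in \<open>\<epsilon>\<close> in each coordinate,
  hence of degree at most \<open>k\<close> in total, and averaging over \<open>k + 1\<close> equidistant points \<open>\<epsilon>\<close> of the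
  unit circle leaves exactly the undeformed counts. With \<open>M = (k + 1) s ^ k N\<close> numbers in play,
  the Fourier transforms cost \<open>O(M log N)\<close> and the label transforms \<open>O(M k s)\<close>.\<close>

section \<open>Roots of unity\<close>

text \<open>Minimum and maximum have no subtraction, so no transform with an inverse applies to them
  directly; a count for each possible value lives in a ring, at the price of the factor
  \<open>n\<close>. Nilpotents have too few points for evaluation to separate elements, whereas
  \<open>x ^ q = \<epsilon>\<close> with \<open>\<epsilon> \<noteq> 0\<close> has \<open>q\<close>
  distinct roots. The stated bound has room for both parts of the cost: each side contributes at
  least one label, so \<open>s \<ge> 2\<close> and \<open>k\<close> is at most a constant times
  \<open>k * log s\<close>, even when \<open>n = 1\<close>. The common factor
  \<open>(k + 1) * N\<close> is never divided out. Each final number is this factor times a natural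
  number, and in exact arithmetic a test for zero decides whether some pair exists. Likewise the
  inverse Fourier transform is the forward one, read at the index \<open>-w\<close> modulo
  \<open>N\<close>. One program serves all inputs; \<open>\<sigma>\<close>, \<open>\<rho>\<close>,
  \<open>n\<close> and \<open>k\<close> reach it only through index variables. Since array contents
  cannot steer control flow, every choice that depends on them is made by factors that are 0 or
  1.\<close>

definition unit_root :: "nat \<Rightarrow> nat \<Rightarrow> complex" where
  "unit_root e f = cis (2 * pi * real e / real f)"

lemma unit_root_0 [simp]: "unit_root 0 f = 1"
  by (simp add: unit_root_def)

lemma unit_root_nonzero [simp]: "unit_root e f \<noteq> 0"
  by (simp add: unit_root_def)

lemma unit_root_add: "unit_root (d + e) f = unit_root d f * unit_root e f"
  by (simp add: unit_root_def cis_mult add_divide_distrib ring_distribs)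

lemma unit_root_cancel: "0 < d \<Longrightarrow> unit_root (e * d) (f * d) = unit_root e f"
  by (simp add: unit_root_def mult.assoc)

lemma unit_root_power: "unit_root e f ^ r = unit_root (r * e) f"
  unfolding unit_root_def DeMoivre by (simp add: algebra_simps)

lemma unit_root_eq_1_iff:
  assumes "0 < f"
  shows "unit_root e f = 1 \<longleftrightarrow> f dvd e"
proof
  assume "unit_root e f = 1"
  then have "cos (2 * pi * real e / real f) = 1"
    unfolding unit_root_def by (metis cis.simps(1) one_complex.simps(1))
  then obtain z :: int where z: "2 * pi * real e / real f = of_int z * 2 * pi"
    unfolding cos_one_2pi_int by blast
  have "real e = of_int z * real f"
    using z assms by (simp add: field_simps)
  then have "int e = z * int f"
    by (metis of_int_eq_iff of_int_mult of_int_of_nat_eq)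
  then show "f dvd e"
    by (metis dvd_triv_right int_dvd_int_iff)
next
  assume "f dvd e"
  then obtain c where "e = f * c" ..
  then have "unit_root e f = cis (2 * pi * real c)"
    using assms by (simp add: unit_root_def mult.assoc)
  then show "unit_root e f = 1"
    by (metis cis_multiple_2pi Ints_of_nat)
qed

lemma sum_unit_root:
  assumes "0 < f"
  shows "(\<Sum>p<f. unit_root (p * d) f) = (if f dvd d then of_nat f else 0)"
proof -
  have eq: "(\<Sum>p<f. unit_root (p * d) f) = (\<Sum>p<f. unit_root d f ^ p)"
    by (simp add: unit_root_power)
  show ?thesis
  proof (cases "f dvd d")
    case True
    then show ?thesis
      using unit_root_eq_1_iff[OF assms, of d] by (simp add: eq)
  next
    case False
    then have ne: "unit_root d f \<noteq> 1"
      using unit_root_eq_1_iff[OF assms] by blast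
    have "unit_root d f ^ f = 1"
      using unit_root_eq_1_iff[OF assms, of "f * d"] by (simp add: unit_root_power)
    then show ?thesis
      using False ne by (simp add: eq geometric_sum)
  qed
qed

section \<open>Digits and sums over products\<close>

definition digit :: "nat \<Rightarrow> nat \<Rightarrow> nat \<Rightarrow> nat" where
  "digit b x i = x div b ^ i mod b"

lemma digit_less: "0 < b \<Longrightarrow> digit b x i < b"
  by (simp add: digit_def)

lemma digit_append:
  assumes "p < b"
  shows "digit b (a * b + p) 0 = p" "digit b (a * b + p) (Suc i) = digit b a i"
  using assms by (simp_all add: digit_def div_mult2_eq)

lemma digit_mod:
  assumes "i < t"
  shows "digit b (x mod b ^ t) i = digit b x i"
proof (cases "b = 0")
  case True
  then show ?thesis using assms by (simp add: digit_def power_0_left)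
next
  case False
  obtain d where t: "t = i + Suc d"
    using assms less_imp_Suc_add by (metis add_Suc_right)
  have "x mod b ^ t = b ^ i * (x div b ^ i mod b ^ Suc d) + x mod b ^ i"
    unfolding t power_add by (rule mod_mult2_eq)
  then have "x mod b ^ t div b ^ i = x div b ^ i mod b ^ Suc d"
    using False by simp
  then show ?thesis
    by (simp add: digit_def mod_mod_cancel)
qed

lemma digit_top: "x < b ^ Suc t \<Longrightarrow> digit b x t = x div b ^ t"
  by (simp add: digit_def less_mult_imp_div_less mult.commute)

lemma digits_less_power:
  fixes d :: "nat \<Rightarrow> nat"
  assumes "\<And>i. i < k \<Longrightarrow> d i < b"
  shows "(\<Sum>i<k. d i * b ^ i) < b ^ k"
  using assms
proof (induction k)
  case (Suc k)
  have "(\<Sum>i<Suc k. d i * b ^ i) < b ^ k + d k * b ^ k"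
    using Suc by simp
  also have "\<dots> = Suc (d k) * b ^ k" by simp
  also have "\<dots> \<le> b * b ^ k"
    by (rule mult_le_mono1) (use Suc.prems[of k] in simp)
  finally show ?case by simp
qed simp

lemma digit_of_digits:
  fixes d :: "nat \<Rightarrow> nat"
  assumes "\<And>i. i < k \<Longrightarrow> d i < b" "i < k"
  shows "digit b (\<Sum>i<k. d i * b ^ i) i = d i"
  using assms
proof (induction k arbitrary: d i)
  case (Suc k)
  have split: "(\<Sum>i<Suc k. d i * b ^ i) = (\<Sum>i<k. d (Suc i) * b ^ i) * b + d 0"
    by (simp add: sum.lessThan_Suc_shift sum_distrib_left mult_ac del: sum.lessThan_Suc)
  show ?case
  proof (cases i)
    case 0
    then show ?thesis unfolding split using Suc.prems by (simp add: digit_append)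
  next
    case (Suc i')
    then show ?thesis unfolding split
      using Suc.prems Suc.IH[of "\<lambda>i. d (Suc i)" i'] by (simp add: digit_append)
  qed
qed simp

lemma sum_of_digits:
  assumes "x < b ^ k"
  shows "(\<Sum>i<k. digit b x i * b ^ i) = x"
  using assms
proof (induction k arbitrary: x)
  case (Suc k)
  have "(\<Sum>i<Suc k. digit b x i * b ^ i) =
      (\<Sum>i<k. digit b (x mod b ^ k) i * b ^ i) + digit b x k * b ^ k"
    by (simp add: digit_mod)
  also have "\<dots> = x mod b ^ k + x div b ^ k * b ^ k"
    using Suc by (subst Suc.IH) (auto simp: digit_top intro!: mod_less_divisor intro: gr0I)
  finally show ?case by (simp only: mod_div_mult_eq)
qed simp

lemma sum_lessThan_add:
  fixes g :: "nat \<Rightarrow> 'a :: comm_monoid_add"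
  shows "(\<Sum>x<m + d. g x) = (\<Sum>x<m. g x) + (\<Sum>p<d. g (m + p))"
  by (induction d) (simp_all add: add_ac)

lemma sum_lessThan_mult:
  fixes g :: "nat \<Rightarrow> 'a :: comm_monoid_add"
  shows "(\<Sum>x<r * b. g x) = (\<Sum>a<r. \<Sum>p<b. g (a * b + p))"
  by (induction r) (simp_all add: sum_lessThan_add[of _ _ b] add.commute[of b])

text \<open>Summing over \<open>q\<close> is summing over all digit vectors, so this is the
  distributive law. It is what factorises the convolution over the \<open>k\<close>
  coordinates.\<close>

lemma sum_prod_digits:
  fixes F :: "nat \<Rightarrow> nat \<Rightarrow> 'a :: comm_semiring_1"
  shows "(\<Sum>q<b ^ k. \<Prod>i<k. F i (digit b q i)) = (\<Prod>i<k. \<Sum>p<b. F i p)"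
proof (induction k arbitrary: F)
  case (Suc k)
  have "(\<Sum>q<b ^ Suc k. \<Prod>i<Suc k. F i (digit b q i)) =
      (\<Sum>a<b ^ k. \<Sum>p<b. F 0 p * (\<Prod>i<k. F (Suc i) (digit b a i)))"
    unfolding power_Suc2 sum_lessThan_mult
    by (intro sum.cong refl)
      (simp add: prod.lessThan_Suc_shift digit_append del: prod.lessThan_Suc)
  also have "\<dots> = (\<Sum>p<b. F 0 p) * (\<Sum>a<b ^ k. \<Prod>i<k. F (Suc i) (digit b a i))"
    by (subst sum.swap) (simp add: sum_product)
  also have "\<dots> = (\<Sum>p<b. F 0 p) * (\<Prod>i<k. \<Sum>p<b. F (Suc i) p)"
    by (simp only: Suc.IH[of "\<lambda>i. F (Suc i)"])
  finally show ?case
    by (simp add: prod.lessThan_Suc_shift del: prod.lessThan_Suc)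
qed simp

section \<open>Fast transforms\<close>

text \<open>One axis of length \<open>b ^ L\<close>. Before stage \<open>t\<close>, position \<open>r * b ^ t + q\<close> with
  \<open>q < b ^ t\<close> holds the partial transform at frequency \<open>q\<close> of the entries whose address
  is \<open>r\<close> modulo \<open>b ^ (L - t)\<close>.\<close>

primrec stage ::
  "(nat \<Rightarrow> nat \<Rightarrow> nat \<Rightarrow> complex) \<Rightarrow> nat \<Rightarrow> nat \<Rightarrow> (nat \<Rightarrow> complex) \<Rightarrow> nat \<Rightarrow> nat \<Rightarrow> complex" where
  "stage \<kappa> b L f 0 x = f x"
| "stage \<kappa> b L f (Suc t) x =
     (\<Sum>p<b. \<kappa> t (x mod b ^ Suc t) p *
        stage \<kappa> b L f t (x div b ^ Suc t * b ^ t + (p * (b ^ L div b) + x mod b ^ t)))"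

text \<open>What a kernel on \<open>t\<close> digits must satisfy for \<open>stage\<close> to
  compute it: the newly absorbed address digit \<open>p\<close> is the lowest one, and only the
  lower digits of the frequency pass to the smaller kernel. Fourier transforms and tensor powers
  both have this shape, so one program and one proof serve both.\<close>

definition transform_kernel ::
  "nat \<Rightarrow> (nat \<Rightarrow> nat \<Rightarrow> nat \<Rightarrow> complex) \<Rightarrow> (nat \<Rightarrow> nat \<Rightarrow> nat \<Rightarrow> complex) \<Rightarrow> bool" where
  "transform_kernel b \<kappa> H \<longleftrightarrow> H 0 0 0 = 1 \<and>
     (\<forall>t q a p. q < b ^ Suc t \<longrightarrow> a < b ^ t \<longrightarrow> p < b \<longrightarrow>
        H (Suc t) q (a * b + p) = \<kappa> t q p * H t (q mod b ^ t) a)"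

text \<open>This is the self-sorting (Stockham) form of the radix-\<open>b\<close> transform: each
  stage trades one digit of the residue \<open>r\<close> for one digit of the frequency
  \<open>q\<close>, so the result needs no separate permutation pass.\<close>

lemma stage_partial:
  assumes H: "transform_kernel b \<kappa> H" and b: "0 < b"
    and "t \<le> L" "q < b ^ t" "r < b ^ (L - t)"
  shows "stage \<kappa> b L f t (r * b ^ t + q) = (\<Sum>a<b ^ t. H t q a * f (r + a * b ^ (L - t)))"
  using assms(3-)
proof (induction t arbitrary: q r)
  case 0
  then show ?case using H by (simp add: transform_kernel_def)
next
  case (Suc t)
  define e where "e = L - Suc t"
  have L: "L = Suc t + e" and Lt: "L - t = Suc e"
    using Suc.prems by (simp_all add: e_def)
  \<comment> \<open>The offset \<open>p * (b ^ L div b)\<close> in \<open>stage\<close> is thereby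
    an increase of the residue by \<open>p * b ^ e\<close>.\<close>
  have bt: "b ^ L div b = b ^ e * b ^ t"
    using b by (simp add: L power_add mult_ac)
  have "stage \<kappa> b L f (Suc t) (r * b ^ Suc t + q) =
      (\<Sum>p<b. \<kappa> t q p * stage \<kappa> b L f t ((r + p * b ^ e) * b ^ t + q mod b ^ t))"
  proof -
    have mod: "(r * b ^ Suc t + q) mod b ^ t = q mod b ^ t"
      using mod_mult_self3[of "r * b" "b ^ t" q] by (simp add: mult_ac)
    have "(r * b ^ Suc t + q) div b ^ Suc t = r" "(r * b ^ Suc t + q) mod b ^ Suc t = q"
      using Suc.prems b by (simp_all del: power_Suc)
    then show ?thesis
      unfolding stage.simps mod bt by (simp only: add_mult_distrib mult.assoc add.assoc)
  qed
  also have "\<dots> = (\<Sum>p<b. \<kappa> t q p *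
      (\<Sum>a<b ^ t. H t (q mod b ^ t) a * f (r + p * b ^ e + a * b ^ Suc e)))"
  proof (intro sum.cong refl arg_cong2[where f = "(*)"])
    fix p assume "p \<in> {..<b}"
    then have "r + p * b ^ e < b ^ Suc e"
      using Suc.prems mult_le_mono1[of "Suc p" b "b ^ e"] by (simp add: e_def)
    then show "stage \<kappa> b L f t ((r + p * b ^ e) * b ^ t + q mod b ^ t) =
        (\<Sum>a<b ^ t. H t (q mod b ^ t) a * f (r + p * b ^ e + a * b ^ Suc e))"
      using Suc.IH[of "q mod b ^ t" "r + p * b ^ e"] Suc.prems b Lt by simp
  qed
  also have "\<dots> = (\<Sum>p<b. \<Sum>a<b ^ t. H (Suc t) q (a * b + p) * f (r + (a * b + p) * b ^ e))"
    using H Suc.prems unfolding transform_kernel_def sum_distrib_left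
    by (intro sum.cong refl) (simp add: algebra_simps)
  also have "\<dots> = (\<Sum>a<b ^ Suc t. H (Suc t) q a * f (r + a * b ^ e))"
    unfolding power_Suc2 sum_lessThan_mult by (rule sum.swap)
  finally show ?case by (simp add: e_def)
qed

lemma stage_final:
  assumes "transform_kernel b \<kappa> H" "0 < b" "q < b ^ L"
  shows "stage \<kappa> b L f L q = (\<Sum>a<b ^ L. H L q a * f a)"
  using stage_partial[OF assms(1,2), of L L q 0] assms(3) by simp

section \<open>Fourier kernels and tensor powers\<close>

text \<open>The Cooley-Tukey splitting: the exponent of \<open>a * b + p\<close> separates into a
  twiddle factor of order \<open>b ^ Suc t\<close> and a root of order \<open>b ^ t\<close>, and the
  latter sees \<open>q\<close> only modulo \<open>b ^ t\<close>.\<close>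

lemma transform_kernel_fourier:
  assumes "0 < b"
  shows "transform_kernel b (\<lambda>t q p. unit_root (p * q) (b ^ Suc t)) (\<lambda>t q a. unit_root (a * q) (b ^ t))"
  unfolding transform_kernel_def
proof (intro conjI allI impI)
  fix t q a p :: nat
  have "unit_root (a * q) (b ^ t) = unit_root (a * (q mod b ^ t) + b ^ t * (a * (q div b ^ t))) (b ^ t)"
    by (metis (no_types) add.commute add_mult_distrib2 mod_mult_div_eq mult.left_commute)
  also have "\<dots> = unit_root (a * (q mod b ^ t)) (b ^ t)"
    using unit_root_eq_1_iff[of "b ^ t"] assms by (simp add: unit_root_add)
  finally have red: "unit_root (a * q) (b ^ t) = unit_root (a * (q mod b ^ t)) (b ^ t)" .
  have "unit_root ((a * b + p) * q) (b ^ Suc t) = unit_root (p * q) (b ^ Suc t) * unit_root (a * q * b) (b ^ t * b)"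
    by (simp add: unit_root_add[symmetric] algebra_simps)
  also have "\<dots> = unit_root (p * q) (b ^ Suc t) * unit_root (a * (q mod b ^ t)) (b ^ t)"
    using assms red by (simp only: unit_root_cancel)
  finally show "unit_root ((a * b + p) * q) (b ^ Suc t) =
      unit_root (p * q) (b ^ Suc t) * unit_root (a * (q mod b ^ t)) (b ^ t)" .
qed simp

text \<open>The tensor power of \<open>T\<close> up to a reversal of the address digits: the stages
  absorb address digits from the top but produce frequency digits from the bottom.\<close>

definition tensor_kernel :: "nat \<Rightarrow> (nat \<Rightarrow> nat \<Rightarrow> complex) \<Rightarrow> nat \<Rightarrow> nat \<Rightarrow> nat \<Rightarrow> complex" where
  "tensor_kernel b T t q a = (\<Prod>i<t. T (digit b q i) (digit b a (t - Suc i)))"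

lemma transform_kernel_tensor:
  "transform_kernel b (\<lambda>t q p. T (q div b ^ t) p) (tensor_kernel b T)"
  unfolding transform_kernel_def
proof (intro conjI allI impI)
  fix t q a p assume *: "q < b ^ Suc t" "p < b"
  have "(\<Prod>i<t. T (digit b q i) (digit b (a * b + p) (t - i))) =
      (\<Prod>i<t. T (digit b (q mod b ^ t) i) (digit b a (t - Suc i)))"
  proof (intro prod.cong refl)
    fix i assume "i \<in> {..<t}"
    then show "T (digit b q i) (digit b (a * b + p) (t - i)) =
        T (digit b (q mod b ^ t) i) (digit b a (t - Suc i))"
      using digit_append(2)[OF *(2), of a "t - Suc i"] by (simp add: digit_mod Suc_diff_Suc)
  qed
  then show "tensor_kernel b T (Suc t) q (a * b + p) = T (q div b ^ t) p * tensor_kernel b T t (q mod b ^ t) a"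
    using * by (simp add: tensor_kernel_def digit_append digit_top mult.commute del: power_Suc)
qed (simp add: tensor_kernel_def)

text \<open>The digit reversals of evaluation and interpolation cancel: after reindexing
  \<open>i\<close> to \<open>k - Suc i\<close>, digit \<open>i\<close> of \<open>c\<close> meets
  digit \<open>i\<close> of \<open>x\<close> and \<open>y\<close> again, and the sum over the points
  splits by \<open>sum_prod_digits\<close>.\<close>

lemma tensor_kernel_convolution:
  "(\<Sum>q<b ^ k. tensor_kernel b U k c q * (tensor_kernel b T k q x * tensor_kernel b T k q y)) =
     (\<Prod>i<k. \<Sum>p<b. U (digit b c i) p * (T p (digit b x i) * T p (digit b y i)))"
proof -
  let ?F = "\<lambda>i p. U (digit b c (k - Suc i)) p * (T p (digit b x (k - Suc i)) * T p (digit b y (k - Suc i)))"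
  have "tensor_kernel b U k c q * (tensor_kernel b T k q x * tensor_kernel b T k q y) =
      (\<Prod>i<k. ?F i (digit b q i))" for q
  proof -
    have "tensor_kernel b U k c q = (\<Prod>i<k. U (digit b c (k - Suc i)) (digit b q i))"
      unfolding tensor_kernel_def
      by (subst prod.nat_diff_reindex[symmetric]) (auto intro!: prod.cong simp: Suc_diff_Suc)
    then show ?thesis by (simp add: tensor_kernel_def prod.distrib)
  qed
  then have "(\<Sum>q<b ^ k. tensor_kernel b U k c q * (tensor_kernel b T k q x * tensor_kernel b T k q y)) =
      (\<Sum>q<b ^ k. \<Prod>i<k. ?F i (digit b q i))"
    by (simp only:)
  also have "\<dots> = (\<Prod>i<k. \<Sum>p<b. ?F i p)"
    by (rule sum_prod_digits)
  also have "\<dots> = (\<Prod>i<k. \<Sum>p<b. U (digit b c i) p * (T p (digit b x i) * T p (digit b y i)))"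
    by (rule prod.nat_diff_reindex)
  finally show ?thesis .
qed

section \<open>The deformed label algebra\<close>

definition eps :: "nat \<Rightarrow> nat \<Rightarrow> complex" where
  "eps k j = unit_root (2 * j + 1) (2 * (k + 1))"

text \<open>The points are the roots of unity of order \<open>k + 1\<close> turned by half a step,
  so the power sum changes only by a constant factor; for \<open>0 < d \<le> k\<close> it vanishes
  because \<open>k + 1\<close> does not divide \<open>d\<close>.\<close>

lemma sum_eps_power:
  assumes "d \<le> k"
  shows "(\<Sum>j<k + 1. eps k j ^ d) = (if d = 0 then of_nat (k + 1) else 0)"
proof -
  have "eps k j ^ d = unit_root d (2 * (k + 1)) * unit_root (j * d) (k + 1)" for j
  proof -
    have "eps k j ^ d = unit_root (d + j * d * 2) (2 * (k + 1))"
      unfolding eps_def unit_root_power by (simp add: algebra_simps)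
    also have "\<dots> = unit_root d (2 * (k + 1)) * unit_root (j * d * 2) ((k + 1) * 2)"
      by (simp only: unit_root_add mult.commute[of 2])
    finally show ?thesis by (simp only: unit_root_cancel zero_less_numeral)
  qed
  then have "(\<Sum>j<k + 1. eps k j ^ d) = unit_root d (2 * (k + 1)) * (\<Sum>j<k + 1. unit_root (j * d) (k + 1))"
    by (simp only: sum_distrib_left)
  also have "\<dots> = (if d = 0 then of_nat (k + 1) else 0)"
    using assms by (subst sum_unit_root) (auto dest: dvd_imp_le)
  finally show ?thesis .
qed

text \<open>Expand over the set \<open>X\<close> of coordinates that contribute \<open>A\<close>.
  The exponent of \<open>eps k j\<close> is the number of the other coordinates, at most
  \<open>k\<close>, so the sum over \<open>j\<close> keeps only the term where \<open>X\<close> is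
  everything. This relies on \<open>A\<close> and \<open>B\<close> being independent of
  \<open>j\<close>.\<close>

lemma sum_prod_deformation:
  "(\<Sum>j<k + 1. \<Prod>i<k. A i + eps k j * B i) = of_nat (k + 1) * (\<Prod>i<k. A i)"
proof -
  have "(\<Prod>i<k. A i + eps k j * B i) =
      (\<Sum>X\<in>Pow {..<k}. eps k j ^ card ({..<k} - X) * (prod A X * prod B ({..<k} - X)))" for j
    by (subst prod_add) (auto intro!: sum.cong simp: prod.distrib mult_ac)
  then have "(\<Sum>j<k + 1. \<Prod>i<k. A i + eps k j * B i) =
      (\<Sum>X\<in>Pow {..<k}. (\<Sum>j<k + 1. eps k j ^ card ({..<k} - X)) * (prod A X * prod B ({..<k} - X)))"
    by (simp only: sum_distrib_right) (rule sum.swap)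
  also have "\<dots> = (\<Sum>X\<in>Pow {..<k}. if X = {..<k} then of_nat (k + 1) * prod A X else 0)"
  proof (intro sum.cong refl)
    fix X assume X: "X \<in> Pow {..<k}"
    have "card ({..<k} - X) \<le> k"
      by (metis Diff_subset card_lessThan card_mono finite_lessThan)
    moreover have "card ({..<k} - X) = 0 \<longleftrightarrow> X = {..<k}"
      using X by auto
    ultimately have *: "(\<Sum>j<k + 1. eps k j ^ card ({..<k} - X)) = (if X = {..<k} then of_nat (k + 1) else 0)"
      by (simp only: sum_eps_power)
    show "(\<Sum>j<k + 1. eps k j ^ card ({..<k} - X)) * (prod A X * prod B ({..<k} - X)) =
        (if X = {..<k} then of_nat (k + 1) * prod A X else 0)"
      unfolding * by (cases "X = {..<k}") simp_all
  qed
  also have "\<dots> = of_nat (k + 1) * (\<Prod>i<k. A i)"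
    by (simp del: of_nat_Suc of_nat_add)
  finally show ?thesis .
qed

section \<open>One side: evaluation, interpolation and structure constants\<close>

text \<open>The labels of one side, \<open>|j|\<close> or \<open>|\<ge>j|\<close> being read as \<open>x ^ j\<close>. For \<open>q = l + 1\<close>
  (finite side) the deformed algebra is \<open>x ^ q = eps k j\<close>, with the nodes as its points; for
  \<open>q = l\<close> (cofinite side) it is the product of this and of the field, the extra point \<open>p = q\<close>
  reading off the sum of all coefficients. The odd numerators in \<open>eps\<close> keep every node
  different from 1, so that the last row of the inverse is a geometric sum.\<close>

definition node :: "nat \<Rightarrow> nat \<Rightarrow> nat \<Rightarrow> nat \<Rightarrow> complex" where
  "node k j q p = unit_root (2 * j + 1 + 2 * (k + 1) * p) (2 * (k + 1) * q)"

definition eval_entry :: "nat \<Rightarrow> nat \<Rightarrow> nat \<Rightarrow> nat \<Rightarrow> nat \<Rightarrow> complex" where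
  "eval_entry k j q p a =
     (if p < q then if a < q then node k j q p ^ a else 0 else 1)"

definition interp_entry :: "nat \<Rightarrow> nat \<Rightarrow> nat \<Rightarrow> nat \<Rightarrow> nat \<Rightarrow> complex" where
  "interp_entry k j q c p =
     (if p < q then if c < q then 1 / (of_nat q * node k j q p ^ c)
                    else (1 / eps k j - 1) / (of_nat q * (1 - 1 / node k j q p))
      else of_bool (\<not> c < q))"

definition side_sum :: "bool \<Rightarrow> nat \<Rightarrow> nat \<Rightarrow> nat \<Rightarrow> nat \<Rightarrow> bool" where
  "side_sum fin l a b c \<longleftrightarrow> (if fin then a + b = c else min (a + b) l = c)"

text \<open>The coefficient of \<open>eps k j\<close> in the deformed product of two labels below
  \<open>q\<close>. An overflow \<open>x ^ (a + b)\<close> wraps to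
  \<open>\<epsilon> x ^ (a + b - q)\<close>. On a cofinite side the value at the extra point must
  stay 1, so the overflow becomes the top label plus \<open>\<epsilon>\<close> times the difference
  of \<open>x ^ (a + b - q)\<close> and the top label; hence the negative case.\<close>

definition side_defect :: "nat \<Rightarrow> nat \<Rightarrow> nat \<Rightarrow> nat \<Rightarrow> complex" where
  "side_defect q a b c =
     (if a < q \<and> b < q then if c < q then of_bool (a + b = c + q) else - of_bool (q \<le> a + b) else 0)"

lemma node_power_q:
  assumes "0 < q"
  shows "node k j q p ^ q = eps k j"
proof -
  have "node k j q p ^ q = unit_root ((2 * j + 1 + 2 * (k + 1) * p) * q) (2 * (k + 1) * q)"
    unfolding node_def unit_root_power by (simp only: mult.commute)
  also have "\<dots> = unit_root (2 * j + 1 + 2 * (k + 1) * p) (2 * (k + 1))"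
    by (rule unit_root_cancel[OF assms])
  also have "\<dots> = unit_root (2 * j + 1) (2 * (k + 1))"
  proof -
    have "unit_root (2 * (k + 1) * p) (2 * (k + 1)) = 1"
      by (rule iffD2[OF unit_root_eq_1_iff]) (simp, rule dvd_triv_left)
    then show ?thesis by (simp only: unit_root_add mult_1_right)
  qed
  finally show ?thesis by (simp add: eps_def)
qed

lemma eps_neq_1: "eps k j \<noteq> 1"
proof -
  have "\<not> 2 * (k + 1) dvd 2 * j + 1"
    by (metis dvd_mult_left even_plus_one_iff even_mult_iff dvd_refl)
  then show ?thesis
    using unit_root_eq_1_iff[of "2 * (k + 1)" "2 * j + 1"] by (simp add: eps_def)
qed

lemma node_nonzero [simp]: "node k j q p \<noteq> 0"
  by (simp add: node_def)

lemma node_neq_1: "0 < q \<Longrightarrow> node k j q p \<noteq> 1"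
  using node_power_q[of q k j p] eps_neq_1[of k j] by auto

text \<open>The nodes are one \<open>q\<close>-th root of \<open>eps k j\<close> times all
  \<open>q\<close>-th roots of unity, so the sum vanishes unless \<open>q\<close> divides
  \<open>a + b - c\<close>. In the given range this leaves no wrap or a single wrap, the latter
  costing one factor \<open>eps k j\<close>.\<close>

lemma sum_node_power:
  assumes "0 < q" "c < q" "a < q" "b < q"
  shows "(\<Sum>p<q. node k j q p ^ (a + b) / node k j q p ^ c) =
     of_nat q * (of_bool (a + b = c) + eps k j * of_bool (a + b = c + q))"
proof -
  define \<theta> where "\<theta> = node k j q 0"
  \<comment> \<open>The exponent \<open>a + b - c\<close>, raised by \<open>q\<close> to remain a
    natural number; the surplus \<open>\<theta> ^ q = eps k j\<close> is divided out again
    below.\<close>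
  define d where "d = a + b + q - c"
  have node: "node k j q p = \<theta> * unit_root p q" for p
  proof -
    have "unit_root (p * (2 * (k + 1))) (q * (2 * (k + 1))) = unit_root p q"
      by (rule unit_root_cancel) simp
    then show ?thesis
      unfolding \<theta>_def node_def unit_root_add by (simp add: mult_ac)
  qed
  have \<theta>: "\<theta> \<noteq> 0" "\<theta> ^ q = eps k j"
    using assms by (simp_all add: \<theta>_def node_power_q)
  have eps0: "eps k j \<noteq> 0"
    by (simp add: eps_def)
  have "node k j q p ^ (a + b) / node k j q p ^ c = \<theta> ^ d / eps k j * unit_root (p * d) q" for p
  proof -
    have "node k j q p ^ d * node k j q p ^ c = node k j q p ^ (a + b) * node k j q p ^ q"
      using assms by (simp add: d_def flip: power_add)
    then have "node k j q p ^ (a + b) / node k j q p ^ c = node k j q p ^ d / eps k j"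
      using assms eps0 by (simp add: node_power_q field_simps)
    then show ?thesis
      by (simp add: node power_mult_distrib unit_root_power mult.commute)
  qed
  then have "(\<Sum>p<q. node k j q p ^ (a + b) / node k j q p ^ c) =
      \<theta> ^ d / eps k j * (if q dvd d then of_nat q else 0)"
    by (simp only: flip: sum_distrib_left sum_unit_root[OF assms(1)])
  moreover have "q dvd d \<longleftrightarrow> a + b = c \<or> a + b = c + q"
  proof
    assume "q dvd d"
    then obtain e where e: "d = q * e" ..
    have "0 < d" "d < q * 3" using assms by (auto simp: d_def)
    then have "0 < e" "e < 3" by (simp_all add: e)
    then have "e = 1 \<or> e = 2" by auto
    then show "a + b = c \<or> a + b = c + q" using e assms by (auto simp: d_def)
  qed (auto simp: d_def)
  moreover have "a + b = c \<Longrightarrow> \<theta> ^ d = eps k j" "a + b = c + q \<Longrightarrow> \<theta> ^ d = eps k j * eps k j"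
    using \<theta> by (simp_all add: d_def power_add)
  ultimately show ?thesis using eps0 assms(1) by auto
qed

text \<open>The coefficient of the top label is the sum of all coefficients, read off at the extra
  point, minus the lower coefficients. At an ordinary point only the second part is visible, and it
  is a geometric sum.\<close>

lemma interp_last:
  assumes "p < q"
  shows "interp_entry k j q q p = - (\<Sum>c<q. interp_entry k j q c p)"
proof -
  let ?z = "1 / node k j q p"
  have z: "?z \<noteq> 1" "?z ^ q = 1 / eps k j"
    using assms node_neq_1[of q k j p] node_power_q[of q k j p] by (auto simp: power_divide)
  have "(\<Sum>c<q. interp_entry k j q c p) = (\<Sum>c<q. ?z ^ c) / of_nat q"
    using assms by (simp add: interp_entry_def sum_divide_distrib power_divide mult.commute)
  also have "(\<Sum>c<q. ?z ^ c) = (?z ^ q - 1) / (?z - 1)"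
    using z by (simp add: geometric_sum)
  also have "\<dots> = - ((1 / eps k j - 1) / (1 - ?z))"
    unfolding z(2) by (metis minus_diff_eq minus_divide_right)
  finally show ?thesis
    using assms by (simp add: interp_entry_def mult.commute)
qed

text \<open>Evaluate, multiply pointwise, interpolate: this yields the structure constants of the
  deformed algebra. Their being affine in \<open>eps k j\<close> is what bounds the degree by the
  number of coordinates.\<close>

lemma side_algebra:
  assumes q: "q = l + of_bool fin" and le: "a \<le> l" "b \<le> l" "c \<le> l"
  shows "(\<Sum>p<l + 1. interp_entry k j q c p * (eval_entry k j q p a * eval_entry k j q p b)) =
     of_bool (side_sum fin l a b c) + eps k j * side_defect q a b c"
proof -
  let ?g = "\<lambda>c p. interp_entry k j q c p * (eval_entry k j q p a * eval_entry k j q p b)"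
  have low: "(\<Sum>p<q. ?g c p) = (if a < q \<and> b < q then of_bool (a + b = c) + eps k j * of_bool (a + b = c + q) else 0)"
    if "c < q" for c
  proof (cases "a < q \<and> b < q")
    case True
    then have "(\<Sum>p<q. ?g c p) = (\<Sum>p<q. node k j q p ^ (a + b) / node k j q p ^ c) / of_nat q"
      using that by (simp add: interp_entry_def eval_entry_def sum_divide_distrib power_add mult.commute)
    then show ?thesis using True that by (simp add: sum_node_power)
  next
    case False
    then have "(\<Sum>p<q. ?g c p) = 0"
      by (intro sum.neutral) (auto simp: eval_entry_def)
    then show ?thesis using False by (simp only: if_False)
  qed
  \<comment> \<open>On a finite side \<open>q = l + 1\<close>, so all points are nodes; on a
    cofinite side \<open>p = q = l\<close> is the extra point, and it contributes only to the row of
    the top label.\<close>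
  have split: "(\<Sum>p<l + 1. ?g c p) = (\<Sum>p<q. ?g c p) + (if fin then 0 else of_bool (\<not> c < q))"
    using q by (auto simp: interp_entry_def eval_entry_def)
  show ?thesis
  proof (cases "c < q")
    case True
    then show ?thesis
      unfolding split using low[OF True] q le
      by (auto simp: side_sum_def side_defect_def)
  next
    case False
    then have cq: "c = q" "\<not> fin" "l = q" using q le by (auto split: if_splits)
    \<comment> \<open>The row of the top label is reduced to the rows below \<open>q\<close>, which
      are already known.\<close>
    have "(\<Sum>p<q. ?g q p) = - (\<Sum>p<q. \<Sum>c<q. ?g c p)"
      unfolding sum_negf[symmetric]
      by (intro sum.cong refl) (simp add: interp_last sum_distrib_right sum_negf)
    also have "\<dots> = - (\<Sum>c<q. \<Sum>p<q. ?g c p)"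
      by (subst sum.swap) (rule refl)
    also have "\<dots> = (if a < q \<and> b < q then - of_bool (a + b < q) - eps k j * of_bool (q \<le> a + b) else 0)"
    proof (cases "a < q \<and> b < q")
      case True
      have "(\<Sum>c<q. of_bool (a + b = c)) = (of_bool (a + b < q) :: complex)"
        by (simp add: of_bool_def)
      moreover have "(\<Sum>c<q. of_bool (a + b = c + q)) = (of_bool (q \<le> a + b) :: complex)"
      proof -
        have "a + b = c + q \<longleftrightarrow> q \<le> a + b \<and> c = a + b - q" for c by auto
        then have "(\<Sum>c<q. of_bool (a + b = c + q)) = (\<Sum>c<q. if c = a + b - q then of_bool (q \<le> a + b) else 0 :: complex)"
          by (intro sum.cong refl) (simp add: of_bool_def)
        also have "\<dots> = of_bool (q \<le> a + b)" using True by auto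
        finally show ?thesis .
      qed
      ultimately show ?thesis
        using True by (simp add: low sum.distrib flip: sum_distrib_left)
    next
      case False
      then have "(\<Sum>c<q. \<Sum>p<q. ?g c p) = 0"
        by (intro sum.neutral) (auto simp: low)
      then show ?thesis using False by (simp only: if_False minus_zero)
    qed
    finally have "(\<Sum>p<q. ?g q p) = (if a < q \<and> b < q then - of_bool (a + b < q) - eps k j * of_bool (q \<le> a + b) else 0)" .
    then show ?thesis
      unfolding split using cq le by (auto simp: side_sum_def side_defect_def)
  qed
qed

section \<open>Both sides: the direct product of two algebras\<close>

definition blocks :: "nat \<Rightarrow> (nat \<Rightarrow> nat \<Rightarrow> complex) \<Rightarrow> (nat \<Rightarrow> nat \<Rightarrow> complex) \<Rightarrow> nat \<Rightarrow> nat \<Rightarrow> complex" where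
  "blocks m S R x y =
     (if x < m \<and> y < m then S x y else if m \<le> x \<and> m \<le> y then R (x - m) (y - m) else 0)"

definition label_sum :: "bool \<Rightarrow> nat \<Rightarrow> bool \<Rightarrow> nat \<Rightarrow> nat \<Rightarrow> nat \<Rightarrow> nat \<Rightarrow> bool" where
  "label_sum fs ls fr lr a b c \<longleftrightarrow>
     a \<le> ls \<and> b \<le> ls \<and> c \<le> ls \<and> side_sum fs ls a b c \<or>
     ls < a \<and> ls < b \<and> ls < c \<and> side_sum fr lr (a - (ls + 1)) (b - (ls + 1)) (c - (ls + 1))"

text \<open>Across the two blocks all products vanish, matching the undefined sums of labels from
  different sides. \<open>D\<close> is obtained before \<open>j\<close> is chosen, as the averaging
  argument requires.\<close>

lemma label_algebra:
  assumes q: "qs = ls + of_bool fs" "qr = lr + of_bool fr"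
  obtains D where "\<And>j a b c. a < ls + lr + 2 \<Longrightarrow> b < ls + lr + 2 \<Longrightarrow> c < ls + lr + 2 \<Longrightarrow>
    (\<Sum>p<ls + lr + 2. blocks (ls + 1) (interp_entry k j qs) (interp_entry k j qr) c p *
       (blocks (ls + 1) (eval_entry k j qs) (eval_entry k j qr) p a *
        blocks (ls + 1) (eval_entry k j qs) (eval_entry k j qr) p b)) =
    of_bool (label_sum fs ls fr lr a b c) + eps k j * D a b c"
proof
  let ?m = "ls + 1"
  let ?D = "\<lambda>a b c. if a \<le> ls \<and> b \<le> ls \<and> c \<le> ls then side_defect qs a b c
    else if ls < a \<and> ls < b \<and> ls < c then side_defect qr (a - ?m) (b - ?m) (c - ?m) else 0"
  fix j a b c assume lt: "a < ls + lr + 2" "b < ls + lr + 2" "c < ls + lr + 2"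
  let ?E = "blocks ?m (eval_entry k j qs) (eval_entry k j qr)"
  let ?I = "blocks ?m (interp_entry k j qs) (interp_entry k j qr)"
  have "(\<Sum>p<ls + lr + 2. ?I c p * (?E p a * ?E p b)) =
      (\<Sum>p<?m. ?I c p * (?E p a * ?E p b)) + (\<Sum>p<lr + 1. ?I c (?m + p) * (?E (?m + p) a * ?E (?m + p) b))"
  proof -
    have "ls + lr + 2 = ?m + (lr + 1)" by simp
    then show ?thesis by (simp only: sum_lessThan_add)
  qed
  also have "(\<Sum>p<?m. ?I c p * (?E p a * ?E p b)) =
      (if a \<le> ls \<and> b \<le> ls \<and> c \<le> ls then of_bool (side_sum fs ls a b c) + eps k j * side_defect qs a b c else 0)"
  proof (cases "a \<le> ls \<and> b \<le> ls \<and> c \<le> ls")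
    case True
    have "(\<Sum>p<?m. ?I c p * (?E p a * ?E p b)) =
        (\<Sum>p<?m. interp_entry k j qs c p * (eval_entry k j qs p a * eval_entry k j qs p b))"
      using True by (intro sum.cong refl) (auto simp: blocks_def)
    then show ?thesis using True by (simp only: side_algebra[OF q(1)] if_True simp_thms)
  next
    case False
    then have "(\<Sum>p<?m. ?I c p * (?E p a * ?E p b)) = 0"
      by (intro sum.neutral) (auto simp: blocks_def)
    then show ?thesis using False by (simp only: if_False)
  qed
  also have "(\<Sum>p<lr + 1. ?I c (?m + p) * (?E (?m + p) a * ?E (?m + p) b)) =
      (if ls < a \<and> ls < b \<and> ls < c then of_bool (side_sum fr lr (a - ?m) (b - ?m) (c - ?m)) +
         eps k j * side_defect qr (a - ?m) (b - ?m) (c - ?m) else 0)"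
  proof (cases "ls < a \<and> ls < b \<and> ls < c")
    case True
    have "(\<Sum>p<lr + 1. ?I c (?m + p) * (?E (?m + p) a * ?E (?m + p) b)) =
        (\<Sum>p<lr + 1. interp_entry k j qr (c - ?m) p * (eval_entry k j qr p (a - ?m) * eval_entry k j qr p (b - ?m)))"
      using True by (intro sum.cong refl) (auto simp: blocks_def)
    moreover have "a - ?m \<le> lr" "b - ?m \<le> lr" "c - ?m \<le> lr" using lt by auto
    ultimately show ?thesis using True by (simp only: side_algebra[OF q(2)] if_True simp_thms)
  next
    case False
    then have "(\<Sum>p<lr + 1. ?I c (?m + p) * (?E (?m + p) a * ?E (?m + p) b)) = 0"
      by (intro sum.neutral) (auto simp: blocks_def)
    then show ?thesis using False by (simp only: if_False)
  qed
  finally show "(\<Sum>p<ls + lr + 2. ?I c p * (?E p a * ?E p b)) =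
      of_bool (label_sum fs ls fr lr a b c) + eps k j * ?D a b c"
    by (auto simp: label_sum_def)
qed

section \<open>Reasoning about programs\<close>

text \<open>The postcondition sees the memory but not the counter, so charging never disturbs it,
  and cost bounds are relative to the start and therefore add up.\<close>

definition runs ::
  "com \<Rightarrow> state \<Rightarrow> ((name \<Rightarrow> nat) \<Rightarrow> (name \<Rightarrow> nat \<Rightarrow> complex) \<Rightarrow> bool) \<Rightarrow> nat \<Rightarrow> bool" where
  "runs c s Q C \<longleftrightarrow> Q (idx (exec c s)) (arr (exec c s)) \<and> ops (exec c s) \<le> ops s + C"

definition same :: "'a set \<Rightarrow> ('a \<Rightarrow> 'b) \<Rightarrow> ('a \<Rightarrow> 'b) \<Rightarrow> bool" where
  "same V f g \<longleftrightarrow> (\<forall>x. x \<notin> V \<longrightarrow> g x = f x)"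

lemma same_refl [simp]: "same V f f"
  by (simp add: same_def)

lemma same_update: "x \<in> V \<Longrightarrow> same V f (g(x := y)) \<longleftrightarrow> same V f g"
  by (auto simp: same_def)

lemma sameD: "same V f g \<Longrightarrow> x \<notin> V \<Longrightarrow> g x = f x"
  by (simp add: same_def)

lemma charge_simps [simp]:
  "idx (charge c s) = idx s" "arr (charge c s) = arr s" "ops (charge c s) = ops s + c"
  by (simp_all add: charge_def)

lemma put_idx_simps [simp]:
  "idx (put_idx x v s) = (idx s)(x := v)" "arr (put_idx x v s) = arr s" "ops (put_idx x v s) = ops s"
  by (simp_all add: put_idx_def)

lemma put_arr_simps [simp]:
  "idx (put_arr A i z s) = idx s" "ops (put_arr A i z s) = ops s"
  "arr (put_arr A i z s) = (arr s)(A := (arr s A)(i := z))"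
  by (simp_all add: put_arr_def)

lemma runs_weaken:
  assumes "runs c s Q C" "\<And>i a. Q i a \<Longrightarrow> R i a" "C \<le> D"
  shows "runs c s R D"
  using assms unfolding runs_def by (meson add_left_mono le_trans)

lemma runs_Set_index:
  "Q ((idx s)(x := ival e s)) (arr s) \<Longrightarrow> 1 + iops e \<le> C \<Longrightarrow> runs (Set_index x e) s Q C"
  by (simp add: runs_def)

lemma runs_Set_array:
  "Q (idx s) ((arr s)(A := (arr s A)(ival e s := dval d s))) \<Longrightarrow> 1 + iops e + dops d \<le> C \<Longrightarrow>
   runs (Set_array A e d) s Q C"
  by (simp add: runs_def)

lemma runs_Seq:
  assumes "runs c s Q C" "\<And>r. Q (idx r) (arr r) \<Longrightarrow> runs d r R D" "C + D \<le> E"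
  shows "runs (Seq c d) s R E"
  using assms(1) assms(2)[of "exec c s"] assms(3) by (auto simp: runs_def)

text \<open>The invariant is available for the index memory \<open>i\<close> before the counter is
  set to \<open>j\<close>; so it must be restored for \<open>Suc j\<close> without relying on the
  value of the counter on entry. The 1 in \<open>C + 1\<close> is the charge for an
  iteration.\<close>

lemma runs_For:
  assumes N: "ival e s = N" and init: "I 0 (idx s) (arr s)"
    and step: "\<And>j r i. j < N \<Longrightarrow> idx r = i(x := j) \<Longrightarrow> I j i (arr r) \<Longrightarrow> runs c r (I (Suc j)) C"
    and D: "1 + iops e + N * (C + 1) \<le> D"
  shows "runs (For x e c) s (I N) D"
proof -
  let ?r = "\<lambda>m. fold (\<lambda>j r. exec c (charge 1 (put_idx x j r))) [0..<m] (charge (1 + iops e) s)"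
  have "I m (idx (?r m)) (arr (?r m)) \<and> ops (?r m) \<le> ops s + (1 + iops e + m * (C + 1))" if "m \<le> N" for m
    using that
  proof (induction m)
    case 0
    then show ?case using init by simp
  next
    case (Suc m)
    let ?q = "charge 1 (put_idx x m (?r m))"
    have "runs c ?q (I (Suc m)) C"
      using Suc by (intro step[where i = "idx (?r m)"]) auto
    then show ?case using Suc by (auto simp: runs_def)
  qed
  from this[of N] show ?thesis using N D by (auto simp: runs_def)
qed

section \<open>Filling one level of an array with sums\<close>

definition fill :: "name \<Rightarrow> iexp \<Rightarrow> iexp \<Rightarrow> dexp \<Rightarrow> com" where
  "fill X base cnt d =
     For ''i'' (IVar ''M'')
       (Seq (Set_array X (IAdd base (IVar ''i'')) (Num (IConst 0)))
         (For ''p'' cnt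
           (Set_array X (IAdd base (IVar ''i'')) (Add (Get X (IAdd base (IVar ''i''))) d))))"

text \<open>The cells below \<open>bs\<close> are guaranteed to keep their contents throughout.
  Hence \<open>d\<close> may read earlier levels of the very array that is being written.\<close>

lemma runs_fill:
  assumes M: "idx s ''M'' = m"
    and base: "\<And>r. same {''i'', ''p''} (idx s) (idx r) \<Longrightarrow> ival base r = bs"
    and cnt: "\<And>r. same {''i'', ''p''} (idx s) (idx r) \<Longrightarrow> ival cnt r = b"
    and d: "\<And>r i p. i < m \<Longrightarrow> p < b \<Longrightarrow> same {''i'', ''p''} (idx s) (idx r) \<Longrightarrow> idx r ''i'' = i \<Longrightarrow>
      idx r ''p'' = p \<Longrightarrow> same {X} (arr s) (arr r) \<Longrightarrow> (\<forall>x<bs. arr r X x = arr s X x) \<Longrightarrow>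
      dval d r = F i p"
  shows "runs (fill X base cnt d) s
     (\<lambda>i a. same {''i'', ''p''} (idx s) i \<and> same {X} (arr s) a \<and> (\<forall>x<bs. a X x = arr s X x) \<and>
        (\<forall>i<m. a X (bs + i) = (\<Sum>p<b. F i p)))
     (1 + m * (4 + iops base + iops cnt + b * (5 + 2 * iops base + dops d)))"
proof -
  let ?fr = "\<lambda>i a. same {''i'', ''p''} (idx s) i \<and> same {X} (arr s) a \<and> (\<forall>x<bs. a X x = arr s X x)"
  let ?I = "\<lambda>j i a. ?fr i a \<and> (\<forall>i<j. a X (bs + i) = (\<Sum>p<b. F i p))"
  let ?J = "\<lambda>j p i a. ?I j i a \<and> i ''i'' = j \<and> a X (bs + j) = (\<Sum>p<p. F j p)"
  have inner: "runs (For ''p'' cnt (Set_array X (IAdd base (IVar ''i'')) (Add (Get X (IAdd base (IVar ''i''))) d)))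
      r (?J j b) (1 + iops cnt + b * (5 + 2 * iops base + dops d))"
    if "j < m" "?J j 0 (idx r) (arr r)" for j and r :: state
  proof (rule runs_For[where I = "?J j"])
    show "ival cnt r = b" using that cnt by blast
    show "?J j 0 (idx r) (arr r)" by (fact that)
    fix p i and r' :: state assume *: "p < b" "idx r' = i(''p'' := p)" "?J j p i (arr r')"
    have sm: "same {''i'', ''p''} (idx s) (idx r')" using * by (simp add: same_update)
    have "dval d r' = F j p" using * that(1) sm by (intro d) auto
    moreover have "ival base r' = bs" using sm by (rule base)
    ultimately show "runs (Set_array X (IAdd base (IVar ''i'')) (Add (Get X (IAdd base (IVar ''i''))) d))
        r' (?J j (Suc p)) (4 + 2 * iops base + dops d)"
      using * sm by (intro runs_Set_array) (auto simp: same_def)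
  qed simp
  show ?thesis
    unfolding fill_def
  proof (rule runs_weaken[OF runs_For[where I = ?I and N = m]])
    fix j i and r :: state assume *: "j < m" "idx r = i(''i'' := j)" "?I j i (arr r)"
    have sm: "same {''i'', ''p''} (idx s) (idx r)" using * by (simp add: same_update)
    show "runs (Seq (Set_array X (IAdd base (IVar ''i'')) (Num (IConst 0)))
         (For ''p'' cnt (Set_array X (IAdd base (IVar ''i'')) (Add (Get X (IAdd base (IVar ''i''))) d))))
       r (?I (Suc j)) (3 + iops base + iops cnt + b * (5 + 2 * iops base + dops d))"
    proof (rule runs_Seq)
      show "runs (Set_array X (IAdd base (IVar ''i'')) (Num (IConst 0))) r (?J j 0) (2 + iops base)"
        using * sm base[OF sm] by (intro runs_Set_array) (auto simp: same_def)
      fix r' :: state assume "?J j 0 (idx r') (arr r')"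
      from inner[OF *(1) this]
      show "runs (For ''p'' cnt (Set_array X (IAdd base (IVar ''i'')) (Add (Get X (IAdd base (IVar ''i''))) d)))
          r' (?I (Suc j)) (1 + iops cnt + b * (5 + 2 * iops base + dops d))"
        by (rule runs_weaken) (auto simp: less_Suc_eq)
    qed simp
  qed (use M in \<open>auto simp: algebra_simps\<close>)
qed

section \<open>Transforms along one axis of an array\<close>

text \<open>The level \<open>t\<close> of a transform is kept at the addresses from \<open>t * M\<close> on; an address
  \<open>(h * B + x) * lo + l\<close> within a level has coordinate \<open>x\<close> along the axis, which has
  length \<open>B\<close>.\<close>

definition axis_coord :: "iexp \<Rightarrow> iexp \<Rightarrow> iexp" where
  "axis_coord lo B = IMod (IDiv (IVar ''i'') lo) B"

definition axis_source :: "iexp \<Rightarrow> iexp \<Rightarrow> iexp \<Rightarrow> iexp" where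
  "axis_source b lo B =
     IAdd (IMul (IAdd (IMul (IDiv (IVar ''i'') (IMul B lo)) B)
       (IAdd (IMul (IDiv (axis_coord lo B) (IMul (IVar ''w'') b)) (IVar ''w''))
         (IAdd (IMul (IVar ''p'') (IDiv B b)) (IMod (axis_coord lo B) (IVar ''w''))))) lo)
       (IMod (IVar ''i'') lo)"

text \<open>Index expressions have no power operation: \<open>w\<close> carries \<open>b ^ t\<close>
  from level to level, and the axis length \<open>b ^ L\<close> is passed in as
  \<open>B\<close>.\<close>

definition transform :: "name \<Rightarrow> iexp \<Rightarrow> iexp \<Rightarrow> iexp \<Rightarrow> iexp \<Rightarrow> dexp \<Rightarrow> dexp \<Rightarrow> com" where
  "transform X L b lo B init coef =
     Seq (Set_index ''w'' (IConst 1))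
       (Seq (fill X (IConst 0) (IConst 1) init)
         (For ''t'' L
           (Seq (fill X (IMul (IAdd (IVar ''t'') (IConst 1)) (IVar ''M'')) b
                  (Mul coef (Get X (IAdd (IMul (IVar ''t'') (IVar ''M'')) (axis_source b lo B)))))
             (Set_index ''w'' (IMul (IVar ''w'') b)))))"

abbreviation loop_vars :: "name set" where
  "loop_vars \<equiv> {''t'', ''w'', ''i'', ''p''}"

lemma address_decode:
  fixes h B x lo l :: nat
  assumes "x < B" "l < lo"
  shows "((h * B + x) * lo + l) div lo = h * B + x" "((h * B + x) * lo + l) mod lo = l"
    "((h * B + x) * lo + l) div (B * lo) = h" "(h * B + x) mod B = x"
proof -
  show *: "((h * B + x) * lo + l) div lo = h * B + x" "((h * B + x) * lo + l) mod lo = l"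
    using assms by simp_all
  have "((h * B + x) * lo + l) div (lo * B) = (h * B + x) div B"
    by (simp only: div_mult2_eq *)
  then show "((h * B + x) * lo + l) div (B * lo) = h"
    using assms by (simp add: mult.commute)
  show "(h * B + x) mod B = x" using assms by simp
qed

lemma address_less:
  fixes h B x lo l :: nat
  assumes "h < hn" "x < B" "l < lo"
  shows "(h * B + x) * lo + l < hn * B * lo"
proof -
  have "h * B + x < hn * B"
    using assms mult_le_mono1[of "Suc h" hn B] by simp
  then show ?thesis
    using assms mult_le_mono1[of "Suc (h * B + x)" "hn * B" lo] by simp
qed

lemma address_encode:
  fixes i B lo hn :: nat
  assumes "i < hn * B * lo"
  obtains h x l where "h < hn" "x < B" "l < lo" "i = (h * B + x) * lo + l"
proof
  have pos: "0 < lo" "0 < B" using assms by (auto intro: gr0I)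
  show "i div lo div B < hn"
    using assms by (simp add: less_mult_imp_div_less)
  show "i div lo mod B < B" "i mod lo < lo" using pos by simp_all
  show "i = (i div lo div B * B + i div lo mod B) * lo + i mod lo"
    by (simp only: div_mult_mod_eq)
qed

lemma stage_source_less:
  fixes b t L x p :: nat
  assumes "0 < b" "t < L" "x < b ^ L" "p < b"
  shows "x div b ^ Suc t * b ^ t + (p * (b ^ L div b) + x mod b ^ t) < b ^ L"
proof -
  define e where "e = L - Suc t"
  have L: "L = Suc t + e" using assms by (simp add: e_def)
  have bL: "b ^ L div b = b ^ e * b ^ t" using assms by (simp add: L power_add mult_ac)
  have "x div b ^ Suc t < b ^ e"
    using assms by (intro less_mult_imp_div_less) (simp add: L power_add mult_ac)
  then have "Suc (x div b ^ Suc t) * b ^ t \<le> b ^ e * b ^ t"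
    by (intro mult_le_mono1) simp
  moreover have "x mod b ^ t < b ^ t" using assms by simp
  moreover have "Suc p * (b ^ e * b ^ t) \<le> b * (b ^ e * b ^ t)"
    using assms by (intro mult_le_mono1) simp
  moreover have "b ^ L = b * (b ^ e * b ^ t)" by (simp add: L power_add mult_ac)
  ultimately show ?thesis unfolding bL by simp
qed

text \<open>\<open>hn\<close> counts the blocks outside the axis and \<open>lo\<close> is the stride
  inside it. The stage kernel may depend on the outer index \<open>h\<close> because the label
  matrices differ for each deformation parameter.\<close>

lemma runs_transform:
  assumes M: "idx s ''M'' = m" "m = hn * b ^ L * lo" "0 < m" and b: "0 < b"
    and ev: "\<And>r. same loop_vars (idx s) (idx r) \<Longrightarrow>
      ival eL r = L \<and> ival eb r = b \<and> ival elo r = lo \<and> ival eB r = b ^ L"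
    and iops: "iops eL = 0" "iops eb = 0" "iops elo = 0" "iops eB = 0"
    and init: "\<And>r h x l. h < hn \<Longrightarrow> x < b ^ L \<Longrightarrow> l < lo \<Longrightarrow> same loop_vars (idx s) (idx r) \<Longrightarrow>
      idx r ''i'' = (h * b ^ L + x) * lo + l \<Longrightarrow> same {X} (arr s) (arr r) \<Longrightarrow> dval einit r = f h l x"
    and coef: "\<And>r t h x l p. t < L \<Longrightarrow> h < hn \<Longrightarrow> x < b ^ L \<Longrightarrow> l < lo \<Longrightarrow> p < b \<Longrightarrow>
      same loop_vars (idx s) (idx r) \<Longrightarrow> idx r ''t'' = t \<Longrightarrow> idx r ''w'' = b ^ t \<Longrightarrow>
      idx r ''i'' = (h * b ^ L + x) * lo + l \<Longrightarrow> idx r ''p'' = p \<Longrightarrow>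
      dval ecoef r = \<kappa> h t (x mod b ^ Suc t) p"
    and H: "\<And>h. h < hn \<Longrightarrow> transform_kernel b (\<kappa> h) (H h)"
  shows "runs (transform X eL eb elo eB einit ecoef) s
    (\<lambda>i a. same loop_vars (idx s) i \<and> same {X} (arr s) a \<and>
       (\<forall>h<hn. \<forall>x<b ^ L. \<forall>l<lo. a X (L * m + ((h * b ^ L + x) * lo + l)) =
          (\<Sum>y<b ^ L. H h L x y * f h l y)))
    ((53 + dops einit + dops ecoef) * ((L + 1) * (m * b)))"
proof -
  let ?G = "\<lambda>t h l. stage (\<kappa> h) b L (f h l) t"
  let ?fr = "\<lambda>i a. same loop_vars (idx s) i \<and> same {X} (arr s) a"
  let ?I = "\<lambda>t i a. ?fr i a \<and> i ''w'' = b ^ t \<and>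
    (\<forall>h<hn. \<forall>x<b ^ L. \<forall>l<lo. a X (t * m + ((h * b ^ L + x) * lo + l)) = ?G t h l x)"
  let ?K = "\<lambda>t i a. ?fr i a \<and> i ''t'' = t \<and> i ''w'' = b ^ t \<and>
    (\<forall>h<hn. \<forall>x<b ^ L. \<forall>l<lo. a X (Suc t * m + ((h * b ^ L + x) * lo + l)) = ?G (Suc t) h l x)"
  let ?h = "\<lambda>i. i div (b ^ L * lo)" and ?x = "\<lambda>i. i div lo mod b ^ L" and ?l = "\<lambda>i. i mod lo"
  have level0: "runs (fill X (IConst 0) (IConst 1) einit) r (?I 0) (1 + m * (9 + dops einit))"
    if r: "?fr (idx r) (arr r)" "idx r ''w'' = 1" for r :: state
  proof -
    have "runs (fill X (IConst 0) (IConst 1) einit) r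
      (\<lambda>i a. same {''i'', ''p''} (idx r) i \<and> same {X} (arr r) a \<and> (\<forall>x<0. a X x = arr r X x) \<and>
        (\<forall>i<m. a X (0 + i) = (\<Sum>p<1::nat. f (?h i) (?l i) (?x i))))
      (1 + m * (4 + iops (IConst 0) + iops (IConst 1) + 1 * (5 + 2 * iops (IConst 0) + dops einit)))"
    proof (rule runs_fill[where F = "\<lambda>i p. f (?h i) (?l i) (?x i)"])
      show "idx r ''M'' = m" using r M sameD by fastforce
      fix r' :: state and i p assume *: "i < m" "same {''i'', ''p''} (idx r) (idx r')" "idx r' ''i'' = i" "same {X} (arr r) (arr r')"
      obtain h x l where hxl: "h < hn" "x < b ^ L" "l < lo" "i = (h * b ^ L + x) * lo + l"
        using address_encode *(1) M(2) by metis
      have "same loop_vars (idx s) (idx r')" "same {X} (arr s) (arr r')"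
        using r(1) * by (auto simp: same_def)
      then have "dval einit r' = f h l x" using hxl * by (intro init) auto
      then show "dval einit r' = f (?h i) (?l i) (?x i)"
        using hxl by (simp only: address_decode)
    qed auto
    then show ?thesis
    proof (rule runs_weaken)
      fix i a
      assume *: "same {''i'', ''p''} (idx r) i \<and> same {X} (arr r) a \<and> (\<forall>x<0. a X x = arr r X x) \<and>
        (\<forall>i<m. a X (0 + i) = (\<Sum>p<1::nat. f (?h i) (?l i) (?x i)))"
      have "a X (0 * m + ((h * b ^ L + x) * lo + l)) = ?G 0 h l x"
        if "h < hn" "x < b ^ L" "l < lo" for h x l
      proof -
        have "(h * b ^ L + x) * lo + l < m" using address_less that M(2) by metis
        then show ?thesis using * that by (simp add: address_decode)
      qed
      moreover have "?fr i a" using * r(1) by (auto simp: same_def)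
      moreover have "i ''w'' = b ^ 0" using * r(2) by (simp add: same_def)
      ultimately show "?I 0 i a" by blast
    qed simp
  qed
  let ?d = "Mul ecoef (Get X (IAdd (IMul (IVar ''t'') (IVar ''M'')) (axis_source eb elo eB)))"
  let ?base = "IMul (IAdd (IVar ''t'') (IConst 1)) (IVar ''M'')"
  have cost_d: "dops ?d = 22 + dops ecoef"
    using iops by (simp add: axis_source_def axis_coord_def)
  have level: "runs (fill X ?base eb ?d) r (?K t) (1 + m * (6 + b * (31 + dops ecoef)))"
    if t: "t < L" and r: "?I t (idx r) (arr r)" "idx r ''t'' = t" for t and r :: state
  proof -
    let ?src = "\<lambda>x p. x div b ^ Suc t * b ^ t + (p * (b ^ L div b) + x mod b ^ t)"
    let ?F = "\<lambda>i p. \<kappa> (?h i) t (?x i mod b ^ Suc t) p * ?G t (?h i) (?l i) (?src (?x i) p)"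
    have Mr: "idx r' ''M'' = m" if "same {''i'', ''p''} (idx r) (idx r')" for r' :: state
      using r M that by (simp add: same_def)
    have "runs (fill X ?base eb ?d) r
      (\<lambda>i a. same {''i'', ''p''} (idx r) i \<and> same {X} (arr r) a \<and> (\<forall>x<Suc t * m. a X x = arr r X x) \<and>
        (\<forall>i<m. a X (Suc t * m + i) = (\<Sum>p<b. ?F i p)))
      (1 + m * (4 + iops ?base + iops eb + b * (5 + 2 * iops ?base + dops ?d)))"
    proof (rule runs_fill[where F = ?F])
      show "idx r ''M'' = m" by (simp add: Mr)
      fix r' :: state assume sm: "same {''i'', ''p''} (idx r) (idx r')"
      then have tr: "idx r' ''t'' = t" "idx r' ''w'' = b ^ t"
        using r by (simp_all add: same_def)
      show "ival ?base r' = Suc t * m" using sm by (simp add: tr Mr)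
      have sm': "same loop_vars (idx s) (idx r')" using r(1) sm by (auto simp: same_def)
      show "ival eb r' = b" using ev[OF sm'] by simp
      fix i p
      assume *: "i < m" "p < b" "idx r' ''i'' = i" "idx r' ''p'' = p" "same {X} (arr r) (arr r')"
        "\<forall>x<Suc t * m. arr r' X x = arr r X x"
      obtain h x l where hxl: "h < hn" "x < b ^ L" "l < lo" "i = (h * b ^ L + x) * lo + l"
        using address_encode *(1) M(2) by metis
      have co: "dval ecoef r' = \<kappa> h t (x mod b ^ Suc t) p"
        using coef[OF t hxl(1-3) *(2) sm' tr] hxl * by simp
      have src: "ival (axis_source eb elo eB) r' = (h * b ^ L + ?src x p) * lo + l"
        using ev[OF sm'] tr * hxl address_decode[OF hxl(2,3)]
        by (simp add: axis_source_def axis_coord_def mult.commute[of "b ^ t" b])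
      have x': "?src x p < b ^ L" by (rule stage_source_less[OF b t hxl(2) *(2)])
      \<comment> \<open>The source lies on level \<open>t\<close>, below the base of the level being
        written, so it still has its old value.\<close>
      have "(h * b ^ L + ?src x p) * lo + l < m"
        using address_less[OF hxl(1) x' hxl(3)] M(2) by simp
      then have "arr r' X (t * m + ((h * b ^ L + ?src x p) * lo + l)) =
          arr r X (t * m + ((h * b ^ L + ?src x p) * lo + l))"
        using *(6) by (simp only: mult_Suc)
      also have "\<dots> = ?G t h l (?src x p)" using r hxl x' by blast
      finally have "arr r' X (t * m + ((h * b ^ L + ?src x p) * lo + l)) = ?G t h l (?src x p)" .
      then have "dval ?d r' = \<kappa> h t (x mod b ^ Suc t) p * ?G t h l (?src x p)"
        using sm by (simp only: dval.simps ival.simps co src tr Mr)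
      then show "dval ?d r' = ?F i p"
        using hxl by (simp only: address_decode)
    qed
    then show ?thesis
    proof (rule runs_weaken)
      fix i a
      assume *: "same {''i'', ''p''} (idx r) i \<and> same {X} (arr r) a \<and> (\<forall>x<Suc t * m. a X x = arr r X x) \<and>
        (\<forall>i<m. a X (Suc t * m + i) = (\<Sum>p<b. ?F i p))"
      have "a X (Suc t * m + ((h * b ^ L + x) * lo + l)) = ?G (Suc t) h l x"
        if "h < hn" "x < b ^ L" "l < lo" for h x l
      proof -
        have "(h * b ^ L + x) * lo + l < m" using address_less that M(2) by metis
        then have "a X (Suc t * m + ((h * b ^ L + x) * lo + l)) = (\<Sum>p<b. ?F ((h * b ^ L + x) * lo + l) p)"
          using * by blast
        then show ?thesis using that by (simp only: address_decode stage.simps)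
      qed
      moreover have "?fr i a" using * r(1) by (auto simp: same_def)
      moreover have "i ''w'' = b ^ t" "i ''t'' = t"
        using * r by (simp_all add: same_def)
      ultimately show "?K t i a" by blast
    next
      show "1 + m * (4 + iops ?base + iops eb + b * (5 + 2 * iops ?base + dops ?d)) \<le>
          1 + m * (6 + b * (31 + dops ecoef))"
        unfolding cost_d using iops by (simp add: algebra_simps)
    qed
  qed
  have loop: "runs (For ''t'' eL (Seq (fill X ?base eb ?d) (Set_index ''w'' (IMul (IVar ''w'') eb)))) r (?I L)
      (1 + L * (4 + m * (6 + b * (31 + dops ecoef))))"
    if "?I 0 (idx r) (arr r)" for r :: state
  proof (rule runs_For[where I = ?I])
    show "ival eL r = L" using ev that by blast
    show "?I 0 (idx r) (arr r)" by (fact that)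
    fix t i and r' :: state assume *: "t < L" "idx r' = i(''t'' := t)" "?I t i (arr r')"
    show "runs (Seq (fill X ?base eb ?d) (Set_index ''w'' (IMul (IVar ''w'') eb))) r' (?I (Suc t))
        (3 + m * (6 + b * (31 + dops ecoef)))"
    proof (rule runs_Seq)
      show "runs (fill X ?base eb ?d) r' (?K t) (1 + m * (6 + b * (31 + dops ecoef)))"
        using * by (intro level) (auto simp: same_update)
      fix r'' :: state assume K: "?K t (idx r'') (arr r'')"
      then have "ival eb r'' = b" using ev by blast
      then show "runs (Set_index ''w'' (IMul (IVar ''w'') eb)) r'' (?I (Suc t)) 2"
        using K iops by (intro runs_Set_index) (auto simp: same_update mult.commute)
    qed simp
  qed (use iops in simp)
  have "runs (transform X eL eb elo eB einit ecoef) s (?I L)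
      (1 + ((1 + m * (9 + dops einit)) + (1 + L * (4 + m * (6 + b * (31 + dops ecoef))))))"
    unfolding transform_def
  proof (rule runs_Seq)
    show "runs (Set_index ''w'' (IConst 1)) s (\<lambda>i a. ?fr i a \<and> i ''w'' = 1) 1"
      by (rule runs_Set_index) (simp_all add: same_update)
    fix r :: state assume "?fr (idx r) (arr r) \<and> idx r ''w'' = 1"
    then show "runs (Seq (fill X (IConst 0) (IConst 1) einit)
        (For ''t'' eL (Seq (fill X ?base eb ?d) (Set_index ''w'' (IMul (IVar ''w'') eb))))) r (?I L)
        ((1 + m * (9 + dops einit)) + (1 + L * (4 + m * (6 + b * (31 + dops ecoef)))))"
      by (intro runs_Seq[OF level0 loop]) auto
  qed simp
  then show ?thesis
  proof (rule runs_weaken)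
    fix i a assume *: "?I L i a"
    then show "same loop_vars (idx s) i \<and> same {X} (arr s) a \<and>
       (\<forall>h<hn. \<forall>x<b ^ L. \<forall>l<lo. a X (L * m + ((h * b ^ L + x) * lo + l)) =
          (\<Sum>y<b ^ L. H h L x y * f h l y))"
      using stage_final[OF H b] by simp
  next
    \<comment> \<open>Every lower-order term is absorbed into \<open>m * b\<close>:
      \<open>41 = 4 + 6 + 31\<close> for one level, and \<open>53 = 3 + 9 + 41\<close> also covers
      the initial level and the loop overhead.\<close>
    have mb: "m \<le> m * b" "1 \<le> m * b" using M b by simp_all
    have "4 + m * (6 + b * (31 + dops ecoef)) \<le> (41 + dops ecoef) * (m * b)"
    proof -
      have "4 + m * (6 + b * (31 + dops ecoef)) = 4 * 1 + 6 * m + (31 + dops ecoef) * (m * b)"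
        by (simp add: algebra_simps)
      also have "\<dots> \<le> 4 * (m * b) + 6 * (m * b) + (31 + dops ecoef) * (m * b)"
        using mb by (intro add_mono mult_le_mono2) auto
      finally show ?thesis by (simp add: algebra_simps)
    qed
    then have "L * (4 + m * (6 + b * (31 + dops ecoef))) \<le> L * ((41 + dops ecoef) * (m * b))"
      by (rule mult_le_mono2)
    moreover have "(9 + dops einit) * m \<le> (9 + dops einit) * (m * b)"
      using mb by (intro mult_le_mono2)
    ultimately have "1 + ((1 + m * (9 + dops einit)) + (1 + L * (4 + m * (6 + b * (31 + dops ecoef))))) \<le>
        3 * (m * b) + (9 + dops einit) * (m * b) + L * ((41 + dops ecoef) * (m * b))"
      using mb(2) unfolding mult.commute[of m "9 + dops einit"] by linarith
    also have "\<dots> \<le> (53 + dops einit + dops ecoef) * ((L + 1) * (m * b))"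
      by (simp add: algebra_simps)
    finally show "1 + ((1 + m * (9 + dops einit)) + (1 + L * (4 + m * (6 + b * (31 + dops ecoef))))) \<le>
        (53 + dops einit + dops ecoef) * ((L + 1) * (m * b))" .
  qed
qed

section \<open>Labels as digits\<close>

text \<open>The case \<open>\<tau> = UNIV\<close> needs no clause of its own: there
  \<open>ell \<tau> = 0\<close>, and the only number is already the top one.\<close>

definition side_label :: "side \<Rightarrow> nat set \<Rightarrow> nat \<Rightarrow> label" where
  "side_label t \<tau> j = (if infinite \<tau> \<and> j = ell \<tau> then At_least t j else Exact t j)"

lemma label_num_side_label [simp]: "label_num (side_label t \<tau> j) = j"
  by (simp add: side_label_def)

lemma side_labels_eq: "side_labels t \<tau> = side_label t \<tau> ` {..ell \<tau>}"
proof -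
  have "{..ell \<tau>} = insert (ell \<tau>) {..<ell \<tau>}"
    by auto
  then show ?thesis
    by (auto simp: side_labels_def side_label_def ell_def image_iff)
qed

lemma card_side_labels: "card (side_labels t \<tau>) = ell \<tau> + 1"
proof -
  have "inj_on (side_label t \<tau>) {..ell \<tau>}"
    by (metis inj_onI label_num_side_label)
  then show ?thesis
    by (simp add: side_labels_eq card_image)
qed

lemma side_oplus_iff:
  assumes "a \<le> ell \<tau>" "b \<le> ell \<tau>" "c \<le> ell \<tau>"
  shows "side_oplus t \<tau> (side_label t \<tau> a) (side_label t \<tau> b) = Some (side_label t \<tau> c) \<longleftrightarrow>
    side_sum (finite \<tau>) (ell \<tau>) a b c"
proof -
  have "At_least t (ell \<tau>) \<in> side_labels t \<tau> \<longleftrightarrow> infinite \<tau>"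
    by (auto simp: side_labels_def ell_def)
  moreover have "Exact t e \<in> side_labels t \<tau> \<longleftrightarrow> (if finite \<tau> then e \<le> ell \<tau> else e < ell \<tau>)" for e
    by (auto simp: side_labels_def ell_def)
  ultimately show ?thesis
    using assms by (auto simp: side_oplus_def Let_def side_label_def side_sum_def min_def)
qed

definition label_of :: "nat set \<Rightarrow> nat set \<Rightarrow> nat \<Rightarrow> label" where
  "label_of \<sigma> \<rho> d =
     (if d \<le> ell \<sigma> then side_label Sigma_side \<sigma> d else side_label Rho_side \<rho> (d - (ell \<sigma> + 1)))"

lemma label_index_label_of: "label_index \<sigma> (label_of \<sigma> \<rho> d) = d"
  by (auto simp: label_of_def side_label_def card_side_labels)

lemma labels_eq: "labels \<sigma> \<rho> = label_of \<sigma> \<rho> ` {..<ell \<sigma> + ell \<rho> + 2}"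
proof -
  have "{..<ell \<sigma> + ell \<rho> + 2} = {..ell \<sigma>} \<union> (\<lambda>j. j + (ell \<sigma> + 1)) ` {..ell \<rho>}"
  proof (rule set_eqI)
    fix x
    show "x \<in> {..<ell \<sigma> + ell \<rho> + 2} \<longleftrightarrow> x \<in> {..ell \<sigma>} \<union> (\<lambda>j. j + (ell \<sigma> + 1)) ` {..ell \<rho>}"
      by (auto simp: image_iff intro!: bexI[of _ "x - (ell \<sigma> + 1)"])
  qed
  moreover have "label_of \<sigma> \<rho> ` {..ell \<sigma>} = side_label Sigma_side \<sigma> ` {..ell \<sigma>}"
    by (intro image_cong) (simp_all add: label_of_def)
  moreover have "label_of \<sigma> \<rho> ` (\<lambda>j. j + (ell \<sigma> + 1)) ` {..ell \<rho>} = side_label Rho_side \<rho> ` {..ell \<rho>}"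
    unfolding image_image by (intro image_cong) (simp_all add: label_of_def)
  ultimately show ?thesis
    by (simp only: labels_def side_labels_eq image_Un)
qed

lemma card_labels: "card (labels \<sigma> \<rho>) = ell \<sigma> + ell \<rho> + 2"
proof -
  have "inj_on (label_of \<sigma> \<rho>) {..<ell \<sigma> + ell \<rho> + 2}"
    by (metis inj_onI label_index_label_of)
  then show ?thesis
    by (simp add: labels_eq card_image)
qed

lemma oplus_iff:
  assumes "a < card (labels \<sigma> \<rho>)" "b < card (labels \<sigma> \<rho>)" "c < card (labels \<sigma> \<rho>)"
  shows "oplus \<sigma> \<rho> (label_of \<sigma> \<rho> a) (label_of \<sigma> \<rho> b) = Some (label_of \<sigma> \<rho> c) \<longleftrightarrow>
    label_sum (finite \<sigma>) (ell \<sigma>) (finite \<rho>) (ell \<rho>) a b c"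
proof -
  have sig: "label_of \<sigma> \<rho> d \<in> side_labels Sigma_side \<sigma> \<longleftrightarrow> d \<le> ell \<sigma>" for d
    by (auto simp: label_of_def side_labels_eq side_label_def image_iff split: if_splits)
  have rho: "label_of \<sigma> \<rho> d \<in> side_labels Rho_side \<rho> \<longleftrightarrow> ell \<sigma> < d" if "d < card (labels \<sigma> \<rho>)" for d
  proof
    assume "ell \<sigma> < d"
    then show "label_of \<sigma> \<rho> d \<in> side_labels Rho_side \<rho>"
      using that by (auto simp: label_of_def side_labels_eq card_labels)
  qed (auto simp: label_of_def side_labels_eq side_label_def split: if_splits)
  \<comment> \<open>This excludes a result \<open>c\<close> on the other side than its two
    summands.\<close>
  have rng: "side_oplus t \<tau> x y = Some z \<Longrightarrow> z \<in> side_labels t \<tau>" for t \<tau> x y z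
    by (auto simp: side_oplus_def Let_def split: if_splits)
  consider "a \<le> ell \<sigma>" "b \<le> ell \<sigma>" | "ell \<sigma> < a" "ell \<sigma> < b" | "a \<le> ell \<sigma> \<longleftrightarrow> ell \<sigma> < b"
    by linarith
  then show ?thesis
  proof cases
    case 1
    then have "oplus \<sigma> \<rho> (label_of \<sigma> \<rho> a) (label_of \<sigma> \<rho> b) =
        side_oplus Sigma_side \<sigma> (label_of \<sigma> \<rho> a) (label_of \<sigma> \<rho> b)"
      by (simp add: oplus_def sig)
    moreover have "label_of \<sigma> \<rho> a = side_label Sigma_side \<sigma> a" "label_of \<sigma> \<rho> b = side_label Sigma_side \<sigma> b"
      "c \<le> ell \<sigma> \<Longrightarrow> label_of \<sigma> \<rho> c = side_label Sigma_side \<sigma> c"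
      using 1 by (simp_all add: label_of_def)
    ultimately show ?thesis
      using 1 side_oplus_iff[of a \<sigma> b c Sigma_side] rng[of Sigma_side \<sigma>] sig[of c]
      by (auto simp: label_sum_def)
  next
    case 2
    then have "oplus \<sigma> \<rho> (label_of \<sigma> \<rho> a) (label_of \<sigma> \<rho> b) =
        side_oplus Rho_side \<rho> (label_of \<sigma> \<rho> a) (label_of \<sigma> \<rho> b)"
      using assms by (simp add: oplus_def sig rho)
    moreover have "label_of \<sigma> \<rho> a = side_label Rho_side \<rho> (a - (ell \<sigma> + 1))"
      "label_of \<sigma> \<rho> b = side_label Rho_side \<rho> (b - (ell \<sigma> + 1))"
      "ell \<sigma> < c \<Longrightarrow> label_of \<sigma> \<rho> c = side_label Rho_side \<rho> (c - (ell \<sigma> + 1))"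
      using 2 by (simp_all add: label_of_def)
    moreover have "a - (ell \<sigma> + 1) \<le> ell \<rho>" "b - (ell \<sigma> + 1) \<le> ell \<rho>" "c - (ell \<sigma> + 1) \<le> ell \<rho>"
      using assms by (auto simp: card_labels)
    ultimately show ?thesis
      using 2 side_oplus_iff[of "a - (ell \<sigma> + 1)" \<rho> "b - (ell \<sigma> + 1)" "c - (ell \<sigma> + 1)" Rho_side]
        rng[of Rho_side \<rho>] rho[OF assms(3)]
      by (auto simp: label_sum_def)
  next
    case 3
    then show ?thesis
      using sig rho assms by (auto simp: oplus_def label_sum_def)
  qed
qed

section \<open>Label vectors as numbers in base \<open>s\<close>\<close>

definition vec_of :: "nat set \<Rightarrow> nat set \<Rightarrow> nat \<Rightarrow> nat \<Rightarrow> label list" where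
  "vec_of \<sigma> \<rho> k x = map (\<lambda>i. label_of \<sigma> \<rho> (digit (card (labels \<sigma> \<rho>)) x i)) [0..<k]"

lemma vec_index_vec_of:
  assumes "x < card (labels \<sigma> \<rho>) ^ k"
  shows "vec_index \<sigma> \<rho> (vec_of \<sigma> \<rho> k x) = x"
  using sum_of_digits[OF assms] by (simp add: vec_index_def vec_of_def label_index_label_of)

lemma label_vecs_eq: "label_vecs \<sigma> \<rho> k = vec_of \<sigma> \<rho> k ` {..<card (labels \<sigma> \<rho>) ^ k}"
proof (intro equalityI subsetI)
  let ?s = "card (labels \<sigma> \<rho>)"
  fix c assume "c \<in> label_vecs \<sigma> \<rho> k"
  then have c: "length c = k" "\<And>i. i < k \<Longrightarrow> c ! i \<in> labels \<sigma> \<rho>"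
    by (auto simp: label_vecs_def)
  have lab: "label_of \<sigma> \<rho> (label_index \<sigma> (c ! i)) = c ! i" "label_index \<sigma> (c ! i) < ?s" if "i < k" for i
    using c(2)[OF that] unfolding card_labels by (auto simp: labels_eq label_index_label_of)
  have "vec_index \<sigma> \<rho> c < ?s ^ k"
    unfolding vec_index_def c(1) by (rule digits_less_power) (use lab in auto)
  moreover have "c = vec_of \<sigma> \<rho> k (vec_index \<sigma> \<rho> c)"
  proof (rule nth_equalityI)
    fix i assume "i < length c"
    then have "digit ?s (vec_index \<sigma> \<rho> c) i = label_index \<sigma> (c ! i)"
      unfolding vec_index_def c(1) by (intro digit_of_digits) (use lab in auto)
    then show "c ! i = vec_of \<sigma> \<rho> k (vec_index \<sigma> \<rho> c) ! i"
      using \<open>i < length c\<close> lab c(1) by (simp add: vec_of_def)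
  qed (simp add: vec_of_def c)
  ultimately show "c \<in> vec_of \<sigma> \<rho> k ` {..<?s ^ k}" by blast
next
  fix c assume "c \<in> vec_of \<sigma> \<rho> k ` {..<card (labels \<sigma> \<rho>) ^ k}"
  moreover have "label_of \<sigma> \<rho> (digit (card (labels \<sigma> \<rho>)) x i) \<in> labels \<sigma> \<rho>" for x i
    using digit_less[of "card (labels \<sigma> \<rho>)" x i] unfolding card_labels by (simp add: labels_eq)
  ultimately show "c \<in> label_vecs \<sigma> \<rho> k"
    by (auto simp: label_vecs_def vec_of_def)
qed

definition vec_sum :: "nat set \<Rightarrow> nat set \<Rightarrow> nat \<Rightarrow> nat \<Rightarrow> nat \<Rightarrow> nat \<Rightarrow> bool" where
  "vec_sum \<sigma> \<rho> k x y z \<longleftrightarrow> (\<forall>i<k. label_sum (finite \<sigma>) (ell \<sigma>) (finite \<rho>) (ell \<rho>)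
     (digit (card (labels \<sigma> \<rho>)) x i) (digit (card (labels \<sigma> \<rho>)) y i) (digit (card (labels \<sigma> \<rho>)) z i))"

lemma vec_oplus_iff:
  "vec_oplus \<sigma> \<rho> (vec_of \<sigma> \<rho> k x) (vec_of \<sigma> \<rho> k y) (vec_of \<sigma> \<rho> k z) \<longleftrightarrow> vec_sum \<sigma> \<rho> k x y z"
proof -
  have "digit (card (labels \<sigma> \<rho>)) x i < card (labels \<sigma> \<rho>)" for x i
    by (rule digit_less) (simp add: card_labels)
  then show ?thesis
    by (simp add: vec_oplus_def vec_of_def vec_sum_def oplus_iff)
qed

definition achieved :: "nat set \<Rightarrow> nat set \<Rightarrow> nat \<Rightarrow> table \<Rightarrow> table \<Rightarrow> nat \<Rightarrow> nat set" where
  "achieved \<sigma> \<rho> k Al Ar z =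
     {a + b | a b x y. x < card (labels \<sigma> \<rho>) ^ k \<and> y < card (labels \<sigma> \<rho>) ^ k \<and>
        vec_sum \<sigma> \<rho> k x y z \<and> Al (vec_of \<sigma> \<rho> k x) = Some a \<and> Ar (vec_of \<sigma> \<rho> k y) = Some b}"

lemma join_vec_of: "join v \<sigma> \<rho> k Al Ar (vec_of \<sigma> \<rho> k z) = opt v (achieved \<sigma> \<rho> k Al Ar z)"
proof -
  have "achieved \<sigma> \<rho> k Al Ar z =
      {a + b | a b cl cr. cl \<in> label_vecs \<sigma> \<rho> k \<and> cr \<in> label_vecs \<sigma> \<rho> k \<and>
         vec_oplus \<sigma> \<rho> cl cr (vec_of \<sigma> \<rho> k z) \<and> Al cl = Some a \<and> Ar cr = Some b}"
    unfolding achieved_def label_vecs_eq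
    by (auto simp: vec_oplus_iff[symmetric])
  then show ?thesis by (simp add: join_def)
qed

section \<open>The counting identity\<close>

abbreviation eval_matrix :: "nat set \<Rightarrow> nat set \<Rightarrow> nat \<Rightarrow> nat \<Rightarrow> nat \<Rightarrow> nat \<Rightarrow> complex" where
  "eval_matrix \<sigma> \<rho> k j \<equiv> blocks (ell \<sigma> + 1)
     (eval_entry k j (ell \<sigma> + of_bool (finite \<sigma>))) (eval_entry k j (ell \<rho> + of_bool (finite \<rho>)))"

abbreviation interp_matrix :: "nat set \<Rightarrow> nat set \<Rightarrow> nat \<Rightarrow> nat \<Rightarrow> nat \<Rightarrow> nat \<Rightarrow> complex" where
  "interp_matrix \<sigma> \<rho> k j \<equiv> blocks (ell \<sigma> + 1)
     (interp_entry k j (ell \<sigma> + of_bool (finite \<sigma>))) (interp_entry k j (ell \<rho> + of_bool (finite \<rho>)))"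

text \<open>Fourier transform of the indicator of the value \<open>f y\<close>. The code
  \<open>-1\<close> of \<open>\<bottom>\<close> equals no \<open>of_nat u\<close>, so such an entry
  has the zero spectrum and drops out of every count.\<close>

definition value_spectrum :: "nat \<Rightarrow> (nat \<Rightarrow> complex) \<Rightarrow> nat \<Rightarrow> nat \<Rightarrow> complex" where
  "value_spectrum N f y q = (\<Sum>u<N. unit_root (u * q) N * of_bool (f y = of_nat u))"

definition spectrum ::
  "nat set \<Rightarrow> nat set \<Rightarrow> nat \<Rightarrow> nat \<Rightarrow> (nat \<Rightarrow> complex) \<Rightarrow> nat \<Rightarrow> nat \<Rightarrow> nat \<Rightarrow> complex" where
  "spectrum \<sigma> \<rho> k N f j x q = (let s = card (labels \<sigma> \<rho>) in
     \<Sum>y<s ^ k. tensor_kernel s (eval_matrix \<sigma> \<rho> k j) k x y * value_spectrum N f y q)"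

text \<open>Only the label transform is undone here; the coordinate \<open>q\<close> is still a
  frequency of the values.\<close>

definition inverse_spectrum ::
  "nat set \<Rightarrow> nat set \<Rightarrow> nat \<Rightarrow> nat \<Rightarrow> (nat \<Rightarrow> complex) \<Rightarrow> (nat \<Rightarrow> complex) \<Rightarrow> nat \<Rightarrow> nat \<Rightarrow> nat \<Rightarrow> complex" where
  "inverse_spectrum \<sigma> \<rho> k N f g j z q = (let s = card (labels \<sigma> \<rho>) in
     \<Sum>x<s ^ k. tensor_kernel s (interp_matrix \<sigma> \<rho> k j) k z x *
       (spectrum \<sigma> \<rho> k N f j x q * spectrum \<sigma> \<rho> k N g j x q))"

text \<open>For fixed \<open>x\<close> and \<open>y\<close> the sum over the points is a product
  over the coordinates, each factor affine in \<open>eps k j\<close> by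
  \<open>label_algebra\<close>; summing over \<open>j\<close> removes all defects. The value spectra
  do not involve \<open>j\<close> and pass through unchanged.\<close>

lemma sum_inverse_spectrum:
  assumes s: "s = card (labels \<sigma> \<rho>)"
  shows "(\<Sum>j<k + 1. inverse_spectrum \<sigma> \<rho> k N f g j z q) =
    of_nat (k + 1) * (\<Sum>x<s ^ k. \<Sum>y<s ^ k. of_bool (vec_sum \<sigma> \<rho> k x y z) *
      (value_spectrum N f x q * value_spectrum N g y q))"
proof -
  have sl: "s = ell \<sigma> + ell \<rho> + 2" by (simp only: s card_labels)
  obtain D where "\<And>j a b c. a < ell \<sigma> + ell \<rho> + 2 \<Longrightarrow> b < ell \<sigma> + ell \<rho> + 2 \<Longrightarrow> c < ell \<sigma> + ell \<rho> + 2 \<Longrightarrow>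
      (\<Sum>p<ell \<sigma> + ell \<rho> + 2. interp_matrix \<sigma> \<rho> k j c p * (eval_matrix \<sigma> \<rho> k j p a * eval_matrix \<sigma> \<rho> k j p b)) =
      of_bool (label_sum (finite \<sigma>) (ell \<sigma>) (finite \<rho>) (ell \<rho>) a b c) + eps k j * D a b c"
    by (rule label_algebra[OF refl refl, where ls = "ell \<sigma>" and lr = "ell \<rho>" and k = k and
      fs = "finite \<sigma>" and fr = "finite \<rho>"], rule that)
  note D = this[folded sl]
  have dig: "digit s x i < s" for x i
    by (rule digit_less) (simp add: s card_labels)
  let ?U = "\<lambda>j. tensor_kernel s (interp_matrix \<sigma> \<rho> k j) k"
  let ?T = "\<lambda>j. tensor_kernel s (eval_matrix \<sigma> \<rho> k j) k"
  let ?v = "\<lambda>x y. value_spectrum N f x q * value_spectrum N g y q"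
  have conv: "(\<Sum>j<k + 1. \<Sum>w<s ^ k. ?U j z w * (?T j w x * ?T j w y)) =
      of_nat (k + 1) * of_bool (vec_sum \<sigma> \<rho> k x y z)" for x y
  proof -
    have "(\<Sum>j<k + 1. \<Sum>w<s ^ k. ?U j z w * (?T j w x * ?T j w y)) =
      (\<Sum>j<k + 1. \<Prod>i<k. of_bool (label_sum (finite \<sigma>) (ell \<sigma>) (finite \<rho>) (ell \<rho>)
          (digit s x i) (digit s y i) (digit s z i)) + eps k j * D (digit s x i) (digit s y i) (digit s z i))"
      by (simp only: tensor_kernel_convolution D dig)
    also have "\<dots> = of_nat (k + 1) * (\<Prod>i<k. of_bool (label_sum (finite \<sigma>) (ell \<sigma>) (finite \<rho>) (ell \<rho>)
          (digit s x i) (digit s y i) (digit s z i)))"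
      by (rule sum_prod_deformation)
    also have "(\<Prod>i<k. of_bool (label_sum (finite \<sigma>) (ell \<sigma>) (finite \<rho>) (ell \<rho>)
          (digit s x i) (digit s y i) (digit s z i))) = (of_bool (vec_sum \<sigma> \<rho> k x y z) :: complex)"
      unfolding vec_sum_def s[symmetric] by (induction k) (auto simp: less_Suc_eq)
    finally show ?thesis .
  qed
  have "inverse_spectrum \<sigma> \<rho> k N f g j z q =
      (\<Sum>x<s ^ k. \<Sum>y<s ^ k. (\<Sum>w<s ^ k. ?U j z w * (?T j w x * ?T j w y)) * ?v x y)" for j
  proof -
    have "inverse_spectrum \<sigma> \<rho> k N f g j z q =
        (\<Sum>w<s ^ k. \<Sum>x<s ^ k. \<Sum>y<s ^ k. ?U j z w * (?T j w x * ?T j w y) * ?v x y)"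
      unfolding inverse_spectrum_def spectrum_def Let_def s[symmetric] sum_product unfolding sum_distrib_left
      by (intro sum.cong refl) (simp add: mult_ac)
    also have "\<dots> = (\<Sum>x<s ^ k. \<Sum>w<s ^ k. \<Sum>y<s ^ k. ?U j z w * (?T j w x * ?T j w y) * ?v x y)"
      by (rule sum.swap)
    also have "\<dots> = (\<Sum>x<s ^ k. \<Sum>y<s ^ k. \<Sum>w<s ^ k. ?U j z w * (?T j w x * ?T j w y) * ?v x y)"
      by (intro sum.cong refl sum.swap)
    finally show ?thesis by (simp only: sum_distrib_right)
  qed
  then have "(\<Sum>j<k + 1. inverse_spectrum \<sigma> \<rho> k N f g j z q) =
      (\<Sum>j<k + 1. \<Sum>x<s ^ k. \<Sum>y<s ^ k. (\<Sum>w<s ^ k. ?U j z w * (?T j w x * ?T j w y)) * ?v x y)"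
    by (simp only:)
  also have "\<dots> = (\<Sum>x<s ^ k. \<Sum>j<k + 1. \<Sum>y<s ^ k. (\<Sum>w<s ^ k. ?U j z w * (?T j w x * ?T j w y)) * ?v x y)"
    by (rule sum.swap)
  also have "\<dots> = (\<Sum>x<s ^ k. \<Sum>y<s ^ k. \<Sum>j<k + 1. (\<Sum>w<s ^ k. ?U j z w * (?T j w x * ?T j w y)) * ?v x y)"
    by (intro sum.cong refl sum.swap)
  also have "\<dots> = (\<Sum>x<s ^ k. \<Sum>y<s ^ k. of_nat (k + 1) * of_bool (vec_sum \<sigma> \<rho> k x y z) * ?v x y)"
    by (simp only: sum_distrib_right[symmetric] conv)
  finally show ?thesis by (simp only: sum_distrib_left mult.assoc)
qed

section \<open>Reading achieved values off the counts\<close>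

text \<open>Orthogonality of the characters modulo \<open>N\<close>. Writing the result as the image
  of a natural number excludes cancellation: it is zero only if every single term is.\<close>

lemma counting_identity:
  assumes s: "s = card (labels \<sigma> \<rho>)" and N: "0 < N"
  shows "(\<Sum>j<k + 1. \<Sum>q<N. unit_root (q * v) N * inverse_spectrum \<sigma> \<rho> k N f g j z q) =
    of_nat ((k + 1) * N * (\<Sum>x<s ^ k. \<Sum>y<s ^ k. \<Sum>u<N. \<Sum>u'<N.
      of_bool (vec_sum \<sigma> \<rho> k x y z \<and> f x = of_nat u \<and> g y = of_nat u' \<and> N dvd u + u' + v)))"
proof -
  have vals: "(\<Sum>q<N. unit_root (q * v) N * (value_spectrum N f x q * value_spectrum N g y q)) =
      of_nat N * (\<Sum>u<N. \<Sum>u'<N. of_bool (f x = of_nat u \<and> g y = of_nat u' \<and> N dvd u + u' + v))" for x y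
  proof -
    have "(\<Sum>q<N. unit_root (q * v) N * (value_spectrum N f x q * value_spectrum N g y q)) =
        (\<Sum>q<N. \<Sum>u<N. \<Sum>u'<N. unit_root (q * (u + u' + v)) N * of_bool (f x = of_nat u \<and> g y = of_nat u'))"
      unfolding value_spectrum_def sum_product unfolding sum_distrib_left
    proof (intro sum.cong refl)
      fix q u u'
      have "unit_root (q * (u + u' + v)) N = unit_root (q * v) N * (unit_root (u * q) N * unit_root (u' * q) N)"
        unfolding unit_root_add[symmetric] by (simp add: algebra_simps)
      then show "unit_root (q * v) N * (unit_root (u * q) N * of_bool (f x = of_nat u) *
            (unit_root (u' * q) N * of_bool (g y = of_nat u'))) =
          unit_root (q * (u + u' + v)) N * of_bool (f x = of_nat u \<and> g y = of_nat u')"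
        by (simp add: of_bool_conj mult_ac)
    qed
    also have "\<dots> = (\<Sum>u<N. \<Sum>q<N. \<Sum>u'<N. unit_root (q * (u + u' + v)) N * of_bool (f x = of_nat u \<and> g y = of_nat u'))"
      by (rule sum.swap)
    also have "\<dots> = (\<Sum>u<N. \<Sum>u'<N. \<Sum>q<N. unit_root (q * (u + u' + v)) N * of_bool (f x = of_nat u \<and> g y = of_nat u'))"
      by (intro sum.cong refl sum.swap)
    also have "\<dots> = (\<Sum>u<N. \<Sum>u'<N. of_nat N * of_bool (f x = of_nat u \<and> g y = of_nat u' \<and> N dvd u + u' + v))"
      unfolding sum_distrib_right[symmetric] sum_unit_root[OF N]
      by (intro sum.cong refl) simp
    finally show ?thesis by (simp only: sum_distrib_left)
  qed
  have "(\<Sum>j<k + 1. \<Sum>q<N. unit_root (q * v) N * inverse_spectrum \<sigma> \<rho> k N f g j z q) =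
      (\<Sum>q<N. unit_root (q * v) N * (\<Sum>j<k + 1. inverse_spectrum \<sigma> \<rho> k N f g j z q))"
    unfolding sum_distrib_left by (rule sum.swap)
  also have "\<dots> = of_nat (k + 1) * (\<Sum>q<N. \<Sum>x<s ^ k. \<Sum>y<s ^ k. of_bool (vec_sum \<sigma> \<rho> k x y z) *
      (unit_root (q * v) N * (value_spectrum N f x q * value_spectrum N g y q)))"
    unfolding sum_inverse_spectrum[OF s] sum_distrib_left by (intro sum.cong refl) (simp only: mult_ac)
  also have "(\<Sum>q<N. \<Sum>x<s ^ k. \<Sum>y<s ^ k. of_bool (vec_sum \<sigma> \<rho> k x y z) *
      (unit_root (q * v) N * (value_spectrum N f x q * value_spectrum N g y q))) =
    (\<Sum>x<s ^ k. \<Sum>q<N. \<Sum>y<s ^ k. of_bool (vec_sum \<sigma> \<rho> k x y z) *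
      (unit_root (q * v) N * (value_spectrum N f x q * value_spectrum N g y q)))"
    by (rule sum.swap)
  also have "\<dots> = (\<Sum>x<s ^ k. \<Sum>y<s ^ k. \<Sum>q<N. of_bool (vec_sum \<sigma> \<rho> k x y z) *
      (unit_root (q * v) N * (value_spectrum N f x q * value_spectrum N g y q)))"
    by (intro sum.cong refl sum.swap)
  also have "\<dots> = (\<Sum>x<s ^ k. \<Sum>y<s ^ k. of_bool (vec_sum \<sigma> \<rho> k x y z) *
      (of_nat N * (\<Sum>u<N. \<Sum>u'<N. of_bool (f x = of_nat u \<and> g y = of_nat u' \<and> N dvd u + u' + v))))"
    by (simp only: sum_distrib_left[symmetric] vals)
  also have "\<dots> = of_nat N * (\<Sum>x<s ^ k. \<Sum>y<s ^ k. \<Sum>u<N. \<Sum>u'<N.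
      of_bool (vec_sum \<sigma> \<rho> k x y z \<and> f x = of_nat u \<and> g y = of_nat u' \<and> N dvd u + u' + v))"
    unfolding sum_distrib_left by (intro sum.cong refl) (simp add: of_bool_conj)
  finally show ?thesis
    by (simp only: of_nat_mult of_nat_sum of_nat_of_bool mult.assoc)
qed

text \<open>Index \<open>(N - w) mod N\<close> stands for \<open>-w\<close>. A cyclic convolution
  suffices because two values of at most \<open>n\<close> sum to at most \<open>2 * n < N\<close>,
  so divisibility by \<open>N\<close> forces \<open>u + u' = w\<close>.\<close>

lemma counting_zero_iff:
  assumes s: "s = card (labels \<sigma> \<rho>)" and N: "2 * n < N" and w: "w \<le> 2 * n"
    and A: "Al \<in> tables \<sigma> \<rho> n k" "Ar \<in> tables \<sigma> \<rho> n k"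
    and f: "\<And>x. x < s ^ k \<Longrightarrow> f x = entry_code (Al (vec_of \<sigma> \<rho> k x))"
    and g: "\<And>x. x < s ^ k \<Longrightarrow> g x = entry_code (Ar (vec_of \<sigma> \<rho> k x))"
  shows "(\<Sum>j<k + 1. \<Sum>q<N. unit_root (q * ((N - w) mod N)) N * inverse_spectrum \<sigma> \<rho> k N f g j z q) = 0 \<longleftrightarrow>
    w \<notin> achieved \<sigma> \<rho> k Al Ar z"
proof -
  have code: "entry_code e = of_nat u \<longleftrightarrow> e = Some u" for e u
  proof (cases e)
    case None
    have "- 1 \<noteq> (of_nat u :: complex)"
      by (metis of_nat_neq_0 add.commute add_eq_0_iff of_nat_Suc)
    then show ?thesis using None by simp
  qed simp
  have bound: "Al (vec_of \<sigma> \<rho> k x) = Some u \<Longrightarrow> u \<le> n" "Ar (vec_of \<sigma> \<rho> k x) = Some u \<Longrightarrow> u \<le> n"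
    if "x < s ^ k" for x u
    using A that by (auto simp: tables_def label_vecs_eq s)
  \<comment> \<open>For \<open>w = 0\<close> the outer \<open>mod\<close> matters: it turns the
    index \<open>N\<close>, which is out of range, into 0.\<close>
  have dvd: "N dvd u + u' + (N - w) mod N \<longleftrightarrow> u + u' = w" if "u \<le> n" "u' \<le> n" for u u'
  proof (cases "w = 0")
    case True
    then show ?thesis using that N by (auto dest: dvd_imp_le)
  next
    case False
    then have mod: "(N - w) mod N = N - w" using N w by simp
    show ?thesis
    proof
      assume "N dvd u + u' + (N - w) mod N"
      then obtain e where e: "u + u' + (N - w) = N * e" unfolding mod ..
      have "0 < N * e" "N * e < N * 2" using e that N w False by linarith+
      then have "e = 1" by auto
      then show "u + u' = w" using e w N by simp
    qed (use w N mod in simp)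
  qed
  have "(\<Sum>j<k + 1. \<Sum>q<N. unit_root (q * ((N - w) mod N)) N * inverse_spectrum \<sigma> \<rho> k N f g j z q) = 0 \<longleftrightarrow>
    \<not> (\<exists>x<s ^ k. \<exists>y<s ^ k. \<exists>u<N. \<exists>u'<N. vec_sum \<sigma> \<rho> k x y z \<and> f x = of_nat u \<and> g y = of_nat u' \<and>
      N dvd u + u' + (N - w) mod N)"
    using N by (subst counting_identity[OF s]) (auto simp del: of_nat_mult)
  also have "(\<exists>x<s ^ k. \<exists>y<s ^ k. \<exists>u<N. \<exists>u'<N. vec_sum \<sigma> \<rho> k x y z \<and> f x = of_nat u \<and> g y = of_nat u' \<and>
      N dvd u + u' + (N - w) mod N) \<longleftrightarrow> w \<in> achieved \<sigma> \<rho> k Al Ar z"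
  proof
    assume "\<exists>x<s ^ k. \<exists>y<s ^ k. \<exists>u<N. \<exists>u'<N. vec_sum \<sigma> \<rho> k x y z \<and> f x = of_nat u \<and> g y = of_nat u' \<and>
      N dvd u + u' + (N - w) mod N"
    then obtain x y u u' where *: "x < s ^ k" "y < s ^ k" "vec_sum \<sigma> \<rho> k x y z"
      "Al (vec_of \<sigma> \<rho> k x) = Some u" "Ar (vec_of \<sigma> \<rho> k y) = Some u'" "N dvd u + u' + (N - w) mod N"
      using f g code by auto
    then have "u + u' = w" using dvd bound by blast
    then show "w \<in> achieved \<sigma> \<rho> k Al Ar z" using * unfolding achieved_def s by blast
  next
    assume "w \<in> achieved \<sigma> \<rho> k Al Ar z"
    then obtain x y u u' where *: "x < s ^ k" "y < s ^ k" "vec_sum \<sigma> \<rho> k x y z"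
      "Al (vec_of \<sigma> \<rho> k x) = Some u" "Ar (vec_of \<sigma> \<rho> k y) = Some u'" "w = u + u'"
      unfolding achieved_def s by blast
    moreover have "u \<le> n" "u' \<le> n" using * bound by blast+
    moreover from this have "u < N" "u' < N" using N by linarith+
    ultimately show "\<exists>x<s ^ k. \<exists>y<s ^ k. \<exists>u<N. \<exists>u'<N. vec_sum \<sigma> \<rho> k x y z \<and> f x = of_nat u \<and> g y = of_nat u' \<and>
      N dvd u + u' + (N - w) mod N"
      using f g code dvd by (intro exI[of _ x] exI[of _ y] exI[of _ u] exI[of _ u'] conjI) simp_all
  qed
  finally show ?thesis .
qed

lemma achieved_le:
  assumes "Al \<in> tables \<sigma> \<rho> n k" "Ar \<in> tables \<sigma> \<rho> n k" "w \<in> achieved \<sigma> \<rho> k Al Ar z"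
  shows "w \<le> 2 * n"
proof -
  obtain x y a b where *: "x < card (labels \<sigma> \<rho>) ^ k" "y < card (labels \<sigma> \<rho>) ^ k"
    "Al (vec_of \<sigma> \<rho> k x) = Some a" "Ar (vec_of \<sigma> \<rho> k y) = Some b" "w = a + b"
    using assms(3) unfolding achieved_def by blast
  then have "a \<le> n" "b \<le> n" using assms(1,2) by (auto simp: tables_def label_vecs_eq)
  then show ?thesis using * by simp
qed

section \<open>The join program\<close>

text \<open>The index variables that stay constant after the setup. None of them is in
  \<open>loop_vars\<close>, so all later commands preserve them.\<close>

definition env :: "nat set \<Rightarrow> nat set \<Rightarrow> nat \<Rightarrow> nat \<Rightarrow> nat \<Rightarrow> (name \<Rightarrow> nat) \<Rightarrow> bool" where
  "env \<sigma> \<rho> n k m i \<longleftrightarrow>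
     i ''n'' = n \<and> i ''k'' = k \<and> i ''m'' = m \<and> i ''N'' = 2 ^ m \<and>
     i ''s'' = card (labels \<sigma> \<rho>) \<and> i ''S'' = card (labels \<sigma> \<rho>) ^ k \<and>
     i ''M'' = (k + 1) * card (labels \<sigma> \<rho>) ^ k * 2 ^ m \<and>
     i ''ss'' = ell \<sigma> + 1 \<and> i ''qs'' = ell \<sigma> + of_bool (finite \<sigma>) \<and> i ''qr'' = ell \<rho> + of_bool (finite \<rho>)"

lemma env_same: "env \<sigma> \<rho> n k m i \<Longrightarrow> same loop_vars i i' \<Longrightarrow> env \<sigma> \<rho> n k m i'"
  by (simp add: env_def same_def)

section \<open>Matrix entries as branch-free expressions\<close>

text \<open>Data expressions have no conditional, so cases become factors 0 and 1. Truncated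
  subtraction makes \<open>e + 1 - f\<close> zero exactly when \<open>e < f\<close>.\<close>

definition less_exp :: "iexp \<Rightarrow> iexp \<Rightarrow> dexp" where
  "less_exp e f = Is_zero (Num (ISub (IAdd e (IConst 1)) f))"

lemma dval_less_exp [simp]: "dval (less_exp e f) r = of_bool (ival e r < ival f r)"
  by (auto simp: less_exp_def Suc_le_eq)

text \<open>With \<open>ss = ell \<sigma> + 1\<close>, truncation makes \<open>ss - e\<close>
  positive exactly for the numbers of the labels of \<open>\<sigma>\<close>, so the flag is 1
  exactly on the other side.\<close>

definition rho_flag :: "iexp \<Rightarrow> iexp" where
  "rho_flag e = ISub (IConst 1) (ISub (IVar ''ss'') e)"

definition side_num :: "iexp \<Rightarrow> iexp" where
  "side_num e = ISub e (IMul (IVar ''ss'') (rho_flag e))"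

definition side_order :: "iexp \<Rightarrow> iexp" where
  "side_order e = IAdd (IMul (IVar ''qs'') (ISub (IConst 1) (rho_flag e))) (IMul (IVar ''qr'') (rho_flag e))"

definition same_side :: "iexp \<Rightarrow> iexp \<Rightarrow> dexp" where
  "same_side e f = Is_zero (Num (IAdd (ISub (rho_flag e) (rho_flag f)) (ISub (rho_flag f) (rho_flag e))))"

definition node_num :: "iexp \<Rightarrow> iexp \<Rightarrow> iexp" where
  "node_num j p = IAdd (IAdd (IMul (IConst 2) j) (IConst 1)) (IMul (IMul (IConst 2) (IAdd (IVar ''k'') (IConst 1))) p)"

definition node_den :: "iexp \<Rightarrow> iexp" where
  "node_den q = IMul (IMul (IConst 2) (IAdd (IVar ''k'') (IConst 1))) q"

text \<open>A power of a root of unity is again a root of unity, so the exponent goes into the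
  numerator and costs one multiplication.\<close>

definition node_power_exp :: "iexp \<Rightarrow> iexp \<Rightarrow> iexp \<Rightarrow> iexp \<Rightarrow> dexp" where
  "node_power_exp j q p c = Root (IMul c (node_num j p)) (node_den q)"

definition eval_exp :: "iexp \<Rightarrow> iexp \<Rightarrow> iexp \<Rightarrow> dexp" where
  "eval_exp j p a = (let q = side_order p; p' = side_num p; a' = side_num a in
     Mul (same_side p a)
       (Add (Sub (Num (IConst 1)) (less_exp p' q))
         (Mul (Mul (less_exp p' q) (less_exp a' q)) (node_power_exp j q p' a'))))"

definition eps_exp :: "iexp \<Rightarrow> dexp" where
  "eps_exp j = Root (IAdd (IMul (IConst 2) j) (IConst 1)) (IMul (IConst 2) (IAdd (IVar ''k'') (IConst 1)))"

text \<open>All cases are evaluated, also those whose factor is 0. For \<open>\<tau> = UNIV\<close>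
  the order \<open>q\<close> is 0 and a discarded case divides by zero; this is harmless since
  division is total with value 0 there.\<close>

definition interp_exp :: "iexp \<Rightarrow> iexp \<Rightarrow> iexp \<Rightarrow> dexp" where
  "interp_exp j c p = (let q = side_order p; p' = side_num p; c' = side_num c; one = Num (IConst 1) in
     Mul (same_side c p)
       (Add (Mul (less_exp p' q)
           (Add (Mul (less_exp c' q) (Div one (Mul (Num q) (node_power_exp j q p' c'))))
             (Mul (Sub one (less_exp c' q))
               (Div (Sub (Div one (eps_exp j)) one)
                 (Mul (Num q) (Sub one (Div one (node_power_exp j q p' (IConst 1)))))))))
         (Mul (Sub one (less_exp p' q)) (Sub one (less_exp c' q)))))"

lemma dval_node_power_exp:
  assumes "idx r ''k'' = k"
  shows "dval (node_power_exp j q p c) r = node k (ival j r) (ival q r) (ival p r) ^ ival c r"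
  using assms
  by (simp add: node_power_exp_def node_num_def node_den_def node_def unit_root_power)
     (simp add: unit_root_def)

lemma dval_eval_exp:
  assumes "env \<sigma> \<rho> n k m (idx r)"
  shows "dval (eval_exp j p a) r = eval_matrix \<sigma> \<rho> k (ival j r) (ival p r) (ival a r)"
proof -
  have ev: "idx r ''k'' = k" "idx r ''ss'' = ell \<sigma> + 1" "idx r ''qs'' = ell \<sigma> + of_bool (finite \<sigma>)"
    "idx r ''qr'' = ell \<rho> + of_bool (finite \<rho>)"
    using assms by (simp_all add: env_def)
  note defs = eval_exp_def Let_def same_side_def side_num_def side_order_def rho_flag_def blocks_def eval_entry_def
  consider "ival p r \<le> ell \<sigma>" "ival a r \<le> ell \<sigma>" | "ival p r \<le> ell \<sigma>" "ell \<sigma> < ival a r"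
    | "ell \<sigma> < ival p r" "ival a r \<le> ell \<sigma>" | "ell \<sigma> < ival p r" "ell \<sigma> < ival a r"
    by linarith
  then show ?thesis
    by cases (simp_all add: defs ev dval_node_power_exp[OF ev(1)])
qed

lemma dval_interp_exp:
  assumes "env \<sigma> \<rho> n k m (idx r)"
  shows "dval (interp_exp j c p) r = interp_matrix \<sigma> \<rho> k (ival j r) (ival c r) (ival p r)"
proof -
  have ev: "idx r ''k'' = k" "idx r ''ss'' = ell \<sigma> + 1" "idx r ''qs'' = ell \<sigma> + of_bool (finite \<sigma>)"
    "idx r ''qr'' = ell \<rho> + of_bool (finite \<rho>)"
    using assms by (simp_all add: env_def)
  have eps: "dval (eps_exp j) r = eps k (ival j r)"
    by (simp add: eps_exp_def eps_def unit_root_def ev)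
  note defs = interp_exp_def Let_def same_side_def side_num_def side_order_def rho_flag_def blocks_def interp_entry_def
  consider "ival p r \<le> ell \<sigma>" "ival c r \<le> ell \<sigma>" | "ival p r \<le> ell \<sigma>" "ell \<sigma> < ival c r"
    | "ell \<sigma> < ival p r" "ival c r \<le> ell \<sigma>" | "ell \<sigma> < ival p r" "ell \<sigma> < ival c r"
    by linarith
  then show ?thesis
    by cases (simp_all add: defs ev dval_node_power_exp[OF ev(1)] eps)
qed

section \<open>The two transforms on the full array\<close>

definition fourier_exp :: dexp where
  "fourier_exp = (let x = axis_coord (IConst 1) (IVar ''N''); w' = IMul (IVar ''w'') (IConst 2) in
     Root (IMul (IVar ''p'') (IMod x w')) w')"

definition value_transform :: "name \<Rightarrow> dexp \<Rightarrow> com" where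
  "value_transform X init = transform X (IVar ''m'') (IConst 2) (IConst 1) (IVar ''N'') init fourier_exp"

text \<open>There is one stage of radix \<open>s\<close> for each vector coordinate, hence
  \<open>k * s\<close> terms per cell instead of \<open>s ^ k\<close>. The arguments of
  \<open>coef\<close> are the layer \<open>j\<close>, the point digit produced by this stage and the
  label digit being summed.\<close>

definition label_transform :: "name \<Rightarrow> dexp \<Rightarrow> (iexp \<Rightarrow> iexp \<Rightarrow> iexp \<Rightarrow> dexp) \<Rightarrow> com" where
  "label_transform X init coef = transform X (IVar ''k'') (IVar ''s'') (IVar ''N'') (IVar ''S'') init
     (coef (IDiv (IVar ''i'') (IMul (IVar ''S'') (IVar ''N'')))
       (IDiv (IMod (axis_coord (IVar ''N'') (IVar ''S'')) (IMul (IVar ''w'') (IVar ''s''))) (IVar ''w''))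
       (IVar ''p''))"

definition address :: "nat set \<Rightarrow> nat set \<Rightarrow> nat \<Rightarrow> nat \<Rightarrow> nat \<Rightarrow> nat \<Rightarrow> nat \<Rightarrow> nat" where
  "address \<sigma> \<rho> k m j c v = (j * card (labels \<sigma> \<rho>) ^ k + c) * 2 ^ m + v"

definition level ::
  "nat set \<Rightarrow> nat set \<Rightarrow> nat \<Rightarrow> nat \<Rightarrow> nat \<Rightarrow> (nat \<Rightarrow> complex) \<Rightarrow> (nat \<Rightarrow> nat \<Rightarrow> nat \<Rightarrow> complex) \<Rightarrow> bool" where
  "level \<sigma> \<rho> k m t x \<phi> \<longleftrightarrow> (\<forall>j<k + 1. \<forall>c<card (labels \<sigma> \<rho>) ^ k. \<forall>v<2 ^ m.
     x (t * ((k + 1) * card (labels \<sigma> \<rho>) ^ k * 2 ^ m) + address \<sigma> \<rho> k m j c v) = \<phi> j c v)"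

text \<open>Cells of one level, times the number of levels of a value transform plus levels times
  radix of a label transform. Every phase after the setup is bounded by a constant multiple of
  this.\<close>

definition work :: "nat set \<Rightarrow> nat set \<Rightarrow> nat \<Rightarrow> nat \<Rightarrow> nat" where
  "work \<sigma> \<rho> k m = (k + 1) * card (labels \<sigma> \<rho>) ^ k * 2 ^ m * ((m + 1) + (k + 1) * card (labels \<sigma> \<rho>))"

lemma runs_value_transform:
  assumes env: "env \<sigma> \<rho> n k m (idx s)"
    and init: "\<And>r j c u. j < k + 1 \<Longrightarrow> c < card (labels \<sigma> \<rho>) ^ k \<Longrightarrow> u < 2 ^ m \<Longrightarrow> env \<sigma> \<rho> n k m (idx r) \<Longrightarrow>
      idx r ''i'' = address \<sigma> \<rho> k m j c u \<Longrightarrow> same {X} (arr s) (arr r) \<Longrightarrow> dval init r = f j c u"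
  shows "runs (value_transform X init) s
    (\<lambda>i a. env \<sigma> \<rho> n k m i \<and> same {X} (arr s) a \<and>
      level \<sigma> \<rho> k m m (a X) (\<lambda>j c v. \<Sum>u<2 ^ m. unit_root (u * v) (2 ^ m) * f j c u))
    ((53 + dops init + dops fourier_exp) * 2 * work \<sigma> \<rho> k m)"
proof -
  define S where "S = card (labels \<sigma> \<rho>) ^ k"
  have S: "0 < S" by (simp add: S_def card_labels)
  let ?M = "(k + 1) * S * 2 ^ m"
  have "runs (value_transform X init) s
    (\<lambda>i a. same loop_vars (idx s) i \<and> same {X} (arr s) a \<and>
       (\<forall>h<(k + 1) * S. \<forall>x<2 ^ m. \<forall>l<1. a X (m * ?M + ((h * 2 ^ m + x) * 1 + l)) =
          (\<Sum>y<2 ^ m. unit_root (y * x) (2 ^ m) * f (h div S) (h mod S) y)))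
    ((53 + dops init + dops fourier_exp) * ((m + 1) * (?M * 2)))"
    unfolding value_transform_def
  \<comment> \<open>The value axis is innermost, so layer and vector together form the outer index
    \<open>h = j * S + c\<close>, taken apart again by \<open>div\<close> and
    \<open>mod\<close>.\<close>
  proof (rule runs_transform[where f = "\<lambda>h l. f (h div S) (h mod S)" and
        H = "\<lambda>h t q a. unit_root (a * q) (2 ^ t)" and \<kappa> = "\<lambda>h t q p. unit_root (p * q) (2 ^ Suc t)"])
    show "idx s ''M'' = ?M" using env by (simp add: env_def S_def)
    show "?M = (k + 1) * S * 2 ^ m * 1" "0 < ?M" using S by simp_all
    show "transform_kernel 2 (\<lambda>t q p. unit_root (p * q) (2 ^ Suc t)) (\<lambda>t q a. unit_root (a * q) (2 ^ t))" for h
      by (rule transform_kernel_fourier) simp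
    fix r :: state assume sm: "same loop_vars (idx s) (idx r)"
    then have er: "env \<sigma> \<rho> n k m (idx r)" using env env_same by blast
    show "ival (IVar ''m'') r = m \<and> ival (IConst 2) r = 2 \<and> ival (IConst 1) r = 1 \<and> ival (IVar ''N'') r = 2 ^ m"
      using er by (simp add: env_def)
    fix h x l assume h: "h < (k + 1) * S" "x < 2 ^ m" "l < (1 :: nat)" "idx r ''i'' = (h * 2 ^ m + x) * 1 + l"
    {
      assume "same {X} (arr s) (arr r)"
      moreover have "h div S < k + 1" using h by (simp add: less_mult_imp_div_less)
      moreover have "h mod S < S" using S by simp
      ultimately show "dval init r = f (h div S) (h mod S) x"
        using h er by (intro init) (auto simp: address_def S_def[symmetric])
    next
      fix t p assume "idx r ''w'' = 2 ^ t" "idx r ''p'' = p"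
      then show "dval fourier_exp r = unit_root (p * (x mod 2 ^ Suc t)) (2 ^ Suc t)"
        using h er by (simp add: fourier_exp_def axis_coord_def Let_def env_def unit_root_def mult.commute)
    }
  qed auto
  then show ?thesis
  proof (rule runs_weaken)
    fix i a
    assume *: "same loop_vars (idx s) i \<and> same {X} (arr s) a \<and>
       (\<forall>h<(k + 1) * S. \<forall>x<2 ^ m. \<forall>l<1. a X (m * ?M + ((h * 2 ^ m + x) * 1 + l)) =
          (\<Sum>y<2 ^ m. unit_root (y * x) (2 ^ m) * f (h div S) (h mod S) y))"
    have "a X (m * ?M + ((j * S + c) * 2 ^ m + v)) = (\<Sum>u<2 ^ m. unit_root (u * v) (2 ^ m) * f j c u)"
      if "j < k + 1" "c < S" "v < 2 ^ m" for j c v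
    proof -
      have "j * S + c < (k + 1) * S" using address_less[of j "k + 1" c S 0 1] that by simp
      then show ?thesis using * that by simp
    qed
    then have "level \<sigma> \<rho> k m m (a X) (\<lambda>j c v. \<Sum>u<2 ^ m. unit_root (u * v) (2 ^ m) * f j c u)"
      unfolding level_def address_def S_def[symmetric] by (intro allI impI)
    moreover have "env \<sigma> \<rho> n k m i" using * env_same[OF env] by simp
    ultimately show "env \<sigma> \<rho> n k m i \<and> same {X} (arr s) a \<and>
      level \<sigma> \<rho> k m m (a X) (\<lambda>j c v. \<Sum>u<2 ^ m. unit_root (u * v) (2 ^ m) * f j c u)"
      using * by (intro conjI) simp_all
  next
    have "(m + 1) * (?M * 2) \<le> 2 * work \<sigma> \<rho> k m"
      by (simp add: work_def S_def algebra_simps)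
    then show "(53 + dops init + dops fourier_exp) * ((m + 1) * (?M * 2)) \<le>
        (53 + dops init + dops fourier_exp) * 2 * work \<sigma> \<rho> k m"
      by (simp only: mult.assoc mult_le_mono2)
  qed
qed

lemma runs_label_transform:
  assumes env: "env \<sigma> \<rho> n k m (idx s)"
    and init: "\<And>r j c u. j < k + 1 \<Longrightarrow> c < card (labels \<sigma> \<rho>) ^ k \<Longrightarrow> u < 2 ^ m \<Longrightarrow> env \<sigma> \<rho> n k m (idx r) \<Longrightarrow>
      idx r ''i'' = address \<sigma> \<rho> k m j c u \<Longrightarrow> same {X} (arr s) (arr r) \<Longrightarrow> dval init r = f j c u"
    and coef: "\<And>r j p a. env \<sigma> \<rho> n k m (idx r) \<Longrightarrow> dval (coef j p a) r = T (ival j r) (ival p r) (ival a r)"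
  shows "runs (label_transform X init coef) s
    (\<lambda>i a. env \<sigma> \<rho> n k m i \<and> same {X} (arr s) a \<and>
      level \<sigma> \<rho> k m k (a X) (\<lambda>j c v. \<Sum>y<card (labels \<sigma> \<rho>) ^ k.
        tensor_kernel (card (labels \<sigma> \<rho>)) (T j) k c y * f j y v))
    ((53 + dops init + dops (coef (IDiv (IVar ''i'') (IMul (IVar ''S'') (IVar ''N'')))
       (IDiv (IMod (axis_coord (IVar ''N'') (IVar ''S'')) (IMul (IVar ''w'') (IVar ''s''))) (IVar ''w''))
       (IVar ''p''))) * work \<sigma> \<rho> k m)"
    (is "runs _ _ _ ((53 + dops init + dops ?coef) * _)")
proof -
  define b where "b = card (labels \<sigma> \<rho>)"
  have b: "0 < b" by (simp add: b_def card_labels)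
  let ?M = "(k + 1) * b ^ k * 2 ^ m"
  have "runs (label_transform X init coef) s
    (\<lambda>i a. same loop_vars (idx s) i \<and> same {X} (arr s) a \<and>
       (\<forall>h<k + 1. \<forall>x<b ^ k. \<forall>l<2 ^ m. a X (k * ?M + ((h * b ^ k + x) * 2 ^ m + l)) =
          (\<Sum>y<b ^ k. tensor_kernel b (T h) k x y * f h y l)))
    ((53 + dops init + dops ?coef) * ((k + 1) * (?M * b)))"
    unfolding label_transform_def
  proof (rule runs_transform[where f = "\<lambda>h l x. f h x l" and
        H = "\<lambda>h. tensor_kernel b (T h)" and \<kappa> = "\<lambda>h t q p. T h (q div b ^ t) p"])
    show "idx s ''M'' = ?M" using env by (simp add: env_def b_def)
    show "?M = (k + 1) * b ^ k * 2 ^ m" "0 < ?M" using b by simp_all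
    show "transform_kernel b (\<lambda>t q p. T h (q div b ^ t) p) (tensor_kernel b (T h))" for h
      by (rule transform_kernel_tensor)
    fix r :: state assume sm: "same loop_vars (idx s) (idx r)"
    then have er: "env \<sigma> \<rho> n k m (idx r)" using env env_same by blast
    then have ev: "idx r ''S'' = b ^ k" "idx r ''N'' = 2 ^ m" "idx r ''s'' = b" "idx r ''k'' = k"
      by (simp_all add: env_def b_def)
    then show "ival (IVar ''k'') r = k \<and> ival (IVar ''s'') r = b \<and> ival (IVar ''N'') r = 2 ^ m \<and>
        ival (IVar ''S'') r = b ^ k"
      by simp
    fix h x l assume h: "h < k + 1" "x < b ^ k" "l < (2 :: nat) ^ m" "idx r ''i'' = (h * b ^ k + x) * 2 ^ m + l"
    {
      assume "same {X} (arr s) (arr r)"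
      then show "dval init r = f h x l"
        using h er by (intro init) (auto simp: address_def b_def[symmetric])
    next
      fix t p assume w: "idx r ''w'' = b ^ t" "idx r ''p'' = p"
      show "dval ?coef r = T h (x mod b ^ Suc t div b ^ t) p"
        by (simp only: coef[OF er] ival.simps axis_coord_def ev w h(4) address_decode[OF h(2,3)] power_Suc2)
    }
  qed (use b in auto)
  then show ?thesis
  proof (rule runs_weaken)
    fix i a
    assume *: "same loop_vars (idx s) i \<and> same {X} (arr s) a \<and>
       (\<forall>h<k + 1. \<forall>x<b ^ k. \<forall>l<2 ^ m. a X (k * ?M + ((h * b ^ k + x) * 2 ^ m + l)) =
          (\<Sum>y<b ^ k. tensor_kernel b (T h) k x y * f h y l))"
    then show "env \<sigma> \<rho> n k m i \<and> same {X} (arr s) a \<and>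
      level \<sigma> \<rho> k m k (a X) (\<lambda>j c v. \<Sum>y<card (labels \<sigma> \<rho>) ^ k.
        tensor_kernel (card (labels \<sigma> \<rho>)) (T j) k c y * f j y v)"
      using env_same[OF env] unfolding level_def address_def b_def[symmetric] by (intro conjI) simp_all
  next
    have "(k + 1) * (?M * b) \<le> work \<sigma> \<rho> k m"
      by (simp add: work_def b_def algebra_simps)
    then show "(53 + dops init + dops ?coef) * ((k + 1) * (?M * b)) \<le> (53 + dops init + dops ?coef) * work \<sigma> \<rho> k m"
      by (rule mult_le_mono2)
  qed
qed

section \<open>From tables to spectra and back to counts\<close>

text \<open>Reduction modulo \<open>S\<close> discards the layer \<open>j\<close>, so all
  \<open>k + 1\<close> layers start from the same data.\<close>

definition indicator_exp :: "name \<Rightarrow> dexp" where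
  "indicator_exp A = Is_zero (Sub (Get A (IMod (IDiv (IVar ''i'') (IVar ''N'')) (IVar ''S'')))
     (Num (IMod (IVar ''i'') (IVar ''N''))))"

definition last_level :: "name \<Rightarrow> name \<Rightarrow> dexp" where
  "last_level X t = Get X (IAdd (IMul (IVar t) (IVar ''M'')) (IVar ''i''))"

lemma dval_last_level:
  assumes "level \<sigma> \<rho> k m t x \<phi>" "j < k + 1" "c < card (labels \<sigma> \<rho>) ^ k" "u < 2 ^ m"
    and "env \<sigma> \<rho> n k m (idx r)" "idx r ''i'' = address \<sigma> \<rho> k m j c u" "arr r X = x" "idx r e = t"
  shows "dval (last_level X e) r = \<phi> j c u"
proof -
  have "idx r ''M'' = (k + 1) * card (labels \<sigma> \<rho>) ^ k * 2 ^ m"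
    using assms(5) by (simp only: env_def)
  then show ?thesis
    using assms(1-4) by (simp only: last_level_def level_def dval.simps ival.simps assms(6-8))
qed

definition spectrum_com :: "name \<Rightarrow> name \<Rightarrow> name \<Rightarrow> com" where
  "spectrum_com A X Y =
     Seq (value_transform X (indicator_exp A)) (label_transform Y (last_level X ''m'') eval_exp)"

abbreviation label_coef :: "(iexp \<Rightarrow> iexp \<Rightarrow> iexp \<Rightarrow> dexp) \<Rightarrow> dexp" where
  "label_coef coef \<equiv> coef (IDiv (IVar ''i'') (IMul (IVar ''S'') (IVar ''N'')))
     (IDiv (IMod (axis_coord (IVar ''N'') (IVar ''S'')) (IMul (IVar ''w'') (IVar ''s''))) (IVar ''w''))
     (IVar ''p'')"

lemma runs_spectrum_com:
  assumes env: "env \<sigma> \<rho> n k m (idx s)" and names: "X \<noteq> A" "X \<noteq> Y"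
  shows "runs (spectrum_com A X Y) s
    (\<lambda>i a. env \<sigma> \<rho> n k m i \<and> same {X, Y} (arr s) a \<and>
      level \<sigma> \<rho> k m k (a Y) (spectrum \<sigma> \<rho> k (2 ^ m) (arr s A)))
    (((53 + dops (indicator_exp A) + dops fourier_exp) * 2 +
      (53 + dops (last_level X ''m'') + dops (label_coef eval_exp))) * work \<sigma> \<rho> k m)"
proof -
  let ?Q = "\<lambda>i a. env \<sigma> \<rho> n k m i \<and> same {X} (arr s) a \<and>
    level \<sigma> \<rho> k m m (a X) (\<lambda>j c v. value_spectrum (2 ^ m) (arr s A) c v)"
  show ?thesis
    unfolding spectrum_com_def
  proof (rule runs_Seq[where Q = ?Q])
    show "runs (value_transform X (indicator_exp A)) s ?Q
        ((53 + dops (indicator_exp A) + dops fourier_exp) * 2 * work \<sigma> \<rho> k m)"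
      unfolding value_spectrum_def
    proof (rule runs_value_transform[OF env])
      fix r :: state and j c u
      assume *: "c < card (labels \<sigma> \<rho>) ^ k" "u < 2 ^ m" "env \<sigma> \<rho> n k m (idx r)"
        "idx r ''i'' = address \<sigma> \<rho> k m j c u" "same {X} (arr s) (arr r)"
      have "arr r A = arr s A" using *(5) names by (simp add: same_def)
      moreover have "idx r ''N'' = 2 ^ m" "idx r ''S'' = card (labels \<sigma> \<rho>) ^ k"
        using *(3) by (simp_all add: env_def)
      ultimately show "dval (indicator_exp A) r = of_bool (arr s A c = of_nat u)"
        using * by (simp add: indicator_exp_def address_def)
    qed
    fix r :: state assume Q: "?Q (idx r) (arr r)"
    then have lev: "level \<sigma> \<rho> k m m (arr r X) (\<lambda>j c v. value_spectrum (2 ^ m) (arr s A) c v)"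
      by blast
    have "runs (label_transform Y (last_level X ''m'') eval_exp) r
      (\<lambda>i a. env \<sigma> \<rho> n k m i \<and> same {Y} (arr r) a \<and>
        level \<sigma> \<rho> k m k (a Y) (\<lambda>j c v. \<Sum>y<card (labels \<sigma> \<rho>) ^ k.
          tensor_kernel (card (labels \<sigma> \<rho>)) (eval_matrix \<sigma> \<rho> k j) k c y * value_spectrum (2 ^ m) (arr s A) y v))
      ((53 + dops (last_level X ''m'') + dops (label_coef eval_exp)) * work \<sigma> \<rho> k m)"
    proof (rule runs_label_transform)
      show "env \<sigma> \<rho> n k m (idx r)" using Q by simp
      show "dval (eval_exp j p a) r = eval_matrix \<sigma> \<rho> k (ival j r) (ival p r) (ival a r)"
        if "env \<sigma> \<rho> n k m (idx r)" for r j p a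
        using that by (rule dval_eval_exp)
      fix r' :: state and j c u
      assume *: "j < k + 1" "c < card (labels \<sigma> \<rho>) ^ k" "u < 2 ^ m" "env \<sigma> \<rho> n k m (idx r')"
        "idx r' ''i'' = address \<sigma> \<rho> k m j c u" "same {Y} (arr r) (arr r')"
      have "arr r' X = arr r X" using *(6) names by (simp add: same_def)
      moreover have "idx r' ''m'' = m" using *(4) by (simp add: env_def)
      ultimately show "dval (last_level X ''m'') r' = value_spectrum (2 ^ m) (arr s A) c u"
        using dval_last_level[OF lev *(1-5)] by simp
    qed
    then show "runs (label_transform Y (last_level X ''m'') eval_exp) r
      (\<lambda>i a. env \<sigma> \<rho> n k m i \<and> same {X, Y} (arr s) a \<and>
        level \<sigma> \<rho> k m k (a Y) (spectrum \<sigma> \<rho> k (2 ^ m) (arr s A)))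
      ((53 + dops (last_level X ''m'') + dops (label_coef eval_exp)) * work \<sigma> \<rho> k m)"
    proof (rule runs_weaken)
      fix i a
      assume "env \<sigma> \<rho> n k m i \<and> same {Y} (arr r) a \<and>
        level \<sigma> \<rho> k m k (a Y) (\<lambda>j c v. \<Sum>y<card (labels \<sigma> \<rho>) ^ k.
          tensor_kernel (card (labels \<sigma> \<rho>)) (eval_matrix \<sigma> \<rho> k j) k c y * value_spectrum (2 ^ m) (arr s A) y v)"
      moreover from this have "same {X, Y} (arr s) a" using Q by (simp add: same_def)
      ultimately show "env \<sigma> \<rho> n k m i \<and> same {X, Y} (arr s) a \<and>
        level \<sigma> \<rho> k m k (a Y) (spectrum \<sigma> \<rho> k (2 ^ m) (arr s A))"
        by (simp add: level_def spectrum_def Let_def)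
    qed simp
  qed (simp add: algebra_simps)
qed

text \<open>The pointwise product needs no pass of its own: it is the initial expression of the
  label transform. The value transform is again the forward one, since the later reading at negated
  indices inverts it up to the factor \<open>N\<close>.\<close>

definition inverse_com :: com where
  "inverse_com =
     Seq (label_transform ''P'' (Mul (last_level ''L2'' ''k'') (last_level ''R2'' ''k'')) interp_exp)
       (Seq (value_transform ''Z'' (last_level ''P'' ''k''))
         (fill ''W'' (IConst 0) (IAdd (IVar ''k'') (IConst 1))
           (Get ''Z'' (IAdd (IMul (IVar ''m'') (IVar ''M''))
             (IAdd (IMul (IVar ''p'') (IMul (IVar ''S'') (IVar ''N''))) (IVar ''i''))))))"

definition inverse_cost :: nat where
  "inverse_cost =
     (53 + dops (Mul (last_level ''L2'' ''k'') (last_level ''R2'' ''k'')) + dops (label_coef interp_exp)) +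
     (53 + dops (last_level ''P'' ''k'') + dops fourier_exp) * 2 + 16"

lemma work_ge:
  "(k + 1) * card (labels \<sigma> \<rho>) ^ k * 2 ^ m * (k + 1) \<le> work \<sigma> \<rho> k m"
  "(k + 1) * card (labels \<sigma> \<rho>) ^ k * 2 ^ m \<le> work \<sigma> \<rho> k m"
  "card (labels \<sigma> \<rho>) ^ k * 2 ^ m \<le> work \<sigma> \<rho> k m"
  "k + 1 \<le> work \<sigma> \<rho> k m" "2 ^ m \<le> work \<sigma> \<rho> k m"
proof -
  let ?s = "card (labels \<sigma> \<rho>)"
  have s: "1 \<le> ?s" "1 \<le> ?s ^ k" "(1 :: nat) \<le> 2 ^ m" by (simp_all add: card_labels)
  have "(k + 1) * 1 \<le> (k + 1) * ?s" using s(1) by (rule mult_le_mono2)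
  then show 1: "(k + 1) * ?s ^ k * 2 ^ m * (k + 1) \<le> work \<sigma> \<rho> k m"
    unfolding work_def by (intro mult_le_mono2) simp
  have "(k + 1) * ?s ^ k * 2 ^ m * 1 \<le> (k + 1) * ?s ^ k * 2 ^ m * (k + 1)"
    by (intro mult_le_mono2) simp
  then show 2: "(k + 1) * ?s ^ k * 2 ^ m \<le> work \<sigma> \<rho> k m" using 1 by linarith
  have "1 * (?s ^ k * 2 ^ m) \<le> (k + 1) * (?s ^ k * 2 ^ m)" by (intro mult_le_mono1) simp
  then show 3: "?s ^ k * 2 ^ m \<le> work \<sigma> \<rho> k m" using 2 by (simp only: mult.assoc mult_1)
  have "(k + 1) * (1 * 1) \<le> (k + 1) * (?s ^ k * 2 ^ m)"
    by (intro mult_le_mono2 mult_le_mono s)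
  then show "k + 1 \<le> work \<sigma> \<rho> k m" using 2 by (simp only: mult.assoc mult_1_right)
  have "1 * 2 ^ m \<le> ?s ^ k * 2 ^ m" using s by (intro mult_le_mono1)
  then show "2 ^ m \<le> work \<sigma> \<rho> k m" using 3 by (simp only: mult_1)
qed

lemma runs_inverse_com:
  assumes env: "env \<sigma> \<rho> n k m (idx s)"
    and L: "level \<sigma> \<rho> k m k (arr s ''L2'') (spectrum \<sigma> \<rho> k (2 ^ m) f)"
    and R: "level \<sigma> \<rho> k m k (arr s ''R2'') (spectrum \<sigma> \<rho> k (2 ^ m) g)"
  shows "runs inverse_com s
    (\<lambda>i a. env \<sigma> \<rho> n k m i \<and> (\<forall>c<card (labels \<sigma> \<rho>) ^ k. \<forall>v<2 ^ m. a ''W'' (c * 2 ^ m + v) =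
      (\<Sum>j<k + 1. \<Sum>q<2 ^ m. unit_root (q * v) (2 ^ m) * inverse_spectrum \<sigma> \<rho> k (2 ^ m) f g j c q)))
    (inverse_cost * work \<sigma> \<rho> k m)"
proof -
  let ?S = "card (labels \<sigma> \<rho>) ^ k" and ?W = "work \<sigma> \<rho> k m"
  let ?M = "(k + 1) * ?S * 2 ^ m"
  let ?inv = "inverse_spectrum \<sigma> \<rho> k (2 ^ m) f g"
  let ?Z = "\<lambda>j c v. \<Sum>q<2 ^ m. unit_root (q * v) (2 ^ m) * ?inv j c q"
  let ?get = "Get ''Z'' (IAdd (IMul (IVar ''m'') (IVar ''M''))
    (IAdd (IMul (IVar ''p'') (IMul (IVar ''S'') (IVar ''N''))) (IVar ''i'')))"
  let ?init = "Mul (last_level ''L2'' ''k'') (last_level ''R2'' ''k'')"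
  have first: "runs (label_transform ''P'' ?init interp_exp) s
    (\<lambda>i a. env \<sigma> \<rho> n k m i \<and> same {''P''} (arr s) a \<and>
      level \<sigma> \<rho> k m k (a ''P'') (\<lambda>j c v. \<Sum>y<?S.
        tensor_kernel (card (labels \<sigma> \<rho>)) (interp_matrix \<sigma> \<rho> k j) k c y *
        (spectrum \<sigma> \<rho> k (2 ^ m) f j y v * spectrum \<sigma> \<rho> k (2 ^ m) g j y v)))
    ((53 + dops ?init + dops (label_coef interp_exp)) * ?W)"
  proof (rule runs_label_transform[OF env])
    show "dval (interp_exp j p a) r = interp_matrix \<sigma> \<rho> k (ival j r) (ival p r) (ival a r)"
      if "env \<sigma> \<rho> n k m (idx r)" for r j p a
      using that by (rule dval_interp_exp)
    fix r :: state and j c u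
    assume *: "j < k + 1" "c < ?S" "u < 2 ^ m" "env \<sigma> \<rho> n k m (idx r)"
      "idx r ''i'' = address \<sigma> \<rho> k m j c u" "same {''P''} (arr s) (arr r)"
    have "arr r ''L2'' = arr s ''L2''" "arr r ''R2'' = arr s ''R2''" using *(6) by (simp_all add: same_def)
    moreover have "idx r ''k'' = k" using *(4) by (simp add: env_def)
    ultimately show "dval ?init r = spectrum \<sigma> \<rho> k (2 ^ m) f j c u * spectrum \<sigma> \<rho> k (2 ^ m) g j c u"
      using dval_last_level[OF L *(1-5)] dval_last_level[OF R *(1-5)] by simp
  qed
  have second: "runs (value_transform ''Z'' (last_level ''P'' ''k'')) r
      (\<lambda>i a. env \<sigma> \<rho> n k m i \<and> same {''Z''} (arr r) a \<and> level \<sigma> \<rho> k m m (a ''Z'') ?Z)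
      ((53 + dops (last_level ''P'' ''k'') + dops fourier_exp) * 2 * ?W)"
    if "env \<sigma> \<rho> n k m (idx r)" and P: "level \<sigma> \<rho> k m k (arr r ''P'') ?inv" for r
  proof (rule runs_value_transform[OF that(1)])
    fix r' :: state and j c u
    assume *: "j < k + 1" "c < ?S" "u < 2 ^ m" "env \<sigma> \<rho> n k m (idx r')"
      "idx r' ''i'' = address \<sigma> \<rho> k m j c u" "same {''Z''} (arr r) (arr r')"
    have "arr r' ''P'' = arr r ''P''" using *(6) by (simp add: same_def)
    moreover have "idx r' ''k'' = k" using *(4) by (simp add: env_def)
    ultimately show "dval (last_level ''P'' ''k'') r' = ?inv j c u"
      using dval_last_level[OF P *(1-5)] by simp
  qed
  have third: "runs (fill ''W'' (IConst 0) (IAdd (IVar ''k'') (IConst 1)) ?get) r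
      (\<lambda>i a. env \<sigma> \<rho> n k m i \<and> (\<forall>c<?S. \<forall>v<2 ^ m. a ''W'' (c * 2 ^ m + v) = (\<Sum>j<k + 1. ?Z j c v)))
      (16 * ?W)"
    if er: "env \<sigma> \<rho> n k m (idx r)" and Z: "level \<sigma> \<rho> k m m (arr r ''Z'') ?Z" for r
  proof -
    let ?F = "\<lambda>i p. arr r ''Z'' (m * ?M + (p * (?S * 2 ^ m) + i))"
    have "runs (fill ''W'' (IConst 0) (IAdd (IVar ''k'') (IConst 1)) ?get) r
      (\<lambda>i a. same {''i'', ''p''} (idx r) i \<and> same {''W''} (arr r) a \<and> (\<forall>x<0. a ''W'' x = arr r ''W'' x) \<and>
        (\<forall>i<?M. a ''W'' (0 + i) = (\<Sum>p<k + 1. ?F i p)))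
      (1 + ?M * (4 + iops (IConst 0) + iops (IAdd (IVar ''k'') (IConst 1)) +
        (k + 1) * (5 + 2 * iops (IConst 0) + dops ?get)))"
    proof (rule runs_fill[where F = ?F])
      show "idx r ''M'' = ?M" using er by (simp add: env_def)
      fix r' :: state assume sm: "same {''i'', ''p''} (idx r) (idx r')"
      then have er': "env \<sigma> \<rho> n k m (idx r')" using env_same[OF er] by (simp add: same_def)
      show "ival (IConst 0) r' = 0" by simp
      show "ival (IAdd (IVar ''k'') (IConst 1)) r' = k + 1" using er' by (simp add: env_def)
      fix i p assume *: "idx r' ''i'' = i" "idx r' ''p'' = p" "same {''W''} (arr r) (arr r')"
      have "arr r' ''Z'' = arr r ''Z''" using *(3) by (simp add: same_def)
      moreover have "idx r' ''m'' = m" "idx r' ''M'' = ?M" "idx r' ''S'' = ?S" "idx r' ''N'' = 2 ^ m"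
        using er' by (simp_all only: env_def)
      ultimately show "dval ?get r' = ?F i p" by (simp only: dval.simps ival.simps *(1,2))
    qed
    then show ?thesis
    proof (rule runs_weaken)
      fix i a
      assume *: "same {''i'', ''p''} (idx r) i \<and> same {''W''} (arr r) a \<and> (\<forall>x<0. a ''W'' x = arr r ''W'' x) \<and>
        (\<forall>i<?M. a ''W'' (0 + i) = (\<Sum>p<k + 1. ?F i p))"
      have "a ''W'' (c * 2 ^ m + v) = (\<Sum>j<k + 1. ?Z j c v)" if "c < ?S" "v < 2 ^ m" for c v
      proof -
        have "c * 2 ^ m + v < ?M"
          using address_less[of 0 "k + 1" c ?S v "2 ^ m"] that by simp
        then have "a ''W'' (c * 2 ^ m + v) = (\<Sum>p<k + 1. ?F (c * 2 ^ m + v) p)" using * by simp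
        also have "\<dots> = (\<Sum>j<k + 1. ?Z j c v)"
        proof (intro sum.cong refl)
          fix j assume "j \<in> {..<k + 1}"
          moreover have "j * (?S * 2 ^ m) + (c * 2 ^ m + v) = address \<sigma> \<rho> k m j c v"
            by (simp add: address_def algebra_simps)
          ultimately show "?F (c * 2 ^ m + v) j = ?Z j c v"
            using Z that by (simp only: level_def lessThan_iff)
        qed
        finally show ?thesis .
      qed
      moreover have "env \<sigma> \<rho> n k m i" using * env_same[OF er] by (simp add: same_def)
      ultimately show "env \<sigma> \<rho> n k m i \<and> (\<forall>c<?S. \<forall>v<2 ^ m. a ''W'' (c * 2 ^ m + v) = (\<Sum>j<k + 1. ?Z j c v))"
        by blast
    next
      have "1 + ?M * (4 + iops (IConst 0) + iops (IAdd (IVar ''k'') (IConst 1)) +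
        (k + 1) * (5 + 2 * iops (IConst 0) + dops ?get)) = 1 + 5 * ?M + 10 * (?M * (k + 1))"
        by (simp add: algebra_simps)
      also have "\<dots> \<le> 16 * ?W"
        using work_ge[where k = k and m = m and \<sigma> = \<sigma> and \<rho> = \<rho>] by linarith
      finally show "1 + ?M * (4 + iops (IConst 0) + iops (IAdd (IVar ''k'') (IConst 1)) +
        (k + 1) * (5 + 2 * iops (IConst 0) + dops ?get)) \<le> 16 * ?W" .
    qed
  qed
  have Pinv: "level \<sigma> \<rho> k m k x ?inv" if "level \<sigma> \<rho> k m k x (\<lambda>j c v. \<Sum>y<?S.
        tensor_kernel (card (labels \<sigma> \<rho>)) (interp_matrix \<sigma> \<rho> k j) k c y *
        (spectrum \<sigma> \<rho> k (2 ^ m) f j y v * spectrum \<sigma> \<rho> k (2 ^ m) g j y v))" for x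
    using that by (simp add: level_def inverse_spectrum_def Let_def)
  show ?thesis
    unfolding inverse_com_def
    by (rule runs_Seq[OF first runs_Seq[OF second third order_refl]])
      (auto simp: inverse_cost_def algebra_simps intro: Pinv)
qed

section \<open>Extracting the optimum\<close>

definition candidate_exp :: "variant \<Rightarrow> iexp" where
  "candidate_exp v = (case v of Minimise \<Rightarrow> ISub (IAdd (IVar ''n'') (IVar ''n'')) (IVar ''p'') | Maximise \<Rightarrow> IVar ''p'')"

definition candidate :: "variant \<Rightarrow> nat \<Rightarrow> nat \<Rightarrow> nat" where
  "candidate v n p = (case v of Minimise \<Rightarrow> n + n - p | Maximise \<Rightarrow> p)"

text \<open>A branch on a count is impossible, so the indicator \<open>z\<close> of a zero count
  selects arithmetically between the old entry and the candidate.\<close>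

definition update_exp :: "variant \<Rightarrow> dexp" where
  "update_exp v = (let w = candidate_exp v;
      z = Is_zero (Get ''W'' (IAdd (IMul (IVar ''i'') (IVar ''N'')) (IMod (ISub (IVar ''N'') w) (IVar ''N'')))) in
     Add (Mul z (Get ''Ai'' (IVar ''i''))) (Mul (Sub (Num (IConst 1)) z) (Num w)))"

definition extract_com :: "variant \<Rightarrow> com" where
  "extract_com v = For ''i'' (IVar ''S'')
     (Seq (Set_array ''Ai'' (IVar ''i'') (Sub (Num (IConst 0)) (Num (IConst 1))))
       (For ''p'' (IAdd (IAdd (IVar ''n'') (IVar ''n'')) (IConst 1))
         (Set_array ''Ai'' (IVar ''i'') (update_exp v))))"

text \<open>The candidates are visited in such an order that the last one achieved is the optimum.\<close>

lemma opt_candidates_Suc: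
  assumes "u \<le> 2 * n"
  shows "opt v {w \<in> A. \<exists>p<Suc u. w = candidate v n p} =
    (if candidate v n u \<in> A then Some (candidate v n u) else opt v {w \<in> A. \<exists>p<u. w = candidate v n p})"
proof (cases "candidate v n u \<in> A")
  case True
  let ?B = "{w \<in> A. \<exists>p<Suc u. w = candidate v n p}"
  have "?B \<subseteq> candidate v n ` {..u}" by (auto simp: less_Suc_eq_le)
  then have fin: "finite ?B" using finite_subset by blast
  have mem: "candidate v n u \<in> ?B" using True by auto
  show ?thesis
  proof (cases v)
    case Minimise
    then have "Min ?B = candidate v n u"
      using assms by (intro Min_eqI fin mem) (auto simp: candidate_def)
    then show ?thesis using True mem Minimise by (auto simp: opt_def)
  next
    case Maximise
    then have "Max ?B = candidate v n u"
      using assms by (intro Max_eqI fin mem) (auto simp: candidate_def)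
    then show ?thesis using True mem Maximise by (auto simp: opt_def)
  qed
next
  case False
  then have "{w \<in> A. \<exists>p<Suc u. w = candidate v n p} = {w \<in> A. \<exists>p<u. w = candidate v n p}"
    by (auto simp: less_Suc_eq)
  then show ?thesis using False by simp
qed

lemma runs_extract_com:
  assumes env: "env \<sigma> \<rho> n k m (idx s)" and N: "2 * n < 2 ^ m"
    and W: "\<And>c w. c < card (labels \<sigma> \<rho>) ^ k \<Longrightarrow> w \<le> 2 * n \<Longrightarrow>
      arr s ''W'' (c * 2 ^ m + (2 ^ m - w) mod 2 ^ m) = 0 \<longleftrightarrow> w \<notin> A c"
    and A: "\<And>c w. w \<in> A c \<Longrightarrow> w \<le> 2 * n"
  shows "runs (extract_com v) s
    (\<lambda>i a. \<forall>c<card (labels \<sigma> \<rho>) ^ k. a ''Ai'' c = entry_code (opt v (A c)))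
    ((9 + dops (update_exp v)) * work \<sigma> \<rho> k m)"
proof -
  let ?S = "card (labels \<sigma> \<rho>) ^ k" and ?d = "dops (update_exp v)"
  let ?part = "\<lambda>u c. entry_code (opt v {w \<in> A c. \<exists>p<u. w = candidate v n p})"
  let ?fr = "\<lambda>i a. same loop_vars (idx s) i \<and> same {''Ai''} (arr s) a"
  let ?I = "\<lambda>j i a. ?fr i a \<and> (\<forall>c<j. a ''Ai'' c = entry_code (opt v (A c)))"
  let ?J = "\<lambda>j u i a. ?I j i a \<and> i ''i'' = j \<and> a ''Ai'' j = ?part u j"
  \<comment> \<open>Either order of visiting runs through all of \<open>0, ..., 2 * n\<close>, so
    the complete enumeration misses no achieved value.\<close>
  have all: "{w \<in> A c. \<exists>p<2 * n + 1. w = candidate v n p} = A c" for c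
  proof -
    have "\<exists>p<2 * n + 1. w = candidate v n p" if "w \<in> A c" for w
    proof (cases v)
      case Minimise
      then show ?thesis using A[OF that] by (intro exI[of _ "2 * n - w"]) (auto simp: candidate_def)
    next
      case Maximise
      then show ?thesis using A[OF that] by (intro exI[of _ w]) (auto simp: candidate_def)
    qed
    then show ?thesis by blast
  qed
  have inner: "runs (For ''p'' (IAdd (IAdd (IVar ''n'') (IVar ''n'')) (IConst 1))
        (Set_array ''Ai'' (IVar ''i'') (update_exp v))) r (?J j (2 * n + 1)) (3 + (2 * n + 1) * (2 + ?d))"
    if j: "j < ?S" and r: "?J j 0 (idx r) (arr r)" for j and r :: state
  proof (rule runs_For[where I = "?J j" and C = "1 + ?d"])
    have er: "env \<sigma> \<rho> n k m (idx r)" using env_same[OF env] r by blast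
    then show "ival (IAdd (IAdd (IVar ''n'') (IVar ''n'')) (IConst 1)) r = 2 * n + 1"
      by (simp add: env_def)
    show "?J j 0 (idx r) (arr r)" by (fact r)
    fix u i and r' :: state assume *: "u < 2 * n + 1" "idx r' = i(''p'' := u)" "?J j u i (arr r')"
    have sm: "same loop_vars (idx s) (idx r')" using * by (simp add: same_update)
    then have er: "env \<sigma> \<rho> n k m (idx r')" by (rule env_same[OF env])
    then have ev: "idx r' ''n'' = n" "idx r' ''N'' = 2 ^ m" by (simp_all add: env_def)
    have ip: "idx r' ''i'' = j" "idx r' ''p'' = u" using * by simp_all
    have cand: "ival (candidate_exp v) r' = candidate v n u"
      by (cases v) (simp_all add: candidate_exp_def candidate_def ev ip)
    have "candidate v n u \<le> 2 * n" using *(1) by (cases v) (simp_all add: candidate_def)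
    moreover have "arr r' ''W'' = arr s ''W''" using *(3) by (simp add: same_def)
    ultimately have Wz: "arr r' ''W'' (j * 2 ^ m + (2 ^ m - candidate v n u) mod 2 ^ m) = 0 \<longleftrightarrow> candidate v n u \<notin> A j"
      using W[OF j] by simp
    have "dval (update_exp v) r' = ?part (Suc u) j"
    proof -
      have Ai: "arr r' ''Ai'' j = ?part u j" using *(3) by blast
      show ?thesis
        unfolding update_exp_def Let_def using *(1) opt_candidates_Suc[of u n v "A j"]
        by (simp add: cand ev ip Wz Ai)
    qed
    then show "runs (Set_array ''Ai'' (IVar ''i'') (update_exp v)) r' (?J j (Suc u)) (1 + ?d)"
      using * sm ip by (intro runs_Set_array) (simp_all add: same_def)
  qed simp
  have "runs (extract_com v) s (?I ?S) (1 + ?S * (6 + (2 * n + 1) * (2 + ?d)))"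
    unfolding extract_com_def
  proof (rule runs_For[where I = ?I])
    show "ival (IVar ''S'') s = ?S" using env by (simp add: env_def)
    show "?I 0 (idx s) (arr s)" by simp
    fix j i and r :: state assume *: "j < ?S" "idx r = i(''i'' := j)" "?I j i (arr r)"
    show "runs (Seq (Set_array ''Ai'' (IVar ''i'') (Sub (Num (IConst 0)) (Num (IConst 1))))
       (For ''p'' (IAdd (IAdd (IVar ''n'') (IVar ''n'')) (IConst 1))
         (Set_array ''Ai'' (IVar ''i'') (update_exp v)))) r (?I (Suc j)) (5 + (2 * n + 1) * (2 + ?d))"
    proof (rule runs_Seq)
      have "?part 0 j = - 1" by (simp add: opt_def)
      moreover have "same loop_vars (idx s) (idx r)" using * by (simp add: same_update)
      ultimately show "runs (Set_array ''Ai'' (IVar ''i'') (Sub (Num (IConst 0)) (Num (IConst 1)))) r (?J j 0) 2"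
        using * by (intro runs_Set_array) (simp_all add: same_def)
      fix r' :: state assume "?J j 0 (idx r') (arr r')"
      from inner[OF *(1) this]
      show "runs (For ''p'' (IAdd (IAdd (IVar ''n'') (IVar ''n'')) (IConst 1))
          (Set_array ''Ai'' (IVar ''i'') (update_exp v))) r' (?I (Suc j)) (3 + (2 * n + 1) * (2 + ?d))"
        unfolding all by (rule runs_weaken) (simp_all add: less_Suc_eq)
    qed simp
  qed simp
  then show ?thesis
  proof (rule runs_weaken)
    have "?S * (2 * n + 1) \<le> ?S * 2 ^ m" using N by (intro mult_le_mono2) simp
    then have "?S * (2 * n + 1) \<le> work \<sigma> \<rho> k m" using work_ge(3) order_trans by blast
    then have "(2 + ?d) * (?S * (2 * n + 1)) \<le> (2 + ?d) * work \<sigma> \<rho> k m" by (rule mult_le_mono2)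
    moreover have "?S \<le> ?S * 2 ^ m" by simp
    then have "?S \<le> work \<sigma> \<rho> k m" using work_ge(3) order_trans by blast
    moreover have "1 \<le> work \<sigma> \<rho> k m" using work_ge(4)[of k \<sigma> \<rho> m] by simp
    moreover have "1 + ?S * (6 + (2 * n + 1) * (2 + ?d)) = 1 + 6 * ?S + (2 + ?d) * (?S * (2 * n + 1))"
      by (simp add: algebra_simps)
    moreover have "(9 + ?d) * work \<sigma> \<rho> k m = 7 * work \<sigma> \<rho> k m + (2 + ?d) * work \<sigma> \<rho> k m"
      by (simp add: algebra_simps)
    ultimately show "1 + ?S * (6 + (2 * n + 1) * (2 + ?d)) \<le> (9 + ?d) * work \<sigma> \<rho> k m" by linarith
  qed simp
qed

section \<open>Computing the sizes\<close>

text \<open>There is no unbounded loop, so the search for the power of two runs a fixed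
  \<open>2 * n + 1\<close> rounds and doubles only while \<open>N \<le> 2 * n\<close>. This linear
  cost is within the budget, and doubling from at most \<open>2 * n\<close> gives
  \<open>N \<le> 4 * n\<close>.\<close>

definition setup_com :: com where
  "setup_com =
     Seq (Seq (Set_index ''ss'' (IAdd (IVar ''ell_sigma'') (IConst 1)))
       (Seq (Set_index ''s'' (IAdd (IVar ''ss'') (IAdd (IVar ''ell_rho'') (IConst 1))))
       (Seq (Set_index ''qs'' (IAdd (IVar ''ell_sigma'') (IVar ''fin_sigma'')))
       (Seq (Set_index ''qr'' (IAdd (IVar ''ell_rho'') (IVar ''fin_rho'')))
       (Seq (Set_index ''S'' (IConst 1)) (Seq (Set_index ''N'' (IConst 1)) (Set_index ''m'' (IConst 0))))))))
     (Seq (For ''t'' (IVar ''k'') (Set_index ''S'' (IMul (IVar ''S'') (IVar ''s''))))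
     (Seq (For ''t'' (IAdd (IAdd (IVar ''n'') (IVar ''n'')) (IConst 1))
        (If_less (IVar ''N'') (IAdd (IAdd (IVar ''n'') (IVar ''n'')) (IConst 1))
          (Seq (Set_index ''N'' (IMul (IVar ''N'') (IConst 2))) (Set_index ''m'' (IAdd (IVar ''m'') (IConst 1))))
          Skip))
       (Set_index ''M'' (IMul (IMul (IAdd (IVar ''k'') (IConst 1)) (IVar ''S'')) (IVar ''N'')))))"

lemma runs_setup_com:
  assumes init: "initial_state \<sigma> \<rho> n k Al Ar st" and n: "1 \<le> n"
  shows "runs setup_com st
    (\<lambda>i a. a = arr st \<and> (\<exists>m. env \<sigma> \<rho> n k m i \<and> 2 * n < 2 ^ m \<and> 2 ^ m \<le> 4 * n))
    (30 + 3 * k + 8 * (2 * n + 1))"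
proof -
  let ?s = "card (labels \<sigma> \<rho>)"
  let ?base = "\<lambda>i. i ''n'' = n \<and> i ''k'' = k \<and> i ''s'' = ?s \<and> i ''ss'' = ell \<sigma> + 1 \<and>
     i ''qs'' = ell \<sigma> + of_bool (finite \<sigma>) \<and> i ''qr'' = ell \<rho> + of_bool (finite \<rho>)"
  let ?Q1 = "\<lambda>t i a. a = arr st \<and> ?base i \<and> i ''N'' = 1 \<and> i ''m'' = 0 \<and> i ''S'' = ?s ^ t"
  let ?Q2 = "\<lambda>t i a. a = arr st \<and> ?base i \<and> i ''S'' = ?s ^ k \<and>
     i ''N'' = 2 ^ i ''m'' \<and> i ''N'' \<le> 4 * n \<and> (2 * n < i ''N'' \<or> i ''m'' = t)"
  show ?thesis
    unfolding setup_com_def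
  proof (rule runs_Seq[where Q = "?Q1 0" and C = 20 and D = "10 + 3 * k + 8 * (2 * n + 1)"])
    show "runs (Seq (Set_index ''ss'' (IAdd (IVar ''ell_sigma'') (IConst 1)))
       (Seq (Set_index ''s'' (IAdd (IVar ''ss'') (IAdd (IVar ''ell_rho'') (IConst 1))))
       (Seq (Set_index ''qs'' (IAdd (IVar ''ell_sigma'') (IVar ''fin_sigma'')))
       (Seq (Set_index ''qr'' (IAdd (IVar ''ell_rho'') (IVar ''fin_rho'')))
       (Seq (Set_index ''S'' (IConst 1)) (Seq (Set_index ''N'' (IConst 1)) (Set_index ''m'' (IConst 0)))))))) st (?Q1 0) 20"
      using init by (simp add: runs_def initial_state_def card_labels)
    fix r :: state assume r: "?Q1 0 (idx r) (arr r)"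
    show "runs (Seq (For ''t'' (IVar ''k'') (Set_index ''S'' (IMul (IVar ''S'') (IVar ''s''))))
     (Seq (For ''t'' (IAdd (IAdd (IVar ''n'') (IVar ''n'')) (IConst 1))
        (If_less (IVar ''N'') (IAdd (IAdd (IVar ''n'') (IVar ''n'')) (IConst 1))
          (Seq (Set_index ''N'' (IMul (IVar ''N'') (IConst 2))) (Set_index ''m'' (IAdd (IVar ''m'') (IConst 1))))
          Skip))
       (Set_index ''M'' (IMul (IMul (IAdd (IVar ''k'') (IConst 1)) (IVar ''S'')) (IVar ''N''))))) r
      (\<lambda>i a. a = arr st \<and> (\<exists>m. env \<sigma> \<rho> n k m i \<and> 2 * n < 2 ^ m \<and> 2 ^ m \<le> 4 * n))
      (10 + 3 * k + 8 * (2 * n + 1))"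
    proof (rule runs_Seq[where Q = "?Q1 k" and C = "1 + 3 * k" and D = "9 + 8 * (2 * n + 1)"])
      show "runs (For ''t'' (IVar ''k'') (Set_index ''S'' (IMul (IVar ''S'') (IVar ''s'')))) r (?Q1 k) (1 + 3 * k)"
      proof (rule runs_For[where I = ?Q1 and C = 2])
        fix t i and r' :: state assume *: "t < k" "idx r' = i(''t'' := t)" "?Q1 t i (arr r')"
        then show "runs (Set_index ''S'' (IMul (IVar ''S'') (IVar ''s''))) r' (?Q1 (Suc t)) 2"
          by (intro runs_Set_index) (simp_all add: mult.commute)
      qed (use r in simp_all)
      fix r :: state assume r: "?Q1 k (idx r) (arr r)"
      show "runs (Seq (For ''t'' (IAdd (IAdd (IVar ''n'') (IVar ''n'')) (IConst 1))
        (If_less (IVar ''N'') (IAdd (IAdd (IVar ''n'') (IVar ''n'')) (IConst 1))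
          (Seq (Set_index ''N'' (IMul (IVar ''N'') (IConst 2))) (Set_index ''m'' (IAdd (IVar ''m'') (IConst 1))))
          Skip))
       (Set_index ''M'' (IMul (IMul (IAdd (IVar ''k'') (IConst 1)) (IVar ''S'')) (IVar ''N'')))) r
        (\<lambda>i a. a = arr st \<and> (\<exists>m. env \<sigma> \<rho> n k m i \<and> 2 * n < 2 ^ m \<and> 2 ^ m \<le> 4 * n))
        (9 + 8 * (2 * n + 1))"
      proof (rule runs_Seq[where Q = "?Q2 (2 * n + 1)" and C = "3 + 8 * (2 * n + 1)" and D = 5])
        show "runs (For ''t'' (IAdd (IAdd (IVar ''n'') (IVar ''n'')) (IConst 1))
          (If_less (IVar ''N'') (IAdd (IAdd (IVar ''n'') (IVar ''n'')) (IConst 1))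
            (Seq (Set_index ''N'' (IMul (IVar ''N'') (IConst 2))) (Set_index ''m'' (IAdd (IVar ''m'') (IConst 1))))
            Skip)) r (?Q2 (2 * n + 1)) (3 + 8 * (2 * n + 1))"
        proof (rule runs_For[where I = ?Q2 and C = 7])
          show "?Q2 0 (idx r) (arr r)" using r n by simp
          fix t i and r' :: state assume *: "t < 2 * n + 1" "idx r' = i(''t'' := t)" "?Q2 t i (arr r')"
          then show "runs (If_less (IVar ''N'') (IAdd (IAdd (IVar ''n'') (IVar ''n'')) (IConst 1))
            (Seq (Set_index ''N'' (IMul (IVar ''N'') (IConst 2))) (Set_index ''m'' (IAdd (IVar ''m'') (IConst 1))))
            Skip) r' (?Q2 (Suc t)) 7"
            by (auto simp: runs_def)
        qed (use r in simp_all)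
        fix r :: state assume r: "?Q2 (2 * n + 1) (idx r) (arr r)"
        \<comment> \<open>Otherwise every round has doubled \<open>N\<close>, so \<open>N\<close>
          would be \<open>2 ^ (2 * n + 1)\<close>.\<close>
        have "2 * n < idx r ''N''"
        proof (rule ccontr)
          assume "\<not> 2 * n < idx r ''N''"
          then have "2 ^ (2 * n + 1) \<le> 2 * n" using r by auto
          then show False using less_exp[of "2 * n + 1"] by simp
        qed
        then show "runs (Set_index ''M'' (IMul (IMul (IAdd (IVar ''k'') (IConst 1)) (IVar ''S'')) (IVar ''N''))) r
          (\<lambda>i a. a = arr st \<and> (\<exists>m. env \<sigma> \<rho> n k m i \<and> 2 * n < 2 ^ m \<and> 2 ^ m \<le> 4 * n)) 5"
          using r by (intro runs_Set_index conjI exI[of _ "idx r ''m''"]) (simp_all add: env_def)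
      qed simp
    qed simp
  qed simp
qed

section \<open>The complete program and its cost\<close>

definition join_com :: "variant \<Rightarrow> com" where
  "join_com v = Seq (spectrum_com ''Al'' ''L1'' ''L2'')
     (Seq (spectrum_com ''Ar'' ''R1'' ''R2'') (Seq inverse_com (extract_com v)))"

definition join_cost :: "variant \<Rightarrow> nat" where
  "join_cost v =
     ((53 + dops (indicator_exp ''Al'') + dops fourier_exp) * 2 +
      (53 + dops (last_level ''L1'' ''m'') + dops (label_coef eval_exp))) +
     (((53 + dops (indicator_exp ''Ar'') + dops fourier_exp) * 2 +
      (53 + dops (last_level ''R1'' ''m'') + dops (label_coef eval_exp))) +
     (inverse_cost + (9 + dops (update_exp v))))"

lemma runs_join_com:
  assumes env: "env \<sigma> \<rho> n k m (idx s)" and N: "2 * n < 2 ^ m"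
    and A: "Al \<in> tables \<sigma> \<rho> n k" "Ar \<in> tables \<sigma> \<rho> n k"
    and f: "\<And>x. x < card (labels \<sigma> \<rho>) ^ k \<Longrightarrow> arr s ''Al'' x = entry_code (Al (vec_of \<sigma> \<rho> k x))"
    and g: "\<And>x. x < card (labels \<sigma> \<rho>) ^ k \<Longrightarrow> arr s ''Ar'' x = entry_code (Ar (vec_of \<sigma> \<rho> k x))"
  shows "runs (join_com v) s
    (\<lambda>i a. \<forall>c<card (labels \<sigma> \<rho>) ^ k. a ''Ai'' c = entry_code (opt v (achieved \<sigma> \<rho> k Al Ar c)))
    (join_cost v * work \<sigma> \<rho> k m)"
proof -
  let ?S = "card (labels \<sigma> \<rho>) ^ k"
  let ?f = "arr s ''Al''" and ?g = "arr s ''Ar''"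
  let ?Q1 = "\<lambda>i a. env \<sigma> \<rho> n k m i \<and> a ''Ar'' = ?g \<and>
    level \<sigma> \<rho> k m k (a ''L2'') (spectrum \<sigma> \<rho> k (2 ^ m) ?f)"
  let ?Q2 = "\<lambda>i a. env \<sigma> \<rho> n k m i \<and>
    level \<sigma> \<rho> k m k (a ''L2'') (spectrum \<sigma> \<rho> k (2 ^ m) ?f) \<and>
    level \<sigma> \<rho> k m k (a ''R2'') (spectrum \<sigma> \<rho> k (2 ^ m) ?g)"
  let ?Q3 = "\<lambda>i a. env \<sigma> \<rho> n k m i \<and> (\<forall>c<?S. \<forall>v<2 ^ m. a ''W'' (c * 2 ^ m + v) =
    (\<Sum>j<k + 1. \<Sum>q<2 ^ m. unit_root (q * v) (2 ^ m) * inverse_spectrum \<sigma> \<rho> k (2 ^ m) ?f ?g j c q))"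
  have left: "runs (spectrum_com ''Al'' ''L1'' ''L2'') s ?Q1
    (((53 + dops (indicator_exp ''Al'') + dops fourier_exp) * 2 +
      (53 + dops (last_level ''L1'' ''m'') + dops (label_coef eval_exp))) * work \<sigma> \<rho> k m)"
    by (rule runs_weaken[OF runs_spectrum_com[OF env]]) (auto simp: same_def)
  have right: "runs (spectrum_com ''Ar'' ''R1'' ''R2'') r ?Q2
    (((53 + dops (indicator_exp ''Ar'') + dops fourier_exp) * 2 +
      (53 + dops (last_level ''R1'' ''m'') + dops (label_coef eval_exp))) * work \<sigma> \<rho> k m)"
    if "?Q1 (idx r) (arr r)" for r :: state
  proof (rule runs_weaken[OF runs_spectrum_com])
    show "env \<sigma> \<rho> n k m (idx r)" using that by simp
  qed (use that in \<open>auto simp: same_def\<close>)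
  have inv: "runs inverse_com r ?Q3 (inverse_cost * work \<sigma> \<rho> k m)" if "?Q2 (idx r) (arr r)" for r :: state
    using that by (intro runs_inverse_com) simp_all
  have ext: "runs (extract_com v) r
      (\<lambda>i a. \<forall>c<?S. a ''Ai'' c = entry_code (opt v (achieved \<sigma> \<rho> k Al Ar c)))
      ((9 + dops (update_exp v)) * work \<sigma> \<rho> k m)" if r: "?Q3 (idx r) (arr r)" for r :: state
  proof (rule runs_extract_com[OF _ N])
    show "env \<sigma> \<rho> n k m (idx r)" using r by simp
    show "w \<le> 2 * n" if "w \<in> achieved \<sigma> \<rho> k Al Ar c" for c w
      using achieved_le[OF A that] .
    fix c w assume cw: "c < ?S" "w \<le> 2 * n"
    have "(2 ^ m - w) mod 2 ^ m < (2 :: nat) ^ m" by simp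
    then have "arr r ''W'' (c * 2 ^ m + (2 ^ m - w) mod 2 ^ m) =
        (\<Sum>j<k + 1. \<Sum>q<2 ^ m. unit_root (q * ((2 ^ m - w) mod 2 ^ m)) (2 ^ m) *
          inverse_spectrum \<sigma> \<rho> k (2 ^ m) ?f ?g j c q)"
      using r cw(1) by blast
    then show "arr r ''W'' (c * 2 ^ m + (2 ^ m - w) mod 2 ^ m) = 0 \<longleftrightarrow> w \<notin> achieved \<sigma> \<rho> k Al Ar c"
      using counting_zero_iff[OF refl N cw(2) A f g] by simp
  qed
  show ?thesis
    unfolding join_com_def join_cost_def
    by (rule runs_Seq[OF left runs_Seq[OF right runs_Seq[OF inv ext order_refl] order_refl]])
      (simp_all add: algebra_simps)
qed

text \<open>With \<open>X\<close> for the logarithmic factor, \<open>s \<ge> 2\<close> gives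
  \<open>ln s \<ge> 1 / 2\<close> and so \<open>k \<le> 2 * X\<close>; this also keeps
  \<open>X\<close> away from 0 when \<open>n = 1\<close>. The constant is
  \<open>96 = 2 * 4 * 12\<close>, from \<open>k + 1 \<le> 2 * k\<close>,
  \<open>2 ^ m \<le> 4 * n\<close>, and \<open>12 = 8 + 4\<close> for the two summands of the
  bracket in \<open>work\<close>.\<close>

lemma work_bound:
  assumes "2 ^ m \<le> 4 * n" "1 \<le> n" "1 \<le> k" and s: "s = card (labels \<sigma> \<rho>)"
  shows "real (work \<sigma> \<rho> k m) \<le>
    96 * (real s ^ (k + 1) * real k * real n * (real k * ln (real s) + ln (real n)))"
proof -
  define X where "X = real k * ln (real s) + ln (real n)"
  have s2: "2 \<le> s" by (simp add: s card_labels)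
  have ln2: "1 / 2 \<le> ln (2 :: real)" using ln_le_minus_one[of "1 / 2 :: real"] by (simp add: ln_div)
  also have "ln (2 :: real) \<le> ln (real s)" using s2 by simp
  finally have lns: "1 / 2 \<le> ln (real s)" .
  have "real k * (1 / 2) \<le> real k * ln (real s)" using lns by (rule mult_left_mono) simp
  moreover have lnn: "0 \<le> ln (real n)" using assms(2) by simp
  ultimately have kX: "real k \<le> 2 * X" and nX: "ln (real n) \<le> X" unfolding X_def using lns by auto
  have X1: "1 \<le> 2 * X" using kX assms(3) by linarith
  have "real (2 ^ m) \<le> real (4 * n)" using assms(1) by (rule of_nat_mono)
  then have le: "2 ^ m \<le> real (4 * n)" by simp
  have "real m * ln 2 = ln (2 ^ m)" by (simp add: ln_realpow)
  also have "\<dots> \<le> ln (real (4 * n))"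
    using le by (rule ln_mono) simp
  also have "\<dots> = ln ((2 :: real) ^ 2) + ln (real n)" using assms(2) by (simp add: ln_mult)
  also have "ln ((2 :: real) ^ 2) = 2 * ln 2" by (subst ln_realpow) simp_all
  finally have "(real m - 2) * ln 2 \<le> ln (real n)" by (simp add: algebra_simps)
  then have "real m - 2 \<le> 2 * ln (real n)"
  proof (cases "2 \<le> m")
    case True
    have "(real m - 2) * (1 / 2) \<le> (real m - 2) * ln 2"
      using True ln2 by (intro mult_left_mono) auto
    also note \<open>(real m - 2) * ln 2 \<le> ln (real n)\<close>
    finally show ?thesis by simp
  qed (use lnn in simp)
  then have m: "real m + 1 \<le> 8 * X" using nX X1 by linarith
  have "8 * X * 1 \<le> 8 * X * real s" using s2 X1 by (intro mult_left_mono) auto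
  then have m': "real m + 1 \<le> 8 * (X * real s)" using m unfolding mult_1_right mult.assoc by (rule order_trans[rotated])
  have "(real k + 1) * real s \<le> 4 * X * real s"
    using kX assms(3) by (intro mult_right_mono) auto
  then have brack: "real (m + 1 + (k + 1) * s) \<le> 12 * (X * real s)"
    using m' by (simp add: algebra_simps)
  have "real ((k + 1) * s ^ k * 2 ^ m) \<le> (2 * real k) * real s ^ k * (4 * real n)"
  proof -
    have "(k + 1) * s ^ k * 2 ^ m \<le> (2 * k) * s ^ k * (4 * n)"
      using assms by (intro mult_le_mono) auto
    then have "real ((k + 1) * s ^ k * 2 ^ m) \<le> real ((2 * k) * s ^ k * (4 * n))"
      by (rule of_nat_mono)
    then show ?thesis by simp
  qed
  then have "real ((k + 1) * s ^ k * 2 ^ m) * real (m + 1 + (k + 1) * s) \<le>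
      ((2 * real k) * real s ^ k * (4 * real n)) * (12 * (X * real s))"
    using brack by (rule mult_mono) auto
  also have "\<dots> = 96 * (real s ^ (k + 1) * real k * real n * X)" by simp
  finally show ?thesis by (simp only: work_def s[symmetric] X_def of_nat_mult)
qed

theorem theorem2:
  fixes v :: variant
  shows "\<exists>(prog :: com) (K :: real).
    \<forall>(\<sigma> :: nat set) (\<rho> :: nat set) (n :: nat) (k :: nat) (s :: nat).
      fin_or_cofin \<sigma> \<longrightarrow> fin_or_cofin \<rho> \<longrightarrow> s = card (labels \<sigma> \<rho>) \<longrightarrow> 1 \<le> n \<longrightarrow> 1 \<le> k \<longrightarrow>
      (\<forall>Al \<in> tables \<sigma> \<rho> n k. \<forall>Ar \<in> tables \<sigma> \<rho> n k. \<forall>st.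
        initial_state \<sigma> \<rho> n k Al Ar st \<longrightarrow>
        holds_table \<sigma> \<rho> k (exec prog st) ''Ai'' (join v \<sigma> \<rho> k Al Ar) \<and>
        real (ops (exec prog st)) \<le>
          K * (real s ^ (k + 1) * real k * real n * (real k * ln (real s) + ln (real n))))"
proof (intro exI allI impI ballI)
  \<comment> \<open>Program and constant stay schematic until the last \<open>show\<close>. They
    cannot refer to anything fixed from here on, which is exactly the uniformity that is
    claimed.\<close>
  fix \<sigma> \<rho> :: "nat set" and n k s :: nat and Al Ar :: table and st :: state
  assume s: "s = card (labels \<sigma> \<rho>)" and n: "1 \<le> n" and k: "1 \<le> k"
    and A: "Al \<in> tables \<sigma> \<rho> n k" "Ar \<in> tables \<sigma> \<rho> n k"
    and init: "initial_state \<sigma> \<rho> n k Al Ar st"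
  let ?r = "exec setup_com st" and ?prog = "Seq setup_com (join_com v)"
  let ?bound = "real s ^ (k + 1) * real k * real n * (real k * ln (real s) + ln (real n))"
  obtain m where m: "env \<sigma> \<rho> n k m (idx ?r)" "2 * n < 2 ^ m" "2 ^ m \<le> 4 * n"
    and arr: "arr ?r = arr st" and cost: "ops ?r \<le> ops st + (30 + 3 * k + 8 * (2 * n + 1))"
    using runs_setup_com[OF init n] unfolding runs_def by blast
  have table: "arr ?r X x = entry_code (B (vec_of \<sigma> \<rho> k x))"
    if "holds_table \<sigma> \<rho> k st X B" "x < card (labels \<sigma> \<rho>) ^ k" for X B x
  proof -
    have "vec_of \<sigma> \<rho> k x \<in> label_vecs \<sigma> \<rho> k" using that(2) by (simp add: label_vecs_eq)
    with that(1) have "arr st X (vec_index \<sigma> \<rho> (vec_of \<sigma> \<rho> k x)) = entry_code (B (vec_of \<sigma> \<rho> k x))"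
      unfolding holds_table_def by (rule bspec)
    then show ?thesis by (simp only: vec_index_vec_of[OF that(2)] arr)
  qed
  have "runs (join_com v) ?r
    (\<lambda>i a. \<forall>c<card (labels \<sigma> \<rho>) ^ k. a ''Ai'' c = entry_code (opt v (achieved \<sigma> \<rho> k Al Ar c)))
    (join_cost v * work \<sigma> \<rho> k m)"
    using m(1,2) A by (rule runs_join_com) (use init table in \<open>auto simp: initial_state_def\<close>)
  then have Ai: "\<And>c. c < card (labels \<sigma> \<rho>) ^ k \<Longrightarrow>
      arr (exec ?prog st) ''Ai'' c = entry_code (opt v (achieved \<sigma> \<rho> k Al Ar c))"
    and cost': "ops (exec ?prog st) \<le> ops ?r + join_cost v * work \<sigma> \<rho> k m"
    by (simp_all add: runs_def)
  \<comment> \<open>The setup cost is at most \<open>30 + 3 + 8 = 41\<close> times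
    \<open>work\<close>, since \<open>1\<close>, \<open>k\<close> and
    \<open>2 * n + 1 \<le> 2 ^ m\<close> are each bounded by it.\<close>
  have "30 + 3 * k + 8 * (2 * n + 1) \<le> 41 * work \<sigma> \<rho> k m"
  proof -
    have "k \<le> work \<sigma> \<rho> k m" "2 * n + 1 \<le> work \<sigma> \<rho> k m" "1 \<le> work \<sigma> \<rho> k m"
      using m(2) work_ge(4,5)[where k = k and m = m and \<sigma> = \<sigma> and \<rho> = \<rho>] by simp_all
    then show ?thesis by simp
  qed
  then have "ops (exec ?prog st) \<le> (41 + join_cost v) * work \<sigma> \<rho> k m"
    using cost cost' init by (simp add: initial_state_def algebra_simps)
  then have "real (ops (exec ?prog st)) \<le> real (41 + join_cost v) * real (work \<sigma> \<rho> k m)"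
    by (simp only: of_nat_mult[symmetric] of_nat_le_iff)
  also have "\<dots> \<le> real (41 + join_cost v) * (96 * ?bound)"
    using work_bound[OF m(3) n k s] by (rule mult_left_mono) simp
  finally have "real (ops (exec ?prog st)) \<le> (real (41 + join_cost v) * 96) * ?bound"
    by (simp only: mult.assoc)
  moreover have "holds_table \<sigma> \<rho> k (exec ?prog st) ''Ai'' (join v \<sigma> \<rho> k Al Ar)"
    unfolding holds_table_def label_vecs_eq
  proof (rule ballI, elim imageE)
    fix c x assume "c = vec_of \<sigma> \<rho> k x" "x \<in> {..<card (labels \<sigma> \<rho>) ^ k}"
    then show "arr (exec ?prog st) ''Ai'' (vec_index \<sigma> \<rho> c) = entry_code (join v \<sigma> \<rho> k Al Ar c)"
      using Ai by (simp only: lessThan_iff vec_index_vec_of join_vec_of)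
  qed
  ultimately show "holds_table \<sigma> \<rho> k (exec ?prog st) ''Ai'' (join v \<sigma> \<rho> k Al Ar) \<and>
      real (ops (exec ?prog st)) \<le> (real (41 + join_cost v) * 96) * ?bound"
    by blast
qed

end
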